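(* Let $Y$ follow a selective Gaussian distribution with base model $\{N(\theta,\Sigma)\colon\theta\in\mathbb{R}^p\}$ and selection function $p(y)$, where $\Sigma\succ0$ is known. A probability-matching prior for $\theta$ exists if and only if the selection function can be written, for almost every $y\in\mathbb{R}^p$, as $$\log p(y)=y^\top Ay+b^\top y+c\quad\text{for some }A\in\mathbb{R}^{p\times p},\ b\in\mathbb{R}^p,\ c\in\mathbb{R},$$ where $A=A^\top$ and $\Sigma^{-1}-2A\succ0$. In this case, the selective distribution is $$Y\sim N\left((\Sigma^{-1}-2A)^{-1}(\Sigma^{-1}\theta+b),\,(\Sigma^{-1}-2A)^{-1}\right)$$ and the probability-matching prior is the improper uniform prior on $\theta$, $\pi(\theta)\propto1$.
   Context: For a symmetric matrix $B$, $B\succ0$ means $B$ is positive definite. **Selective Gaussian distribution.** Given a measurable selection function $p\colon\mathbb{R}^p\to[0,\infty)$ with $\varphi(\theta)=E[p(X)]$, $X\sim N(\theta,\Sigma)$, positive and finite for every $\theta\in\mathbb{R}^p$, the selective Gaussian distribution with base model $\{N(\theta,\Sigma)\colon\theta\in\mathbb{R}^p\}$ and selection function $p$ has density $f_\theta(y)\,p(y)/\varphi(\theta)$, where $f_\theta$ is the $N(\theta,\Sigma)$ density. **Posterior.** A prior is a fixed (not data-dependent), possibly improper, density $\pi(\theta)\ge0$ on $\mathbb{R}^p$ that is valid in the sense that it yields a proper posterior; the posterior density is $\pi(\theta\mid y)\propto\pi(\theta)f_\theta(y)p(y)/\varphi(\theta)$ as a function of $\theta$. Priors are identified up to multiplicative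 constants (and null sets). **Probability-matching prior.** A prior density for $\theta$ is (exactly) probability-matching if $\Pi(\theta_0\mid Y)\sim U(0,1)$ under repeated sampling of $Y$ from the selective distribution with true parameter $\theta_0$, for every $\theta_0$, where $\Pi(\cdot\mid Y)$ is the marginal posterior distribution function induced by the prior. For $p>1$ this is understood for scalar linear subparameters: for every nonzero $v\in\mathbb{R}^p$ and every true $\theta_0\in\mathbb{R}^p$, $\Pi_v(v^\top\theta_0\mid Y)\sim U(0,1)$, where $\Pi_v(\cdot\mid Y)$ is the marginal posterior distribution function of $v^\top\theta$. *)

theory Defs
  imports "HOL-Probability.Probability"
begin

definition pos_def :: "real ^ 'n ^ 'n \<Rightarrow> bool" where
  "pos_def B \<longleftrightarrow> transpose B = B \<and> (\<forall>x. x \<noteq> 0 \<longrightarrow> 0 < x \<bullet> (B *v x))"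

definition gauss_density :: "real ^ 'n \<Rightarrow> real ^ 'n ^ 'n \<Rightarrow> real ^ 'n \<Rightarrow> real" where
  "gauss_density \<mu> S y =
     exp (- ((y - \<mu>) \<bullet> (matrix_inv S *v (y - \<mu>))) / 2) / sqrt ((2 * pi) ^ CARD('n) * det S)"

definition gauss_measure :: "real ^ 'n \<Rightarrow> real ^ 'n ^ 'n \<Rightarrow> (real ^ 'n) measure" where
  "gauss_measure \<mu> S = density lborel (\<lambda>y. ennreal (gauss_density \<mu> S y))"

definition selection_prob ::
    "real ^ 'n ^ 'n \<Rightarrow> (real ^ 'n \<Rightarrow> real) \<Rightarrow> real ^ 'n \<Rightarrow> real" where
  "selection_prob \<Sigma> p \<theta> = (\<integral>x. p x \<partial>gauss_measure \<theta> \<Sigma>)"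

text \<open>Integrability is required explicitly, because the Bochner integral of a
  non-integrable function is \<open>0\<close>.\<close>

definition selection_function :: "real ^ 'n ^ 'n \<Rightarrow> (real ^ 'n \<Rightarrow> real) \<Rightarrow> bool" where
  "selection_function \<Sigma> p \<longleftrightarrow>
     p \<in> borel_measurable borel \<and> (\<forall>y. 0 \<le> p y) \<and>
     (\<forall>\<theta>. integrable (gauss_measure \<theta> \<Sigma>) p \<and> 0 < selection_prob \<Sigma> p \<theta>)"

definition selective_density ::
    "real ^ 'n ^ 'n \<Rightarrow> (real ^ 'n \<Rightarrow> real) \<Rightarrow> real ^ 'n \<Rightarrow> real ^ 'n \<Rightarrow> real" where
  "selective_density \<Sigma> p \<theta> y = gauss_density \<theta> \<Sigma> y * p y / selection_prob \<Sigma> p \<theta>"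

definition selective_measure ::
    "real ^ 'n ^ 'n \<Rightarrow> (real ^ 'n \<Rightarrow> real) \<Rightarrow> real ^ 'n \<Rightarrow> (real ^ 'n) measure" where
  "selective_measure \<Sigma> p \<theta> = density lborel (\<lambda>y. ennreal (selective_density \<Sigma> p \<theta> y))"

text \<open>Properness of the posterior is required for almost every \<open>y\<close> that can be observed.
  Where \<open>p y = 0\<close> the product of prior and likelihood vanishes identically in \<open>\<theta>\<close>, so no
  posterior exists there; such \<open>y\<close> form a null set of every selective distribution.\<close>

definition valid_prior ::
    "real ^ 'n ^ 'n \<Rightarrow> (real ^ 'n \<Rightarrow> real) \<Rightarrow> (real ^ 'n \<Rightarrow> real) \<Rightarrow> bool" where
  "valid_prior \<Sigma> p \<pi> \<longleftrightarrow>
     \<pi> \<in> borel_measurable borel \<and> (\<forall>\<theta>. 0 \<le> \<pi> \<theta>) \<and>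
     (AE y in lborel. 0 < p y \<longrightarrow>
        integrable lborel (\<lambda>\<theta>. \<pi> \<theta> * selective_density \<Sigma> p \<theta> y) \<and>
        0 < (\<integral>\<theta>. \<pi> \<theta> * selective_density \<Sigma> p \<theta> y \<partial>lborel))"

definition posterior_measure ::
    "real ^ 'n ^ 'n \<Rightarrow> (real ^ 'n \<Rightarrow> real) \<Rightarrow> (real ^ 'n \<Rightarrow> real) \<Rightarrow> real ^ 'n \<Rightarrow> (real ^ 'n) measure" where
  "posterior_measure \<Sigma> p \<pi> y =
     density lborel (\<lambda>\<theta>. ennreal (\<pi> \<theta> * selective_density \<Sigma> p \<theta> y /
       (\<integral>\<eta>. \<pi> \<eta> * selective_density \<Sigma> p \<eta> y \<partial>lborel)))"

definition marginal_posterior_cdf ::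
    "real ^ 'n ^ 'n \<Rightarrow> (real ^ 'n \<Rightarrow> real) \<Rightarrow> (real ^ 'n \<Rightarrow> real) \<Rightarrow>
     real ^ 'n \<Rightarrow> real ^ 'n \<Rightarrow> real \<Rightarrow> real" where
  "marginal_posterior_cdf \<Sigma> p \<pi> v y = cdf (distr (posterior_measure \<Sigma> p \<pi> y) borel (\<lambda>\<theta>. v \<bullet> \<theta>))"

text \<open>In dimension one, all nonzero \<open>v\<close> give conditions equivalent to the one for \<open>v = 1\<close>:
  scaling by a positive factor leaves the marginal posterior distribution function at the true
  value unchanged, and a sign change replaces it by its complement to \<open>1\<close>.\<close>

definition probability_matching ::
    "real ^ 'n ^ 'n \<Rightarrow> (real ^ 'n \<Rightarrow> real) \<Rightarrow> (real ^ 'n \<Rightarrow> real) \<Rightarrow> bool" where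
  "probability_matching \<Sigma> p \<pi> \<longleftrightarrow>
     valid_prior \<Sigma> p \<pi> \<and>
     (\<forall>v \<theta>\<^sub>0. v \<noteq> 0 \<longrightarrow>
        distributed (selective_measure \<Sigma> p \<theta>\<^sub>0) lborel
          (\<lambda>y. marginal_posterior_cdf \<Sigma> p \<pi> v y (v \<bullet> \<theta>\<^sub>0)) (indicator {0..1}))"

text \<open>The conjunct \<open>0 < p y\<close> is needed because of the convention \<open>ln 0 = 0\<close>.\<close>

definition log_quadratic_selection ::
    "real ^ 'n ^ 'n \<Rightarrow> (real ^ 'n \<Rightarrow> real) \<Rightarrow> real ^ 'n ^ 'n \<Rightarrow> real ^ 'n \<Rightarrow> real \<Rightarrow> bool" where
  "log_quadratic_selection \<Sigma> p A b c \<longleftrightarrow>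
     transpose A = A \<and> pos_def (matrix_inv \<Sigma> - 2 *\<^sub>R A) \<and>
     (AE y in lborel. 0 < p y \<and> ln (p y) = y \<bullet> (A *v y) + b \<bullet> y + c)"

end

theory Submission
  imports Defs
begin

text \<open>Write \<open>Q = \<Sigma>\<inverse>\<close>. The selective density factors as \<open>m \<theta> * h y * exp ((Q *v \<theta>) \<bullet> y)\<close> with
\<open>h y = exp (- (y \<bullet> (Q *v y)) / 2) * p y\<close>, and the posterior density as
\<open>R \<theta> * exp ((Q *v \<theta>) \<bullet> y) / Z y\<close> with \<open>R \<theta> = \<pi> \<theta> * m \<theta>\<close>, where \<open>Z y\<close> is the integral of
\<open>R \<theta> * exp ((Q *v \<theta>) \<bullet> y)\<close>. Data and parameter thus play symmetric roles: \<open>1 / m\<close> is the Laplace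
transform of \<open>h\<close>, and \<open>Z\<close> is that of \<open>R\<close>. (Below, \<open>h\<close>, \<open>m\<close>, \<open>R\<close> and \<open>Z\<close> are \<open>sel_base\<close>,
\<open>sel_norm\<close>, \<open>prior_weight\<close> and \<open>Zc\<close>.)

\<^bold>\<open>Matching forces a quadratic.\<close> Fix \<open>v \<noteq> 0\<close> and put \<open>w = \<Sigma> *v v\<close>. The parameters with \<open>v \<bullet> \<theta> = t\<close> are
those whose tilt \<open>z = Q *v \<theta>\<close> lies in the hyperplane \<open>z \<bullet> w = t\<close>. These tilts form a complete family
for the data modulo \<open>w\<close>, so uniformity under all of them means uniformity conditionally on almost
every line \<open>y + s *\<^sub>R w\<close> (\<open>laplace_zero_on_hyperplane_imp_AE_lines\<close>). Conditionally on a line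
the problem is one-dimensional. The posterior distribution function \<open>G\<close> at \<open>t\<close> is then monotone in
\<open>s\<close>, so that uniformity identifies \<open>1 - G\<close> with the conditional distribution function of the data.
Differentiating this identity in \<open>t\<close> isolates the prior \<open>r\<close> of the line problem, and
differentiating once more in \<open>s\<close> gives
\<open>(K t - s) * (h s * Z s) = r t * (t - Z' s / Z s)\<close>, where \<open>K t\<close> is the mean of the data on the line.
Eliminating \<open>K t\<close> between two values of \<open>s\<close> shows that \<open>r t\<close> times an affine function of \<open>t\<close> is a
non-zero constant for all real \<open>t\<close>. An affine function without zero is constant, hence \<open>r\<close>
and \<open>h * Z\<close> are constant, \<open>K\<close> is affine, and \<open>ln Z\<close> is a quadratic function with positive leading
coefficient on the line (\<open>gaussian_line\<close>).

Back in the full space, \<open>h * Z\<close> is constant on almost every line of every direction. It is therefore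
invariant under every translation up to null sets, and so almost everywhere equal to a constant
\<open>C > 0\<close>. The function \<open>Z\<close> is finite, convex and hence continuous, and \<open>ln Z\<close> is quadratic on all
lines, thus a quadratic polynomial with positive definite leading part. The formula for \<open>p\<close> follows
from \<open>h = C / Z\<close> (\<open>matching_imp_log_quadratic\<close>).

\<^bold>\<open>A quadratic suffices.\<close> If \<open>ln p\<close> is quadratic, the selective distribution is Gaussian by completing
the square. For the flat prior, \<open>\<theta> - post_mean y\<close> has one and the same Gaussian law under the
posterior of \<open>\<theta>\<close> given \<open>y\<close> and under sampling of \<open>y\<close> given \<open>\<theta>\<close>. The posterior distribution function
of \<open>v \<bullet> \<theta>\<close> at the true value is therefore \<open>F W\<close>, where \<open>W\<close> has the continuous distribution function
\<open>F\<close>, and this is uniform (\<open>flat_prior_matching\<close>).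

\<^bold>\<open>Uniqueness.\<close> The functions \<open>Z\<close> of two matching priors are both proportional to \<open>1 / h\<close>, hence to each
other, and a Laplace transform determines \<open>R\<close> up to null sets (\<open>matching_prior_unique\<close>).\<close>

section \<open>Uniqueness of Laplace transforms\<close>

lemma abs_exp_minus_linear_le:
  fixes u :: real
  shows "\<bar>exp u - 1 - u\<bar> \<le> u\<^sup>2 / 2 * exp \<bar>u\<bar>"
proof -
  obtain t where t: "\<bar>t\<bar> \<le> \<bar>u\<bar>" "exp u = (\<Sum>m<2. u ^ m / fact m) + exp t / fact 2 * u ^ 2"
    using Maclaurin_exp_le[of u 2] by blast
  have "exp u - 1 - u = exp t * (u\<^sup>2 / 2)"
    using t(2) by (simp add: numeral_2_eq_2)
  moreover have "exp t \<le> exp \<bar>u\<bar>" using t(1) by simp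
  ultimately show ?thesis
    by (simp only: abs_mult) (simp add: mult_right_mono mult.commute)
qed

lemma half_square_le_exp_abs:
  fixes u :: real
  shows "u\<^sup>2 / 2 \<le> exp \<bar>u\<bar>"
proof -
  have "1 + \<bar>u\<bar> + \<bar>u\<bar>\<^sup>2 / 2 \<le> exp \<bar>u\<bar>" by (rule exp_lower_Taylor_quadratic) simp
  moreover have "\<bar>u\<bar>\<^sup>2 = u\<^sup>2" by simp
  ultimately show ?thesis by linarith
qed

text \<open>The bound that makes Laplace transforms differentiable: the error of the linear approximation of
\<open>exp (d * x)\<close> is quadratic in \<open>d\<close>, uniformly in \<open>x\<close> once the factor is absorbed into
exponentials whose integrability is at hand.\<close>

lemma abs_exp_increment_le:
  fixes d e x :: real
  assumes "0 < e" "\<bar>d\<bar> \<le> e"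
  shows "\<bar>exp (d * x) - 1 - d * x\<bar> \<le> (d / e)\<^sup>2 * (exp (2 * e * x) + exp (- (2 * e * x)))"
proof -
  have "\<bar>exp (d * x) - 1 - d * x\<bar> \<le> (d * x)\<^sup>2 / 2 * exp \<bar>d * x\<bar>"
    by (rule abs_exp_minus_linear_le)
  also have "\<dots> \<le> (d * x)\<^sup>2 / 2 * exp \<bar>e * x\<bar>"
    using assms by (intro mult_left_mono) (auto simp: abs_mult mult_right_mono)
  also have "\<dots> = (d / e)\<^sup>2 * ((e * x)\<^sup>2 / 2 * exp \<bar>e * x\<bar>)"
    using assms by (simp add: field_simps power2_eq_square)
  also have "\<dots> \<le> (d / e)\<^sup>2 * (exp \<bar>e * x\<bar> * exp \<bar>e * x\<bar>)"
    by (intro mult_left_mono mult_right_mono half_square_le_exp_abs) auto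
  also have "exp \<bar>e * x\<bar> * exp \<bar>e * x\<bar> \<le> exp (2 * e * x) + exp (- (2 * e * x))"
    by (cases "0 \<le> e * x") (auto simp flip: exp_add simp: abs_if mult.assoc)
  finally show ?thesis by (simp add: mult_left_mono)
qed

text \<open>Differentiation under the integral sign. The weight \<open>f\<close> may change sign and the function \<open>\<phi>\<close> is
arbitrary, so the lemma can be iterated (with \<open>f * \<phi>\<close> for \<open>f\<close>) and serves for data and parameter
alike.\<close>

lemma laplace_has_derivative:
  fixes f \<phi> :: "'a \<Rightarrow> real"
  assumes [measurable]: "f \<in> borel_measurable M" "\<phi> \<in> borel_measurable M"
    and I: "open I" "t \<in> I"
    and int: "\<And>s. s \<in> I \<Longrightarrow> integrable M (\<lambda>x. f x * exp (s * \<phi> x))"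
  shows "integrable M (\<lambda>x. f x * \<phi> x * exp (t * \<phi> x))"
    and "((\<lambda>s. \<integral>x. f x * exp (s * \<phi> x) \<partial>M) has_real_derivative
          (\<integral>x. f x * \<phi> x * exp (t * \<phi> x) \<partial>M)) (at t)"
proof -
  obtain r where r: "0 < r" "ball t r \<subseteq> I" using I openE by blast
  \<comment> \<open>Tilts up to \<open>t + 2 * e\<close> and down to \<open>t - 2 * e\<close> are used, hence a third of the radius.\<close>
  define e where "e = r / 3"
  have e: "0 < e" using r by (simp add: e_def)
  have inI: "t + d \<in> I" if "\<bar>d\<bar> \<le> 2 * e" for d
    using that r by (intro subsetD[OF r(2)]) (auto simp: e_def dist_real_def)
  define B where "B x = \<bar>f x\<bar> * exp (t * \<phi> x) * (exp (2 * e * \<phi> x) + exp (- (2 * e * \<phi> x)))" for x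
  have B_eq: "B x = \<bar>f x * exp ((t + 2 * e) * \<phi> x)\<bar> + \<bar>f x * exp ((t + - (2 * e)) * \<phi> x)\<bar>" for x
    by (simp add: B_def abs_mult algebra_simps flip: exp_add)
  have intB: "integrable M B"
    unfolding B_eq using e by (intro Bochner_Integration.integrable_add integrable_abs int inI) auto
  have bnd: "\<bar>f x * exp ((t + d) * \<phi> x) - f x * exp (t * \<phi> x) - d * (f x * \<phi> x * exp (t * \<phi> x))\<bar>
      \<le> (d / e)\<^sup>2 * B x" if "\<bar>d\<bar> \<le> e" for d x
  proof -
    have "f x * exp ((t + d) * \<phi> x) - f x * exp (t * \<phi> x) - d * (f x * \<phi> x * exp (t * \<phi> x))
        = (f x * exp (t * \<phi> x)) * (exp (d * \<phi> x) - 1 - d * \<phi> x)"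
      by (simp add: algebra_simps exp_add)
    then have "\<bar>f x * exp ((t + d) * \<phi> x) - f x * exp (t * \<phi> x) - d * (f x * \<phi> x * exp (t * \<phi> x))\<bar>
        = (\<bar>f x\<bar> * exp (t * \<phi> x)) * \<bar>exp (d * \<phi> x) - 1 - d * \<phi> x\<bar>"
      by (simp add: abs_mult)
    also have "\<dots> \<le> (\<bar>f x\<bar> * exp (t * \<phi> x)) * ((d / e)\<^sup>2 * (exp (2 * e * \<phi> x) + exp (- (2 * e * \<phi> x))))"
      by (intro mult_left_mono abs_exp_increment_le e that) auto
    finally show ?thesis by (simp add: B_def mult_ac)
  qed
  show intd: "integrable M (\<lambda>x. f x * \<phi> x * exp (t * \<phi> x))"
  proof -
    have "integrable M (\<lambda>x. e * (f x * \<phi> x * exp (t * \<phi> x)))"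
    proof (rule Bochner_Integration.integrable_bound)
      show "integrable M (\<lambda>x. B x + \<bar>f x * exp ((t + e) * \<phi> x)\<bar> + \<bar>f x * exp ((t + 0) * \<phi> x)\<bar>)"
        using e by (intro Bochner_Integration.integrable_add integrable_abs int inI intB) auto
      show "AE x in M. norm (e * (f x * \<phi> x * exp (t * \<phi> x))) \<le> norm (B x + \<bar>f x * exp ((t + e) * \<phi> x)\<bar> + \<bar>f x * exp ((t + 0) * \<phi> x)\<bar>)"
      proof (intro AE_I2)
        fix x
        have "\<bar>f x * exp ((t + e) * \<phi> x) - f x * exp (t * \<phi> x) - e * (f x * \<phi> x * exp (t * \<phi> x))\<bar> \<le> B x"
          using bnd[of e x] e by simp
        then show "norm (e * (f x * \<phi> x * exp (t * \<phi> x))) \<le> norm (B x + \<bar>f x * exp ((t + e) * \<phi> x)\<bar> + \<bar>f x * exp ((t + 0) * \<phi> x)\<bar>)"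
          by simp
      qed
    qed simp
    then show ?thesis using e by simp
  qed
  define F where "F s = (\<integral>x. f x * exp (s * \<phi> x) \<partial>M)" for s
  define D where "D = (\<integral>x. f x * \<phi> x * exp (t * \<phi> x) \<partial>M)"
  define C where "C = (\<integral>x. B x \<partial>M) / e\<^sup>2"
  have est: "\<bar>F (t + d) - F t - d * D\<bar> \<le> d\<^sup>2 * C" if d: "\<bar>d\<bar> \<le> e" for d
  proof -
    have i1: "integrable M (\<lambda>x. f x * exp ((t + d) * \<phi> x))" using d e by (intro int inI) auto
    have i2: "integrable M (\<lambda>x. f x * exp (t * \<phi> x))" using I by (intro int) auto
    have "F (t + d) - F t - d * D
        = (\<integral>x. f x * exp ((t + d) * \<phi> x) - f x * exp (t * \<phi> x) - d * (f x * \<phi> x * exp (t * \<phi> x)) \<partial>M)"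
      using i1 i2 intd by (simp add: F_def D_def)
    also have "\<bar>\<dots>\<bar> \<le> (\<integral>x. (d / e)\<^sup>2 * B x \<partial>M)"
      by (rule order_trans[OF integral_abs_bound integral_mono])
        (use i1 i2 intd intB bnd[OF d] in auto)
    also have "\<dots> = d\<^sup>2 * C" by (simp add: C_def power_divide)
    finally show ?thesis .
  qed
  have "((\<lambda>d. (F (t + d) - F t) / d - D) \<longlongrightarrow> 0) (at 0)"
  proof (rule Lim_null_comparison)
    show "((\<lambda>d. \<bar>d\<bar> * C) \<longlongrightarrow> 0) (at 0)" by (auto intro!: tendsto_eq_intros)
    have "eventually (\<lambda>d. \<bar>d\<bar> < e \<and> d \<noteq> 0) (at (0::real))"
      using e unfolding eventually_at by (auto simp: dist_real_def intro!: exI[of _ e])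
    then show "eventually (\<lambda>d. norm ((F (t + d) - F t) / d - D) \<le> \<bar>d\<bar> * C) (at 0)"
    proof eventually_elim
      case (elim d)
      have "\<bar>(F (t + d) - F t) / d - D\<bar> * \<bar>d\<bar> = \<bar>F (t + d) - F t - d * D\<bar>"
        using elim by (simp flip: abs_mult add: field_simps)
      also have "\<dots> \<le> \<bar>d\<bar> * C * \<bar>d\<bar>" using est[of d] elim by (simp add: power2_eq_square mult_ac)
      finally show ?case using elim by (simp add: mult.commute)
    qed
  qed
  then have "((\<lambda>d. (F (t + d) - F t) / d) \<longlongrightarrow> D) (at 0)" by (simp add: LIM_zero_iff)
  then show "((\<lambda>s. \<integral>x. f x * exp (s * \<phi> x) \<partial>M) has_real_derivative (\<integral>x. f x * \<phi> x * exp (t * \<phi> x) \<partial>M)) (at t)"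
    by (simp add: DERIV_def F_def D_def)
qed

text \<open>All derivatives of the vanishing Laplace transform vanish, that is, all moments of \<open>f\<close> in \<open>\<phi>\<close> are
zero. Finite exponential moments allow the exponential series to be integrated term by term at the
imaginary argument.\<close>

lemma laplace_zero_imp_fourier_zero:
  fixes f \<phi> :: "'a \<Rightarrow> real"
  assumes [measurable]: "f \<in> borel_measurable M" "\<phi> \<in> borel_measurable M"
    and int: "\<And>s. integrable M (\<lambda>x. f x * exp (s * \<phi> x))"
    and zero: "\<And>s. (\<integral>x. f x * exp (s * \<phi> x) \<partial>M) = 0"
  shows "(\<integral>x. f x *\<^sub>R iexp (t * \<phi> x) \<partial>M) = 0"
proof -
  have mom: "integrable M (\<lambda>x. f x * \<phi> x ^ k * exp (s * \<phi> x)) \<and> (\<integral>x. f x * \<phi> x ^ k * exp (s * \<phi> x) \<partial>M) = 0" for k s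
  proof (induction k arbitrary: s)
    case 0 then show ?case using int zero by simp
  next
    case (Suc k)
    have z: "(\<lambda>s. \<integral>x. f x * \<phi> x ^ k * exp (s * \<phi> x) \<partial>M) = (\<lambda>s. 0)"
      using Suc by auto
    have *: "integrable M (\<lambda>x. f x * \<phi> x ^ k * \<phi> x * exp (s * \<phi> x))"
      "((\<lambda>s. \<integral>x. f x * \<phi> x ^ k * exp (s * \<phi> x) \<partial>M) has_real_derivative
          (\<integral>x. f x * \<phi> x ^ k * \<phi> x * exp (s * \<phi> x) \<partial>M)) (at s)"
      using Suc by (intro laplace_has_derivative[where I = UNIV]; simp)+
    have "((\<lambda>s::real. 0) has_real_derivative (\<integral>x. f x * \<phi> x ^ k * \<phi> x * exp (s * \<phi> x) \<partial>M)) (at s)"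
      using *(2) unfolding z .
    then have "(\<integral>x. f x * \<phi> x ^ k * \<phi> x * exp (s * \<phi> x) \<partial>M) = 0"
      using DERIV_const DERIV_unique by blast
    with *(1) show ?case by (simp add: mult_ac)
  qed
  have mom0: "integrable M (\<lambda>x. f x * \<phi> x ^ k)" "(\<integral>x. f x * \<phi> x ^ k \<partial>M) = 0" for k
    using mom[of k 0] by auto
  define g where "g k x = (f x * \<phi> x ^ k) *\<^sub>R ((\<i> * of_real t) ^ k / fact k)" for k x
  have nrm: "norm (g k x) = \<bar>f x\<bar> * (\<bar>t * \<phi> x\<bar> ^ k / fact k)" for k x
    by (simp add: g_def norm_mult norm_power norm_divide abs_mult power_mult_distrib power_abs)
  have gint: "integrable M (g k)" for k
    unfolding g_def by (intro integrable_scaleR_left mom0)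
  have g0: "(\<integral>x. g k x \<partial>M) = 0" for k
    unfolding g_def using mom0 by simp
  have gsum: "(\<lambda>k. g k x) sums (f x *\<^sub>R iexp (t * \<phi> x))" for x
  proof -
    have "(\<lambda>k. f x *\<^sub>R ((\<i> * of_real (t * \<phi> x)) ^ k /\<^sub>R fact k)) sums (f x *\<^sub>R iexp (t * \<phi> x))"
      by (intro sums_scaleR_right exp_converges)
    also have "(\<lambda>k. f x *\<^sub>R ((\<i> * of_real (t * \<phi> x)) ^ k /\<^sub>R fact k)) = (\<lambda>k. g k x)"
      by (auto simp: g_def fun_eq_iff scaleR_conv_of_real power_mult_distrib field_simps)
    finally show ?thesis .
  qed
  have ex: "(\<lambda>k. \<bar>t * \<phi> x\<bar> ^ k / fact k) sums exp \<bar>t * \<phi> x\<bar>" for x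
    using exp_converges[of "\<bar>t * \<phi> x\<bar>"] by (simp add: field_simps)
  have nsum: "summable (\<lambda>k. norm (g k x))" for x
    unfolding nrm using ex[of x] by (intro summable_mult) (auto simp: sums_iff)
  define b where "b x = \<bar>f x * exp (t * \<phi> x)\<bar> + \<bar>f x * exp ((- t) * \<phi> x)\<bar>" for x
  have bint: "integrable M b" unfolding b_def by (intro Bochner_Integration.integrable_add integrable_abs int)
  have part: "(\<Sum>k<n. norm (g k x)) \<le> b x" for n x
  proof -
    have "(\<Sum>k<n. \<bar>t * \<phi> x\<bar> ^ k / fact k) \<le> (\<Sum>k. \<bar>t * \<phi> x\<bar> ^ k / fact k)"
      using ex[of x] by (intro sum_le_suminf) (auto simp: sums_iff)
    also have "\<dots> = exp \<bar>t * \<phi> x\<bar>" using ex[of x] by (simp add: sums_iff)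
    finally have "(\<Sum>k<n. norm (g k x)) \<le> \<bar>f x\<bar> * exp \<bar>t * \<phi> x\<bar>"
      unfolding nrm sum_distrib_left[symmetric] by (intro mult_left_mono) auto
    also have "\<dots> \<le> b x"
    proof -
      have "exp \<bar>t * \<phi> x\<bar> \<le> exp (t * \<phi> x) + exp (- (t * \<phi> x))"
        by (cases "0 \<le> t * \<phi> x") (auto simp: abs_if)
      then have "\<bar>f x\<bar> * exp \<bar>t * \<phi> x\<bar> \<le> \<bar>f x\<bar> * (exp (t * \<phi> x) + exp (- (t * \<phi> x)))"
        by (intro mult_left_mono) auto
      then show ?thesis by (simp add: b_def abs_mult distrib_left)
    qed
    finally show ?thesis .
  qed
  have "(\<lambda>k. integral\<^sup>L M (g k)) sums (\<integral>x. (\<Sum>k. g k x) \<partial>M)"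
  proof (rule sums_integral)
    show "summable (\<lambda>i. \<integral>x. norm (g i x) \<partial>M)"
    proof (rule summableI_nonneg_bounded)
      fix n
      have "(\<Sum>k<n. \<integral>x. norm (g k x) \<partial>M) = (\<integral>x. (\<Sum>k<n. norm (g k x)) \<partial>M)"
        using gint by simp
      also have "\<dots> \<le> (\<integral>x. b x \<partial>M)"
        using gint bint part by (intro integral_mono) auto
      finally show "(\<Sum>k<n. \<integral>x. norm (g k x) \<partial>M) \<le> (\<integral>x. b x \<partial>M)" .
    qed simp
  qed (use gint nsum in auto)
  then have "(\<lambda>k. 0) sums (\<integral>x. f x *\<^sub>R iexp (t * \<phi> x) \<partial>M)"
    using g0 gsum by (simp add: sums_iff)
  then show ?thesis using sums_unique2 sums_zero by blast
qed

text \<open>The positive and the negative part of \<open>f\<close> have equal mass. Normalised and pushed forward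
along \<open>\<phi>\<close>, they are probability measures with the same characteristic function, so Levy's uniqueness
theorem applies.\<close>

lemma laplace_zero_imp_integral_atMost_zero:
  fixes f \<phi> :: "'a \<Rightarrow> real"
  assumes [measurable]: "f \<in> borel_measurable M" "\<phi> \<in> borel_measurable M"
    and int: "\<And>s. integrable M (\<lambda>x. f x * exp (s * \<phi> x))"
    and zero: "\<And>s. (\<integral>x. f x * exp (s * \<phi> x) \<partial>M) = 0"
  shows "(\<integral>x. f x * indicator {..a} (\<phi> x) \<partial>M) = 0"
proof -
  have f_int: "integrable M f" using int[of 0] by simp
  define fp fn where "fp x = max 0 (f x)" and "fn x = max 0 (- f x)" for x
  have [measurable]: "fp \<in> borel_measurable M" "fn \<in> borel_measurable M"
    unfolding fp_def fn_def by measurable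
  have nn: "0 \<le> fp x" "0 \<le> fn x" for x by (auto simp: fp_def fn_def)
  have ff: "f x = fp x - fn x" for x by (auto simp: fp_def fn_def)
  have pint: "integrable M fp" "integrable M fn"
    unfolding fp_def fn_def using f_int by (auto intro!: integrable_max)
  define m where "m = (\<integral>x. fp x \<partial>M)"
  have mn: "m = (\<integral>x. fn x \<partial>M)"
    using zero[of 0] pint by (simp add: m_def ff)
  show ?thesis
  proof (cases "m = 0")
    case True
    have "AE x in M. fp x = 0" "AE x in M. fn x = 0"
      using True mn integral_nonneg_eq_0_iff_AE[OF pint(1)] integral_nonneg_eq_0_iff_AE[OF pint(2)] nn
      by (auto simp: m_def)
    then have "AE x in M. f x * indicator {..a} (\<phi> x) = 0"
      by eventually_elim (simp add: ff)
    then show ?thesis by (rule integral_eq_zero_AE)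
  next
    case False
    have "0 \<le> m" using nn by (simp add: m_def)
    with False have m: "0 < m" by simp
    define D where "D g = distr (density M (\<lambda>x. ennreal (g x / m))) borel \<phi>" for g
    have D_real: "real_distribution (D g)" if [measurable]: "g \<in> borel_measurable M" and g: "integrable M g" "\<And>x. 0 \<le> g x" "(\<integral>x. g x \<partial>M) = m" for g
    proof -
      have "emeasure (density M (\<lambda>x. ennreal (g x / m))) (space M) = (\<integral>\<^sup>+x. ennreal (g x / m) \<partial>M)"
        by (subst emeasure_density) (auto intro!: nn_integral_cong)
      also have "\<dots> = ennreal (\<integral>x. g x / m \<partial>M)"
        using g m by (intro nn_integral_eq_integral) auto
      also have "\<dots> = 1" using g m by simp
      finally have "prob_space (density M (\<lambda>x. ennreal (g x / m)))" by (intro prob_spaceI) simp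
      then interpret prob_space "density M (\<lambda>x. ennreal (g x / m))" .
      show ?thesis unfolding D_def by (intro real_distribution_distr) simp
    qed
    have D_char: "char (D g) s = (\<integral>x. g x *\<^sub>R iexp (s * \<phi> x) \<partial>M) / m" if [measurable]: "g \<in> borel_measurable M" and g: "integrable M g" "\<And>x. 0 \<le> g x" for g s
    proof -
      have "char (D g) s = (\<integral>x. (1 / m) *\<^sub>R (g x *\<^sub>R iexp (s * \<phi> x)) \<partial>M)"
        unfolding char_def D_def using g m
        by (simp add: integral_distr integral_density)
      then show ?thesis
        by (simp only: integral_scaleR_right) (simp add: scaleR_conv_of_real)
    qed
    have eint: "integrable M (\<lambda>x. g x *\<^sub>R iexp (s * \<phi> x))" if [measurable]: "g \<in> borel_measurable M" and g: "integrable M g" for g :: "'a \<Rightarrow> real" and s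
      by (rule Bochner_Integration.integrable_bound[OF g]) auto
    have "char (D fp) = char (D fn)"
    proof
      fix s
      have "(\<integral>x. fp x *\<^sub>R iexp (s * \<phi> x) \<partial>M) - (\<integral>x. fn x *\<^sub>R iexp (s * \<phi> x) \<partial>M) = (\<integral>x. f x *\<^sub>R iexp (s * \<phi> x) \<partial>M)"
        unfolding ff scaleR_diff_left
        by (rule Bochner_Integration.integral_diff[symmetric]; rule eint) (simp_all add: pint)
      also have "\<dots> = 0" by (rule laplace_zero_imp_fourier_zero) (use int zero in auto)
      finally show "char (D fp) s = char (D fn) s" by (simp add: D_char pint nn)
    qed
    then have eq: "D fp = D fn"
      by (intro Levy_uniqueness D_real pint nn) (auto simp: m_def mn[unfolded m_def])
    have D_meas: "measure (D g) {..a} = (\<integral>x. g x * indicator {..a} (\<phi> x) \<partial>M) / m" if [measurable]: "g \<in> borel_measurable M" and g: "integrable M g" "\<And>x. 0 \<le> g x" for g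
    proof -
      have "measure (D g) {..a} = (\<integral>y. indicator {..a} y \<partial>D g)" by (simp add: D_def)
      also have "\<dots> = (\<integral>x. indicator {..a} (\<phi> x) \<partial>density M (\<lambda>x. ennreal (g x / m)))"
        unfolding D_def by (rule integral_distr) auto
      also have "\<dots> = (\<integral>x. (g x / m) *\<^sub>R indicator {..a} (\<phi> x) \<partial>M)"
        by (rule integral_density) (use g m in auto)
      also have "\<dots> = (\<integral>x. g x * indicator {..a} (\<phi> x) \<partial>M) / m" by simp
      finally show ?thesis .
    qed
    have i2: "integrable M (\<lambda>x. g x * indicator {..a} (\<phi> x))" if [measurable]: "g \<in> borel_measurable M" and g: "integrable M g" for g :: "'a \<Rightarrow> real"
      by (rule Bochner_Integration.integrable_bound[OF g]) (auto simp: indicator_def)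
    have "(\<integral>x. fp x * indicator {..a} (\<phi> x) \<partial>M) = (\<integral>x. fn x * indicator {..a} (\<phi> x) \<partial>M)"
      using eq D_meas[of fp] D_meas[of fn] pint nn m by simp
    then show ?thesis
      unfolding ff by (simp add: left_diff_distrib i2 pint)
  qed
qed

text \<open>Uniqueness in several variables by exchanging exponentials for indicators one coordinate at a time;
each exchange is the one-dimensional uniqueness for a weight that already carries the other
factors.\<close>

lemma laplace_zero_imp_integral_orthants_zero:
  fixes f :: "'a \<Rightarrow> real" and \<phi> :: "'i \<Rightarrow> 'a \<Rightarrow> real"
  assumes "finite I"
    and "f \<in> borel_measurable M" "\<And>i. i \<in> I \<Longrightarrow> \<phi> i \<in> borel_measurable M"
    and "\<And>\<xi>. integrable M (\<lambda>x. f x * exp (\<Sum>i\<in>I. \<xi> i * \<phi> i x))"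
    and "\<And>\<xi>. (\<integral>x. f x * exp (\<Sum>i\<in>I. \<xi> i * \<phi> i x) \<partial>M) = 0"
  shows "(\<integral>x. f x * (\<Prod>i\<in>I. indicator {..a i} (\<phi> i x)) \<partial>M) = 0"
  using assms
proof (induction I arbitrary: f rule: finite_induct)
  case empty
  then show ?case by simp
next
  case (insert i I)
  note [measurable] = insert.prems(1)
  have [measurable]: "\<phi> i \<in> borel_measurable M" "\<And>j. j \<in> I \<Longrightarrow> \<phi> j \<in> borel_measurable M"
    using insert.prems(2) by auto
  define f' where "f' x = f x * indicator {..a i} (\<phi> i x)" for x
  have [measurable]: "f' \<in> borel_measurable M" unfolding f'_def by measurable
  have eq: "(\<Sum>j\<in>insert i I. (\<xi>(i := s)) j * \<phi> j x) = s * \<phi> i x + (\<Sum>j\<in>I. \<xi> j * \<phi> j x)" for \<xi> s x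
    using insert.hyps by (simp add: sum.insert) (rule sum.cong, auto)
  have "(\<integral>x. f' x * (\<Prod>j\<in>I. indicator {..a j} (\<phi> j x)) \<partial>M) = 0"
  proof (rule insert.IH)
    fix \<xi> :: "'i \<Rightarrow> real"
    define g where "g x = f x * exp (\<Sum>j\<in>I. \<xi> j * \<phi> j x)" for x
    have [measurable]: "g \<in> borel_measurable M" unfolding g_def by measurable
    have g_int: "integrable M (\<lambda>x. g x * exp (s * \<phi> i x))" and g_zero: "(\<integral>x. g x * exp (s * \<phi> i x) \<partial>M) = 0" for s
      using insert.prems(3)[of "\<xi>(i := s)"] insert.prems(4)[of "\<xi>(i := s)"]
      unfolding eq by (auto simp: g_def exp_add mult_ac)
    have f'_eq: "f' x * exp (\<Sum>j\<in>I. \<xi> j * \<phi> j x) = g x * indicator {..a i} (\<phi> i x)" for x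
      by (simp add: f'_def g_def)
    show "(\<integral>x. f' x * exp (\<Sum>j\<in>I. \<xi> j * \<phi> j x) \<partial>M) = 0"
      unfolding f'_eq by (rule laplace_zero_imp_integral_atMost_zero) (use g_int g_zero in auto)
    show "integrable M (\<lambda>x. f' x * exp (\<Sum>j\<in>I. \<xi> j * \<phi> j x))"
      unfolding f'_eq using g_int[of 0]
      by (rule Bochner_Integration.integrable_bound) (auto simp: indicator_def)
  qed auto
  then show ?case using insert.hyps by (simp add: f'_def mult_ac)
qed

lemma integral_orthants_zero_imp_AE_zero:
  fixes f :: "'a::ordered_euclidean_space \<Rightarrow> real"
  assumes f_int: "integrable lborel f"
    and orth: "\<And>a. (\<integral>y. f y * indicator {..a} y \<partial>lborel) = 0"
  shows "AE y in lborel. f y = 0"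
proof -
  have [measurable]: "f \<in> borel_measurable borel" using f_int by auto
  define fp fn where "fp x = max 0 (f x)" and "fn x = max 0 (- f x)" for x
  have [measurable]: "fp \<in> borel_measurable borel" "fn \<in> borel_measurable borel"
    unfolding fp_def fn_def by measurable
  have nn: "0 \<le> fp x" "0 \<le> fn x" for x by (auto simp: fp_def fn_def)
  have ff: "f x = fp x - fn x" for x by (auto simp: fp_def fn_def)
  have pint: "integrable lborel fp" "integrable lborel fn"
    unfolding fp_def fn_def using f_int by (auto intro!: integrable_max)
  have iint: "integrable lborel (\<lambda>y. g y * indicator {..a} y)" if [measurable]: "g \<in> borel_measurable borel" and g: "integrable lborel g" for g :: "'a \<Rightarrow> real" and a
    by (rule Bochner_Integration.integrable_bound[OF g]) (auto simp: indicator_def)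
  have em: "emeasure (density lborel (\<lambda>y. ennreal (g y))) {..a} = ennreal (\<integral>y. g y * indicator {..a} y \<partial>lborel)"
    if [measurable]: "g \<in> borel_measurable borel" and g: "integrable lborel g" "\<And>y. 0 \<le> g y" for g :: "'a \<Rightarrow> real" and a
  proof -
    have "emeasure (density lborel (\<lambda>y. ennreal (g y))) {..a} = (\<integral>\<^sup>+y. ennreal (g y * indicator {..a} y) \<partial>lborel)"
      by (subst emeasure_density) (auto intro!: nn_integral_cong simp: indicator_def)
    then show ?thesis using g iint by (subst (asm) nn_integral_eq_integral) auto
  qed
  have "density lborel (\<lambda>y. ennreal (fp y)) = density lborel (\<lambda>y. ennreal (fn y))"
  proof (rule measure_eqI_generator_eq[where E = "range (\<lambda>a::'a. {..a})" and \<Omega> = UNIV and A = "\<lambda>i. {..real i *\<^sub>R One}"])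
    show "Int_stable (range (\<lambda>a::'a. {..a}))"
    proof (rule Int_stableI_image)
      fix a b :: 'a
      have "{..a} \<inter> {..b} = {..inf a b}" by auto
      then show "\<exists>c\<in>UNIV. {..a} \<inter> {..b} = {..c}" by blast
    qed
    show "emeasure (density lborel (\<lambda>y. ennreal (fp y))) X = emeasure (density lborel (\<lambda>y. ennreal (fn y))) X"
      if X_in: "X \<in> range (\<lambda>a::'a. {..a})" for X
    proof -
      obtain a where X: "X = {..a}" using X_in by auto
      have "(\<integral>y. fp y * indicator {..a} y \<partial>lborel) = (\<integral>y. fn y * indicator {..a} y \<partial>lborel)"
        using orth[of a] by (simp add: ff left_diff_distrib iint pint)
      then show ?thesis by (simp add: X em pint nn)
    qed
    show "sets (density lborel (\<lambda>y. ennreal (fp y))) = sigma_sets UNIV (range (\<lambda>a::'a. {..a}))"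
      "sets (density lborel (\<lambda>y. ennreal (fn y))) = sigma_sets UNIV (range (\<lambda>a::'a. {..a}))"
      by (simp_all add: borel_eq_atMost)
    show "(\<Union>i. {..real i *\<^sub>R (One::'a)}) = UNIV"
    proof (intro equalityI subsetI UNIV_I)
      fix y :: 'a
      obtain n :: nat where n: "norm y \<le> real n" using real_arch_simple by blast
      have "y \<le> real n *\<^sub>R One"
        unfolding eucl_le[where 'a='a] using n Basis_le_norm[of _ y]
        by (auto intro: order_trans[OF abs_ge_self])
           (smt (verit) Basis_le_norm)
      then show "y \<in> (\<Union>i. {..real i *\<^sub>R One})" by auto
    qed
    show "emeasure (density lborel (\<lambda>y. ennreal (fp y))) {..real i *\<^sub>R One} \<noteq> \<infinity>" for i
      by (simp add: em pint nn)
  qed auto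
  then have "AE y in lborel. ennreal (fp y) = ennreal (fn y)"
    by (intro sigma_finite_measure.density_unique[OF sigma_finite_lborel]) auto
  then show ?thesis
    by eventually_elim (simp add: nn ff)
qed


text \<open>A Laplace transform on a Euclidean space that is finite everywhere determines the function up to
null sets.\<close>

lemma laplace_zero_imp_AE_zero:
  fixes f :: "'a::ordered_euclidean_space \<Rightarrow> real"
  assumes [measurable]: "f \<in> borel_measurable borel"
    and int: "\<And>z. integrable lborel (\<lambda>y. f y * exp (z \<bullet> y))"
    and zero: "\<And>z. (\<integral>y. f y * exp (z \<bullet> y) \<partial>lborel) = 0"
  shows "AE y in lborel. f y = 0"
proof (rule integral_orthants_zero_imp_AE_zero)
  show "integrable lborel f" using int[of 0] by simp
  show "(\<integral>y. f y * indicator {..a} y \<partial>lborel) = 0" for a :: 'a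
  proof -
    have expo: "(\<Sum>b\<in>Basis. \<xi> b * (y \<bullet> b)) = (\<Sum>b\<in>Basis. \<xi> b *\<^sub>R b) \<bullet> y" for \<xi> :: "'a \<Rightarrow> real" and y
      by (simp add: inner_sum_left inner_commute[of y])
    have "(\<integral>y. f y * (\<Prod>b\<in>Basis. indicator {..a \<bullet> b} (y \<bullet> b)) \<partial>lborel) = 0"
      by (rule laplace_zero_imp_integral_orthants_zero) (auto simp: expo int zero)
    also have "(\<lambda>y. \<Prod>b\<in>Basis. indicator {..a \<bullet> b} (y \<bullet> b)) = (indicator {..a} :: 'a \<Rightarrow> real)"
      by (auto simp: fun_eq_iff indicator_def eucl_le[where 'a='a])
    finally show ?thesis by simp
  qed
qed

section \<open>Disintegration along parallel lines\<close>

lemma nn_integral_lborel_translate: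
  fixes f :: "'a::euclidean_space \<Rightarrow> ennreal"
  assumes [measurable]: "f \<in> borel_measurable borel"
  shows "(\<integral>\<^sup>+y. f (y + a) \<partial>lborel) = (\<integral>\<^sup>+y. f y \<partial>lborel)"
proof -
  have "(\<integral>\<^sup>+y. f y \<partial>lborel) = (\<integral>\<^sup>+y. f y \<partial>distr lborel borel ((+) a))"
    by (simp add: lborel_distr_plus)
  also have "\<dots> = (\<integral>\<^sup>+y. f (y + a) \<partial>lborel)"
    by (subst nn_integral_distr) (auto simp: add.commute)
  finally show ?thesis by simp
qed

text \<open>Sliding each slice along \<open>w\<close> preserves volume. This replaces a choice of coordinates on the quotient
modulo \<open>w\<close>: statements about almost every line become statements about almost every base point, each
line being counted once for each of its points.\<close>

lemma lborel_shear:
  fixes w :: "'a::euclidean_space"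
  shows "distr lborel borel (\<lambda>(y, s). (y + s *\<^sub>R w, s)) = (lborel :: ('a \<times> real) measure)"
proof (rule measure_eqI)
  fix A assume "A \<in> sets (distr lborel borel (\<lambda>(y, s). (y + s *\<^sub>R w, s)))"
  then have [measurable]: "A \<in> sets (borel :: ('a \<times> real) measure)" by simp
  then have A2: "A \<in> sets (borel \<Otimes>\<^sub>M borel)" unfolding borel_prod .
  have [measurable]: "(\<lambda>(y, s). (y + s *\<^sub>R w, s)) \<in> borel_measurable (borel :: ('a \<times> real) measure)"
    by (auto simp: case_prod_beta borel_prod[symmetric])
  have "emeasure (distr lborel borel (\<lambda>(y, s). (y + s *\<^sub>R w, s))) A
      = (\<integral>\<^sup>+p. indicator A p \<partial>distr lborel borel (\<lambda>(y, s). (y + s *\<^sub>R w, s)))" by simp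
  also have "\<dots> = (\<integral>\<^sup>+p. indicator A (case p of (y, s) \<Rightarrow> (y + s *\<^sub>R w, s)) \<partial>(lborel \<Otimes>\<^sub>M lborel))"
    by (subst nn_integral_distr) (auto simp: lborel_prod)
  also have "\<dots> = (\<integral>\<^sup>+s. \<integral>\<^sup>+y. indicator A (y + s *\<^sub>R w, s) \<partial>lborel \<partial>lborel)"
    by (subst lborel_pair.nn_integral_snd[symmetric]) (auto simp: borel_prod)
  also have "\<dots> = (\<integral>\<^sup>+s. \<integral>\<^sup>+y. indicator A (y, s) \<partial>lborel \<partial>lborel)"
  proof (rule nn_integral_cong)
    fix s :: real
    have [measurable]: "(\<lambda>y. indicator A (y, s) :: ennreal) \<in> borel_measurable borel"
      using A2 by measurable
    show "(\<integral>\<^sup>+y. indicator A (y + s *\<^sub>R w, s) \<partial>lborel) = (\<integral>\<^sup>+y. indicator A (y, s) \<partial>lborel)"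
      by (rule nn_integral_lborel_translate[of "\<lambda>y. indicator A (y, s)"]) simp
  qed
  also have "\<dots> = (\<integral>\<^sup>+p. indicator A p \<partial>(lborel \<Otimes>\<^sub>M lborel))"
    by (subst lborel_pair.nn_integral_snd[symmetric]) (simp_all add: lborel_prod)
  also have "\<dots> = emeasure lborel A" by (simp add: lborel_prod)
  finally show "emeasure (distr lborel borel (\<lambda>(y, s). (y + s *\<^sub>R w, s))) A = emeasure lborel A" .
qed simp

lemma AE_lborel_shear:
  fixes w :: "'a::euclidean_space"
  assumes "AE p in (lborel :: ('a \<times> real) measure). P p"
  shows "AE y in lborel. AE s in lborel. P (y + s *\<^sub>R w, s)"
proof -
  have m: "(\<lambda>(y, s). (y + s *\<^sub>R w, s)) \<in> borel_measurable (borel :: ('a \<times> real) measure)"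
    by (auto simp: case_prod_beta borel_prod[symmetric])
  have "AE p in distr lborel borel (\<lambda>(y, s). (y + s *\<^sub>R w, s)). P p"
    unfolding lborel_shear by (rule assms)
  then have "AE p in lborel. P (case p of (y, s) \<Rightarrow> (y + s *\<^sub>R w, s))"
    by (rule AE_distrD[rotated]) (use m in simp)
  then have "AE p in lborel \<Otimes>\<^sub>M lborel. P (case p of (y, s) \<Rightarrow> (y + s *\<^sub>R w, s))"
    unfolding lborel_prod .
  from lborel_pair.AE_pair[OF this] show ?thesis by simp
qed

lemma AE_lborel_imp_AE_lines:
  fixes w :: "'a::euclidean_space"
  assumes "AE y in lborel. P y"
  shows "AE y in lborel. AE s in (lborel :: real measure). P (y + s *\<^sub>R w)"
proof -
  obtain N where N: "{y. \<not> P y} \<subseteq> N" "emeasure lborel N = 0" "N \<in> sets (borel :: 'a measure)"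
    using assms by (auto elim: AE_E)
  have "N \<times> (UNIV :: real set) \<in> null_sets (lborel \<Otimes>\<^sub>M lborel)"
    using N by (intro lborel.times_in_null_sets1) auto
  then have "AE p in (lborel :: ('a \<times> real) measure). P (fst p)"
    using N(1) by (intro AE_I'[of "N \<times> UNIV"]) (auto simp: lborel_prod)
  from AE_lborel_shear[OF this, of w] show ?thesis by simp
qed

text \<open>By Fubini, the exceptional set has measure zero on almost every line, while its measure counted over
all shifts is infinitely many times its volume.\<close>

lemma AE_lines_imp_AE_lborel:
  fixes w :: "'a::euclidean_space"
  assumes [measurable]: "Measurable.pred borel P"
    and lines: "AE y in lborel. AE s in (lborel :: real measure). P (y + s *\<^sub>R w)"
  shows "AE y in lborel. P y"
proof -
  define f where "f y = (if P y then 0 else 1 :: ennreal)" for y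
  have [measurable]: "f \<in> borel_measurable borel" unfolding f_def by measurable
  define c where "c = (\<integral>\<^sup>+y. f y \<partial>lborel)"
  have "0 = (\<integral>\<^sup>+y. \<integral>\<^sup>+s. f (y + s *\<^sub>R w) \<partial>(lborel :: real measure) \<partial>lborel)"
  proof -
    have "AE y in lborel. (\<integral>\<^sup>+s. f (y + s *\<^sub>R w) \<partial>(lborel :: real measure)) = 0"
      using lines
    proof eventually_elim
      case (elim y)
      have "(\<integral>\<^sup>+s. f (y + s *\<^sub>R w) \<partial>(lborel :: real measure)) = (\<integral>\<^sup>+s. 0 \<partial>(lborel :: real measure))"
        using elim by (intro nn_integral_cong_AE) (auto simp: f_def)
      then show ?case by simp
    qed
    then have "(\<integral>\<^sup>+y. \<integral>\<^sup>+s. f (y + s *\<^sub>R w) \<partial>(lborel :: real measure) \<partial>lborel) = (\<integral>\<^sup>+(y::'a). 0 \<partial>lborel)"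
      by (intro nn_integral_cong_AE) auto
    then show ?thesis by simp
  qed
  also have "\<dots> = (\<integral>\<^sup>+s. \<integral>\<^sup>+y. f (y + s *\<^sub>R w) \<partial>lborel \<partial>(lborel :: real measure))"
    by (rule lborel_pair.Fubini'[symmetric]) measurable
  also have "\<dots> = (\<integral>\<^sup>+(s::real). c \<partial>lborel)"
    by (simp add: c_def nn_integral_lborel_translate)
  also have "\<dots> = c * \<infinity>" by simp
  finally have "c = 0" by (auto simp: ennreal_mult_eq_top_iff)
  then have "AE y in lborel. f y = 0"
    unfolding c_def by (subst (asm) nn_integral_0_iff_AE) auto
  then show ?thesis by eventually_elim (auto simp: f_def split: if_splits)
qed

lemma integral_exp_window:
  fixes q N \<kappa> :: real
  shows "integrable lborel (\<lambda>s. exp (\<kappa> * s) * indicator {- N..N} (q - s))"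
    and "(\<integral>s. exp (\<kappa> * s) * indicator {- N..N} (q - s) \<partial>lborel)
       = exp (\<kappa> * q) * (\<integral>s. exp (\<kappa> * s) * indicator {- N..N} s \<partial>lborel)"
proof -
  have eq: "(\<lambda>s. exp (\<kappa> * s) * indicator {- N..N} (q - s)) = (\<lambda>s. indicator {q - N..q + N} s *\<^sub>R exp (\<kappa> * s))"
    by (auto simp: fun_eq_iff indicator_def)
  show "integrable lborel (\<lambda>s. exp (\<kappa> * s) * indicator {- N..N} (q - s))"
    unfolding eq by (rule borel_integrable_compact) (auto intro!: continuous_intros)
  have "(\<integral>s. exp (\<kappa> * s) * indicator {- N..N} (q - s) \<partial>lborel)
      = (\<integral>s. exp (\<kappa> * (q + 1 * s)) * indicator {- N..N} (q - (q + 1 * s)) \<partial>lborel)"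
    using lborel_integral_real_affine[of 1 "\<lambda>s. exp (\<kappa> * s) * indicator {- N..N} (q - s)" q] by simp
  also have "\<dots> = (\<integral>s. exp (\<kappa> * q) * (exp (\<kappa> * s) * indicator {- N..N} s) \<partial>lborel)"
    by (intro Bochner_Integration.integral_cong) (auto simp: indicator_def exp_add distrib_left)
  finally show "(\<integral>s. exp (\<kappa> * s) * indicator {- N..N} (q - s) \<partial>lborel)
       = exp (\<kappa> * q) * (\<integral>s. exp (\<kappa> * s) * indicator {- N..N} s \<partial>lborel)" by simp
qed

text \<open>The integral over all base points \<open>y\<close> of a line integral diverges, since each line is met
infinitely often. The indicator restricts the base points to a slab that meets every line in a
bounded segment. For the linear form \<open>om\<close> with \<open>om \<bullet> w = 1\<close>, the shear turns the slab into a window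
for \<open>s\<close> and the double integral splits into two factors.\<close>

lemma slab_integral:
  fixes u :: "'a::ordered_euclidean_space \<Rightarrow> real" and N t :: real and z :: 'a
  assumes [measurable]: "u \<in> borel_measurable borel" and om: "om \<bullet> w = 1"
    and int: "\<And>z. integrable lborel (\<lambda>y. u y * exp (z \<bullet> y))"
  defines "\<Phi> \<equiv> (\<lambda>(y, s). (indicator {- N..N} (om \<bullet> y) * exp (z \<bullet> y)) * (u (y + s *\<^sub>R w) * exp (t * s)))"
  defines "k \<equiv> t - z \<bullet> w"
  shows "integrable (lborel \<Otimes>\<^sub>M lborel) \<Phi>"
    and "(\<integral>p. \<Phi> p \<partial>(lborel \<Otimes>\<^sub>M lborel))
      = (\<integral>s. exp (k * s) * indicator {- N..N} s \<partial>lborel) * (\<integral>y. u y * exp ((z + k *\<^sub>R om) \<bullet> y) \<partial>lborel)"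
proof -
  define c where "c = (\<integral>s. exp (k * s) * indicator {- N..N} s \<partial>lborel)"
  define \<Psi> where "\<Psi> = (\<lambda>(y, s). (u y * exp (z \<bullet> y)) * (exp (k * s) * indicator {- N..N} (om \<bullet> y - s)))"
  have [measurable]: "\<Psi> \<in> borel_measurable (borel \<Otimes>\<^sub>M borel)"
    unfolding \<Psi>_def by measurable
  have m: "(\<lambda>(y, s). (y + s *\<^sub>R w, s)) \<in> borel_measurable (borel :: ('a \<times> real) measure)"
    by (auto simp: case_prod_beta borel_prod[symmetric])
  have z_om: "(u y * exp (z \<bullet> y)) * (exp (k * (om \<bullet> y)) * c) = c * (u y * exp ((z + k *\<^sub>R om) \<bullet> y))" for y
    by (simp add: inner_add_left exp_add)
  have \<Psi>_int: "integrable (lborel \<Otimes>\<^sub>M lborel) \<Psi>"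
  proof (rule lborel_pair.Fubini_integrable)
    show "AE y in lborel. integrable lborel (\<lambda>s. \<Psi> (y, s))"
      unfolding \<Psi>_def prod.case
      by (intro AE_I2 Bochner_Integration.integrable_mult_right integral_exp_window)
    have "(\<integral>s. norm (\<Psi> (y, s)) \<partial>lborel) = \<bar>c * (u y * exp ((z + k *\<^sub>R om) \<bullet> y))\<bar>" for y
    proof -
      have "0 \<le> c" unfolding c_def by (intro integral_nonneg_AE AE_I2) auto
      have "(\<integral>s. norm (\<Psi> (y, s)) \<partial>lborel)
          = (\<integral>s. \<bar>u y * exp (z \<bullet> y)\<bar> * (exp (k * s) * indicator {- N..N} (om \<bullet> y - s)) \<partial>lborel)"
        by (intro Bochner_Integration.integral_cong) (auto simp: \<Psi>_def abs_mult)
      also have "\<dots> = \<bar>u y * exp (z \<bullet> y)\<bar> * (exp (k * (om \<bullet> y)) * c)"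
        by (simp only: integral_mult_right_zero integral_exp_window c_def)
      also have "\<dots> = \<bar>(u y * exp (z \<bullet> y)) * (exp (k * (om \<bullet> y)) * c)\<bar>"
        using \<open>0 \<le> c\<close> by (simp add: abs_mult)
      finally show ?thesis unfolding z_om .
    qed
    then show "integrable lborel (\<lambda>y. \<integral>s. norm (\<Psi> (y, s)) \<partial>lborel)"
      by (simp only:) (intro integrable_abs Bochner_Integration.integrable_mult_right int)
  qed simp
  have \<Psi>_val: "(\<integral>p. \<Psi> p \<partial>(lborel \<Otimes>\<^sub>M lborel)) = c * (\<integral>y. u y * exp ((z + k *\<^sub>R om) \<bullet> y) \<partial>lborel)"
  proof -
    have "(\<integral>p. \<Psi> p \<partial>(lborel \<Otimes>\<^sub>M lborel)) = (\<integral>y. \<integral>s. \<Psi> (y, s) \<partial>lborel \<partial>lborel)"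
      using \<Psi>_int by (rule lborel_pair.integral_fst'[symmetric])
    also have "\<dots> = (\<integral>y. c * (u y * exp ((z + k *\<^sub>R om) \<bullet> y)) \<partial>lborel)"
      unfolding \<Psi>_def prod.case z_om[symmetric]
      by (simp only: integral_mult_right_zero integral_exp_window c_def)
    finally show ?thesis by simp
  qed
  have \<Phi>: "\<Phi> = (\<lambda>p. \<Psi> (case p of (y, s) \<Rightarrow> (y + s *\<^sub>R w, s)))"
  proof
    fix q :: "'a \<times> real"
    obtain y s where q: "q = (y, s)" by (cases q)
    have "exp (z \<bullet> (y + s *\<^sub>R w)) * exp (k * s) = exp (z \<bullet> y) * exp (t * s)"
      by (simp add: k_def inner_add_right algebra_simps flip: exp_add)
    then show "\<Phi> q = \<Psi> (case q of (y, s) \<Rightarrow> (y + s *\<^sub>R w, s))"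
      using om by (simp add: q \<Phi>_def \<Psi>_def inner_add_right mult_ac)
  qed
  have \<Psi>m: "\<Psi> \<in> borel_measurable borel" using \<open>\<Psi> \<in> _\<close> by (simp add: borel_prod)
  have "integrable (distr lborel borel (\<lambda>(y, s). (y + s *\<^sub>R w, s))) \<Psi>"
    using \<Psi>_int by (simp add: lborel_prod lborel_shear)
  then show "integrable (lborel \<Otimes>\<^sub>M lborel) \<Phi>"
    unfolding \<Phi> lborel_prod by (rule integrable_distr[rotated]) (use m in simp)
  have "(\<integral>p. \<Psi> p \<partial>distr lborel borel (\<lambda>(y, s). (y + s *\<^sub>R w, s))) = c * (\<integral>y. u y * exp ((z + k *\<^sub>R om) \<bullet> y) \<partial>lborel)"
    using \<Psi>_val by (simp add: lborel_prod lborel_shear)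
  then show "(\<integral>p. \<Phi> p \<partial>(lborel \<Otimes>\<^sub>M lborel))
      = (\<integral>s. exp (k * s) * indicator {- N..N} s \<partial>lborel) * (\<integral>y. u y * exp ((z + k *\<^sub>R om) \<bullet> y) \<partial>lborel)"
    unfolding \<Phi> lborel_prod by (subst (asm) integral_distr) (use m \<Psi>m in \<open>auto simp: c_def\<close>)
qed

lemma AE_eq_on_slabs:
  fixes om :: "'a::euclidean_space"
  assumes "\<And>n::nat. AE y in lborel. om \<bullet> y \<in> {- real n..real n} \<longrightarrow> P y"
  shows "AE y in lborel. P y"
proof -
  have "AE y in lborel. \<forall>n::nat. om \<bullet> y \<in> {- real n..real n} \<longrightarrow> P y"
    unfolding AE_all_countable using assms by blast
  then show ?thesis
  proof eventually_elim
    case (elim y)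
    obtain n :: nat where "\<bar>om \<bullet> y\<bar> \<le> real n" using real_arch_simple by blast
    then have "om \<bullet> y \<in> {- real n..real n}" by auto
    with elim show ?case by blast
  qed
qed

text \<open>A single null set works for all \<open>t\<close>, because integrability at arbitrarily large \<open>\<bar>t\<bar>\<close> of both signs
implies it in between.\<close>

lemma laplace_integrable_imp_AE_lines_integrable:
  fixes u :: "'a::ordered_euclidean_space \<Rightarrow> real"
  assumes [measurable]: "u \<in> borel_measurable borel" and w: "w \<noteq> 0"
    and int: "\<And>z. integrable lborel (\<lambda>y. u y * exp (z \<bullet> y))"
  shows "AE y in lborel. \<forall>t. integrable lborel (\<lambda>s. u (y + s *\<^sub>R w) * exp (t * s))"
proof -
  define om where "om = (1 / (w \<bullet> w)) *\<^sub>R w"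
  have om: "om \<bullet> w = 1" using w by (simp add: om_def)
  have "AE y in lborel. integrable lborel (\<lambda>s. u (y + s *\<^sub>R w) * exp (t * s))" for t
  proof (rule AE_eq_on_slabs)
    fix n :: nat
    have "AE y in lborel. integrable lborel (\<lambda>s. (indicator {- real n..real n} (om \<bullet> y) * exp (0 \<bullet> y)) * (u (y + s *\<^sub>R w) * exp (t * s)))"
      using lborel_pair.AE_integrable_fst'[OF slab_integral(1)[OF assms(1) om int, where N = "real n" and z = 0 and t = t]] by simp
    then show "AE y in lborel. om \<bullet> y \<in> {- real n..real n} \<longrightarrow> integrable lborel (\<lambda>s. u (y + s *\<^sub>R w) * exp (t * s))"
      by eventually_elim auto
  qed
  then have "AE y in lborel. \<forall>n::nat. integrable lborel (\<lambda>s. u (y + s *\<^sub>R w) * exp (real n * s)) \<and>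
      integrable lborel (\<lambda>s. u (y + s *\<^sub>R w) * exp (- real n * s))"
    unfolding AE_all_countable by (intro allI AE_conjI)
  then show ?thesis
  proof eventually_elim
    case (elim y)
    show ?case
    proof
      fix t
      obtain n :: nat where n: "\<bar>t\<bar> \<le> real n" using real_arch_simple by blast
      have e: "exp (t * s) \<le> exp (real n * s) + exp (- real n * s)" for s
      proof -
        have "t * s \<le> \<bar>t\<bar> * \<bar>s\<bar>" by (metis abs_ge_self abs_mult)
        also have "\<dots> \<le> real n * \<bar>s\<bar>" using n by (intro mult_right_mono) auto
        finally have "exp (t * s) \<le> exp (real n * \<bar>s\<bar>)" by simp
        also have "\<dots> \<le> exp (real n * s) + exp (- real n * s)" by (cases "0 \<le> s") auto
        finally show ?thesis .
      qed
      have "integrable lborel (\<lambda>s. u (y + s *\<^sub>R w) * exp (real n * s) + u (y + s *\<^sub>R w) * exp (- real n * s))"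
        using elim by (intro Bochner_Integration.integrable_add) blast+
      then show "integrable lborel (\<lambda>s. u (y + s *\<^sub>R w) * exp (t * s))"
      proof (rule Bochner_Integration.integrable_bound)
        have "\<bar>u (y + s *\<^sub>R w)\<bar> * exp (t * s) \<le> \<bar>u (y + s *\<^sub>R w)\<bar> * (exp (real n * s) + exp (- real n * s))" for s
          by (intro mult_left_mono e) simp
        then show "AE s in lborel. norm (u (y + s *\<^sub>R w) * exp (t * s)) \<le> norm (u (y + s *\<^sub>R w) * exp (real n * s) + u (y + s *\<^sub>R w) * exp (- real n * s))"
          by (intro AE_I2) (simp add: abs_mult abs_of_pos add_pos_pos flip: distrib_left)
      qed measurable
    qed
  qed
qed

text \<open>This is the completeness of the exponential family with tilts in the hyperplane \<open>z \<bullet> w = t\<close>. The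
line integrals, cut off by the slab, have a Laplace transform that at every argument is a multiple of
the transform of \<open>u\<close> at a point of the hyperplane, and the latter is zero.\<close>

lemma laplace_zero_on_hyperplane_imp_AE_lines:
  fixes u :: "'a::ordered_euclidean_space \<Rightarrow> real"
  assumes [measurable]: "u \<in> borel_measurable borel" and w: "w \<noteq> 0"
    and int: "\<And>z. integrable lborel (\<lambda>y. u y * exp (z \<bullet> y))"
    and zero: "\<And>z. z \<bullet> w = t \<Longrightarrow> (\<integral>y. u y * exp (z \<bullet> y) \<partial>lborel) = 0"
  shows "AE y in lborel. (\<integral>s. u (y + s *\<^sub>R w) * exp (t * s) \<partial>lborel) = 0"
proof -
  define om where "om = (1 / (w \<bullet> w)) *\<^sub>R w"
  have om: "om \<bullet> w = 1" using w by (simp add: om_def)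
  define D where "D y = (\<integral>s. u (y + s *\<^sub>R w) * exp (t * s) \<partial>lborel)" for y
  have [measurable]: "D \<in> borel_measurable borel"
    unfolding D_def by measurable
  have slab: "AE y in lborel. indicator {- N..N} (om \<bullet> y) * D y = 0" for N :: real
  proof (rule laplace_zero_imp_AE_zero)
    fix z :: 'a
    define \<Phi> where "\<Phi> = (\<lambda>(y, s). (indicator {- N..N} (om \<bullet> y) * exp (z \<bullet> y)) * (u (y + s *\<^sub>R w) * exp (t * s)))"
    have \<Phi>_int: "integrable (lborel \<Otimes>\<^sub>M lborel) \<Phi>"
      unfolding \<Phi>_def by (rule slab_integral(1)[OF assms(1) om int])
    have \<Phi>_zero: "(\<integral>p. \<Phi> p \<partial>(lborel \<Otimes>\<^sub>M lborel)) = 0"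
      unfolding \<Phi>_def slab_integral(2)[OF assms(1) om int]
      using zero[of "z + (t - z \<bullet> w) *\<^sub>R om"] om by (simp add: inner_add_left)
    have inner: "(\<integral>s. \<Phi> (y, s) \<partial>lborel) = indicator {- N..N} (om \<bullet> y) * D y * exp (z \<bullet> y)" for y
    proof -
      have "(\<integral>s. \<Phi> (y, s) \<partial>lborel) = (indicator {- N..N} (om \<bullet> y) * exp (z \<bullet> y)) * D y"
        unfolding D_def \<Phi>_def prod.case by (simp only: integral_mult_right_zero)
      then show ?thesis by (simp add: mult_ac)
    qed
    show "integrable lborel (\<lambda>y. indicator {- N..N} (om \<bullet> y) * D y * exp (z \<bullet> y))"
      using lborel_pair.integrable_fst'[OF \<Phi>_int] by (simp only: inner)
    show "(\<integral>y. indicator {- N..N} (om \<bullet> y) * D y * exp (z \<bullet> y) \<partial>lborel) = 0"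
      using lborel_pair.integral_fst'[OF \<Phi>_int] \<Phi>_zero by (simp only: inner)
  qed simp
  show ?thesis
  proof (rule AE_eq_on_slabs)
    show "AE y in lborel. om \<bullet> y \<in> {- real n..real n} \<longrightarrow> (\<integral>s. u (y + s *\<^sub>R w) * exp (t * s) \<partial>lborel) = 0" for n :: nat
      using slab[of "real n"] by eventually_elim (auto simp: D_def)
  qed
qed

section \<open>The matching problem on a line\<close>

lemma AE_notin_frontier_convex:
  fixes S :: "'a::euclidean_space set"
  assumes "convex S"
  shows "AE x in lborel. x \<notin> frontier S"
proof -
  have "frontier S \<in> null_sets lebesgue"
    using negligible_convex_frontier[OF assms] by (simp add: negligible_iff_null_sets)
  then have "frontier S \<in> null_sets lborel"
    by (auto simp: null_sets_def)
  then show ?thesis by (rule AE_not_in)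
qed

lemma open_AE_imp_ex:
  fixes S :: "'a::euclidean_space set"
  assumes "open S" "S \<noteq> {}" "AE x in lborel. P x"
  shows "\<exists>x\<in>S. P x"
proof (rule ccontr)
  assume "\<not> ?thesis"
  then have "AE x in lborel. x \<notin> S" using assms(3) by (auto elim: eventually_mono)
  moreover have "S \<in> sets lborel" using assms(1) by auto
  ultimately have "S \<in> null_sets lborel" by (simp add: AE_iff_null_sets)
  then have "negligible S" by (simp add: negligible_iff_null_sets null_sets_completionI)
  then show False using assms open_not_negligible by blast
qed

text \<open>Identities between continuous functions that hold almost everywhere hold everywhere, because
non-empty open sets are not null.\<close>

lemma continuous_AE_zero_imp_zero:
  fixes f :: "'a::euclidean_space \<Rightarrow> real"
  assumes "continuous_on UNIV f" "AE x in lborel. f x = 0"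
  shows "f x = 0"
proof (rule ccontr)
  assume "f x \<noteq> 0"
  have "open {x. f x \<noteq> 0}"
    using assms(1) by (intro open_Collect_neq) auto
  from open_AE_imp_ex[OF this _ assms(2)] \<open>f x \<noteq> 0\<close> show False by auto
qed

lemma continuous_Rats_zero_imp_zero:
  fixes f :: "real \<Rightarrow> real"
  assumes "continuous_on UNIV f" "\<And>q. q \<in> \<rat> \<Longrightarrow> f q = 0"
  shows "f x = 0"
proof (rule ccontr)
  assume nz: "f x \<noteq> 0"
  have "open {x. f x \<noteq> 0}"
    using assms(1) by (intro open_Collect_neq) auto
  then obtain e where e: "0 < e" "ball x e \<subseteq> {x. f x \<noteq> 0}"
    using nz openE by (metis mem_Collect_eq)
  obtain q where "q \<in> \<rat>" "x < q" "q < x + e" using Rats_dense_in_real[of x "x + e"] e(1) by auto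
  moreover from this have "q \<in> ball x e" by (simp add: dist_real_def)
  ultimately show False using assms(2) e(2) by blast
qed

text \<open>The conditional problem on a line. The function \<open>h\<close> is the data density before tilting by
\<open>exp (t * s)\<close>. The parameter is \<open>\<phi>\<close>, a function on the measure space \<open>M\<close> with weight \<open>f\<close>, which
includes the prior and the normalising factor. A linear functional of a vector parameter
has this form. Matching is assumed at rational \<open>t\<close> and \<open>\<alpha>\<close>, so that only countably many
null sets occur. The posterior distribution function at \<open>t\<close> is written with cleared
denominator.\<close>

locale matched_line = sigma_finite_measure M for M :: "'a measure" +
  fixes h :: "real \<Rightarrow> real" and f \<phi> :: "'a \<Rightarrow> real"
  assumes h_meas [measurable]: "h \<in> borel_measurable borel" and h_nonneg: "\<And>s. 0 \<le> h s"
    and h_int: "\<And>t. integrable lborel (\<lambda>s. h s * exp (t * s))"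
    and h_nonzero: "\<not> (AE s in lborel. h s = 0)"
    and f_meas [measurable]: "f \<in> borel_measurable M" and f_nonneg: "\<And>x. 0 \<le> f x"
    and phi_meas [measurable]: "\<phi> \<in> borel_measurable M"
    and proper: "AE s in lborel. 0 < h s \<longrightarrow>
        integrable M (\<lambda>x. f x * exp (s * \<phi> x)) \<and> 0 < (\<integral>x. f x * exp (s * \<phi> x) \<partial>M)"
    and match: "\<And>t \<alpha>. t \<in> \<rat> \<Longrightarrow> \<alpha> \<in> \<rat> \<Longrightarrow> 0 \<le> \<alpha> \<Longrightarrow> \<alpha> \<le> 1 \<Longrightarrow>
        (\<integral>s. (indicator {s. (\<integral>x. f x * exp (s * \<phi> x) * indicator {..t} (\<phi> x) \<partial>M)
                \<le> \<alpha> * (\<integral>x. f x * exp (s * \<phi> x) \<partial>M)} s - \<alpha>) * h s * exp (t * s) \<partial>lborel) = 0"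
begin

text \<open>The posterior at \<open>s\<close> is proper exactly for \<open>s \<in> S\<close>. There \<open>Zt t s / Z s\<close> is the posterior probability
of \<open>\<phi> \<le> t\<close>, while \<open>W t y / mh t\<close> is the probability under the parameter \<open>t\<close> that the data exceed
\<open>y\<close>.\<close>

definition S :: "real set" where "S = {s. integrable M (\<lambda>x. f x * exp (s * \<phi> x))}"
definition Z :: "real \<Rightarrow> real" where "Z s = (\<integral>x. f x * exp (s * \<phi> x) \<partial>M)"
definition Zt :: "real \<Rightarrow> real \<Rightarrow> real" where
  "Zt t s = (\<integral>x. f x * exp (s * \<phi> x) * indicator {..t} (\<phi> x) \<partial>M)"
definition mh :: "real \<Rightarrow> real" where "mh t = (\<integral>x. h x * exp (t * x) \<partial>lborel)"
definition W :: "real \<Rightarrow> real \<Rightarrow> real" where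
  "W t y = (\<integral>x. h x * indicator {y<..} x * exp (t * x) \<partial>lborel)"

lemma Z_meas [measurable]: "Z \<in> borel_measurable borel" "Zt t \<in> borel_measurable borel"
  unfolding Z_def Zt_def by measurable

lemma f_not_AE_zero: "\<not> (AE x in M. f x = 0)"
proof
  assume "AE x in M. f x = 0"
  then have z: "(\<integral>x. f x * exp (s * \<phi> x) \<partial>M) = 0" for s
    by (intro integral_eq_zero_AE) (auto elim: eventually_mono)
  have "AE s in lborel. h s = 0"
    using proper by eventually_elim (use h_nonneg z in \<open>auto simp: less_le\<close>)
  with h_nonzero show False by simp
qed

lemma Z_pos: "s \<in> S \<Longrightarrow> 0 < Z s"
proof -
  assume s: "s \<in> S"
  have "0 \<le> Z s" unfolding Z_def using f_nonneg by simp
  moreover have "Z s \<noteq> 0"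
  proof
    assume "Z s = 0"
    then have "AE x in M. f x * exp (s * \<phi> x) = 0"
      using s f_nonneg unfolding Z_def S_def by (subst (asm) integral_nonneg_eq_0_iff_AE) auto
    with f_not_AE_zero show False by auto
  qed
  ultimately show ?thesis by simp
qed

lemma AE_S: "AE s in lborel. 0 < h s \<longrightarrow> s \<in> S"
  using proper by eventually_elim (auto simp: S_def)

lemma mh_pos: "0 < mh t"
proof -
  have "0 \<le> mh t" unfolding mh_def using h_nonneg by simp
  moreover have "mh t \<noteq> 0"
  proof
    assume "mh t = 0"
    then have "AE x in lborel. h x * exp (t * x) = 0"
      using h_int h_nonneg unfolding mh_def by (subst (asm) integral_nonneg_eq_0_iff_AE) auto
    with h_nonzero show False by auto
  qed
  ultimately show ?thesis by simp
qed

lemma part_int: "s \<in> S \<Longrightarrow> integrable M (\<lambda>x. f x * exp (s * \<phi> x) * indicator B (\<phi> x))"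
  if [measurable]: "B \<in> sets borel"
  unfolding S_def mem_Collect_eq
  by (rule Bochner_Integration.integrable_bound) (auto simp: indicator_def)

lemma h_part_int: "integrable lborel (\<lambda>x. h x * indicator B x * exp (t * x))"
  if [measurable]: "B \<in> sets borel"
  by (rule Bochner_Integration.integrable_bound[OF h_int[of t]]) (auto simp: indicator_def)

lemma Zt_le_Z: "s \<in> S \<Longrightarrow> Zt t s \<le> Z s" and Zt_nonneg: "0 \<le> Zt t s"
  unfolding Z_def Zt_def using f_nonneg
  by (auto intro!: integral_mono part_int simp: S_def) (auto simp: S_def indicator_def)

lemma Z_split: "s \<in> S \<Longrightarrow> Z s = Zt t s + (\<integral>x. f x * exp (s * \<phi> x) * indicator {t<..} (\<phi> x) \<partial>M)"
  unfolding Z_def Zt_def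
  by (subst Bochner_Integration.integral_add[symmetric], simp_all only: part_int atMost_borel greaterThan_borel)
     (auto intro!: Bochner_Integration.integral_cong simp: indicator_def)

text \<open>Monotone likelihood ratio: raising \<open>s\<close> multiplies the weight at \<open>\<phi>\<close> by a function that increases with
\<open>\<phi>\<close>, so the posterior probability of \<open>\<phi> \<le> t\<close> decreases in \<open>s\<close>.\<close>

lemma odds_antimono:
  assumes s: "s \<in> S" "y \<in> S" "y \<le> s"
  shows "Zt t s * Z y \<le> Zt t y * Z s"
proof -
  \<comment> \<open>The ratio of the two weights at the threshold \<open>\<phi> = t\<close>.\<close>
  define E where "E = exp ((s - y) * t)"
  define C where "C s = (\<integral>x. f x * exp (s * \<phi> x) * indicator {t<..} (\<phi> x) \<partial>M)" for s
  have "0 \<le> C y" unfolding C_def using f_nonneg by simp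
  have fac: "exp (s * \<phi> x) = exp (y * \<phi> x) * exp ((s - y) * \<phi> x)" for x
    by (simp add: algebra_simps flip: exp_add)
  have "Zt t s \<le> (\<integral>x. E * (f x * exp (y * \<phi> x) * indicator {..t} (\<phi> x)) \<partial>M)"
    unfolding Zt_def
  proof (rule integral_mono)
    fix x
    have "\<phi> x \<le> t \<Longrightarrow> f x * (exp (y * \<phi> x) * exp ((s - y) * \<phi> x)) \<le> f x * (exp (y * \<phi> x) * E)"
      unfolding E_def using s f_nonneg by (intro mult_left_mono) (auto simp: mult_left_mono)
    then show "f x * exp (s * \<phi> x) * indicator {..t} (\<phi> x) \<le> E * (f x * exp (y * \<phi> x) * indicator {..t} (\<phi> x))"
      unfolding fac by (auto simp: indicator_def mult_ac)
  qed (use s in \<open>auto intro!: part_int\<close>)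
  then have 1: "Zt t s \<le> E * Zt t y" by (simp add: Zt_def)
  have "(\<integral>x. E * (f x * exp (y * \<phi> x) * indicator {t<..} (\<phi> x)) \<partial>M) \<le> C s"
    unfolding C_def
  proof (rule integral_mono)
    fix x
    have "t < \<phi> x \<Longrightarrow> f x * (exp (y * \<phi> x) * E) \<le> f x * (exp (y * \<phi> x) * exp ((s - y) * \<phi> x))"
      unfolding E_def using s f_nonneg by (intro mult_left_mono) (auto simp: mult_left_mono)
    then show "E * (f x * exp (y * \<phi> x) * indicator {t<..} (\<phi> x)) \<le> f x * exp (s * \<phi> x) * indicator {t<..} (\<phi> x)"
      unfolding fac by (auto simp: indicator_def mult_ac)
  qed (use s in \<open>auto intro!: part_int\<close>)
  then have 2: "E * C y \<le> C s" by (simp add: C_def)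
  have "Zt t s * C y \<le> E * Zt t y * C y" using 1 \<open>0 \<le> C y\<close> by (rule mult_right_mono)
  also have "\<dots> = Zt t y * (E * C y)" by simp
  also have "\<dots> \<le> Zt t y * C s" using 2 Zt_nonneg by (rule mult_left_mono)
  finally show ?thesis
    using Z_split[OF s(1), of t] Z_split[OF s(2), of t] by (simp add: C_def algebra_simps)
qed

text \<open>A uniformly distributed statistic that decreases in the data equals the probability of larger data.
Both inequalities follow by comparing a level set of the posterior distribution function with a
half-line.\<close>

lemma match_rat:
  assumes y: "y \<in> S" and t: "t \<in> \<rat>"
  shows "Zt t y * mh t = Z y * W t y"
proof -
  define G where "G s = Zt t s / Z s" for s
  define F where "F = W t y / mh t"
  have G01: "0 \<le> G y" "G y \<le> 1"
    using Zt_nonneg[of t y] Zt_le_Z[OF y, of t] Z_pos[OF y] by (auto simp: G_def)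
  have W0: "0 \<le> W t y" unfolding W_def using h_nonneg by simp
  have W1: "W t y \<le> mh t" unfolding W_def mh_def using h_nonneg
    by (intro integral_mono h_part_int h_int) (auto simp: indicator_def)
  have F01: "0 \<le> F" "F \<le> 1" using W0 W1 mh_pos[of t] by (auto simp: F_def)
  define A where "A \<alpha> = {s. Zt t s \<le> \<alpha> * Z s}" for \<alpha>
  have [measurable]: "A \<alpha> \<in> sets borel" for \<alpha> unfolding A_def by measurable
  have A: "(\<integral>s. h s * indicator (A \<alpha>) s * exp (t * s) \<partial>lborel) = \<alpha> * mh t"
    if "\<alpha> \<in> \<rat>" "0 \<le> \<alpha>" "\<alpha> \<le> 1" for \<alpha>
  proof -
    have "0 = (\<integral>s. (indicator (A \<alpha>) s - \<alpha>) * h s * exp (t * s) \<partial>lborel)"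
      using match[OF t that] by (simp add: A_def Z_def Zt_def)
    also have "\<dots> = (\<integral>s. h s * indicator (A \<alpha>) s * exp (t * s) - \<alpha> * (h s * exp (t * s)) \<partial>lborel)"
      by (intro Bochner_Integration.integral_cong) (auto simp: algebra_simps)
    also have "\<dots> = (\<integral>s. h s * indicator (A \<alpha>) s * exp (t * s) \<partial>lborel) - \<alpha> * mh t"
      unfolding mh_def by (subst Bochner_Integration.integral_diff) (auto intro!: h_part_int h_int)
    finally show ?thesis by simp
  qed
  have "\<not> G y < F"
  proof
    assume "G y < F"
    then obtain \<alpha> where \<alpha>: "\<alpha> \<in> \<rat>" "G y < \<alpha>" "\<alpha> < F" using Rats_dense_in_real by blast
    have "W t y \<le> (\<integral>s. h s * indicator (A \<alpha>) s * exp (t * s) \<partial>lborel)"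
      unfolding W_def
    proof (rule integral_mono_AE)
      show "AE x in lborel. h x * indicator {y<..} x * exp (t * x) \<le> h x * indicator (A \<alpha>) x * exp (t * x)"
        using AE_S
      proof eventually_elim
        case (elim x)
        show ?case
        proof (cases "0 < h x \<and> y < x")
          case True
          then have x: "x \<in> S" using elim by simp
          have "Zt t x * Z y \<le> Zt t y * Z x" using odds_antimono[OF x y] True by simp
          also have "Zt t y \<le> \<alpha> * Z y" using \<alpha>(2) Z_pos[OF y] by (simp add: G_def field_simps)
          then have "Zt t y * Z x \<le> \<alpha> * Z y * Z x" using Z_pos[OF x] by (intro mult_right_mono) auto
          finally have "Zt t x \<le> \<alpha> * Z x" using Z_pos[OF y] by (simp add: mult_ac)
          then show ?thesis using True by (simp add: A_def)
        next
          case False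
          then show ?thesis using h_nonneg[of x] by (auto simp: indicator_def)
        qed
      qed
    qed (auto intro!: h_part_int)
    also have "\<dots> = \<alpha> * mh t" using \<alpha> G01 F01 by (intro A) auto
    finally have "F \<le> \<alpha>" using mh_pos[of t] by (simp add: F_def field_simps)
    with \<alpha> show False by simp
  qed
  moreover have "\<not> F < G y"
  proof
    assume "F < G y"
    then obtain \<alpha> where \<alpha>: "\<alpha> \<in> \<rat>" "F < \<alpha>" "\<alpha> < G y" using Rats_dense_in_real by blast
    have "\<alpha> * mh t = (\<integral>s. h s * indicator (A \<alpha>) s * exp (t * s) \<partial>lborel)"
      using \<alpha> G01 F01 by (intro A[symmetric]) auto
    also have "\<dots> \<le> W t y"
      unfolding W_def
    proof (rule integral_mono_AE)
      show "AE x in lborel. h x * indicator (A \<alpha>) x * exp (t * x) \<le> h x * indicator {y<..} x * exp (t * x)"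
        using AE_S
      proof eventually_elim
        case (elim x)
        show ?case
        proof (cases "0 < h x \<and> x \<in> A \<alpha>")
          case True
          then have x: "x \<in> S" using elim by simp
          have "y < x"
          proof (rule ccontr)
            assume "\<not> y < x"
            then have "Zt t y * Z x \<le> Zt t x * Z y" using odds_antimono[OF y x] by simp
            also have "\<dots> \<le> \<alpha> * Z x * Z y"
              using True Z_pos[OF y] by (intro mult_right_mono) (auto simp: A_def)
            finally have "Zt t y \<le> \<alpha> * Z y" using Z_pos[OF x] by (simp add: mult_ac)
            then show False using \<alpha>(3) Z_pos[OF y] by (simp add: G_def field_simps)
          qed
          then show ?thesis using True by simp
        next
          case False
          then show ?thesis using h_nonneg[of x] by (auto simp: indicator_def)
        qed
      qed
    qed (auto intro!: h_part_int)
    finally have "\<alpha> \<le> F" using mh_pos[of t] by (simp add: F_def field_simps)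
    with \<alpha> show False by simp
  qed
  ultimately have "G y = F" by simp
  then show ?thesis using mh_pos[of t] Z_pos[OF y] by (simp add: G_def F_def field_simps)
qed

definition m1 :: "real \<Rightarrow> real" where "m1 t = (\<integral>x. h x * x * exp (t * x) \<partial>lborel)"
definition W1 :: "real \<Rightarrow> real \<Rightarrow> real" where
  "W1 t y = (\<integral>x. h x * indicator {y<..} x * x * exp (t * x) \<partial>lborel)"

lemma mh_deriv: "(mh has_real_derivative m1 t) (at t)"
  unfolding mh_def[abs_def] m1_def
  by (rule laplace_has_derivative[where I = UNIV]) (auto intro: h_int)

lemma hx_int: "integrable lborel (\<lambda>x. h x * x * exp (t * x))"
  by (rule laplace_has_derivative[where I = UNIV]) (auto intro: h_int)

lemma hx_part_int: "integrable lborel (\<lambda>x. h x * indicator B x * x * exp (t * x))"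
  if [measurable]: "B \<in> sets borel"
  by (rule laplace_has_derivative[where I = UNIV]) (auto intro!: h_part_int)

lemma W_deriv: "((\<lambda>t. W t y) has_real_derivative W1 t y) (at t)"
  unfolding W_def W1_def
  by (rule laplace_has_derivative[where I = UNIV]) (auto intro!: h_part_int)

lemma m1_cont: "isCont m1 t"
proof -
  have "(m1 has_real_derivative (\<integral>x. h x * x * x * exp (t * x) \<partial>lborel)) (at t)"
    unfolding m1_def[abs_def]
    by (rule laplace_has_derivative[where I = UNIV]) (auto intro: hx_int)
  then show ?thesis by (rule DERIV_isCont)
qed

lemma W1_cont: "isCont (\<lambda>t. W1 t y) t"
proof -
  have "((\<lambda>t. W1 t y) has_real_derivative (\<integral>x. h x * indicator {y<..} x * x * x * exp (t * x) \<partial>lborel)) (at t)"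
    unfolding W1_def
    by (rule laplace_has_derivative[where I = UNIV]) (auto intro!: hx_part_int)
  then show ?thesis by (rule DERIV_isCont)
qed

text \<open>Distribution functions are right-continuous in \<open>t\<close>, and the data side is continuous in \<open>t\<close>.\<close>

lemma match_real:
  assumes y: "y \<in> S"
  shows "Zt t y * mh t = Z y * W t y"
proof -
  have "\<exists>q. q \<in> \<rat> \<and> t < q \<and> q < t + 1 / Suc n" for n
    using Rats_dense_in_real[of t "t + 1 / Suc n"] by auto
  then obtain q where q: "\<And>n. q n \<in> \<rat>" "\<And>n. t < q n" "\<And>n. q n < t + 1 / Suc n" by metis
  have q_lim: "q \<longlonglongrightarrow> t"
  proof (rule tendsto_sandwich[of "\<lambda>n. t"])
    have "(\<lambda>n. t + inverse (real (Suc n))) \<longlonglongrightarrow> t + 0"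
      by (intro tendsto_add tendsto_const LIMSEQ_inverse_real_of_nat)
    then show "(\<lambda>n. t + 1 / Suc n) \<longlonglongrightarrow> t" by (simp add: inverse_eq_divide)
  qed (use q in \<open>auto intro!: always_eventually less_imp_le simp del: of_nat_Suc\<close>)
  have "(\<lambda>n. Zt (q n) y) \<longlonglongrightarrow> Zt t y"
    unfolding Zt_def
  proof (rule integral_dominated_convergence[where w = "\<lambda>x. f x * exp (y * \<phi> x)"])
    show "integrable M (\<lambda>x. f x * exp (y * \<phi> x))" using y by (simp add: S_def)
    show "AE x in M. (\<lambda>n. f x * exp (y * \<phi> x) * indicator {..q n} (\<phi> x)) \<longlonglongrightarrow> f x * exp (y * \<phi> x) * indicator {..t} (\<phi> x)"
    proof (intro AE_I2 tendsto_mult tendsto_const tendsto_eventually)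
      fix x
      show "\<forall>\<^sub>F n in sequentially. (indicator {..q n} (\<phi> x) :: real) = indicator {..t} (\<phi> x)"
      proof (cases "\<phi> x \<le> t")
        case True
        then have "\<phi> x \<le> q n" for n using q(2)[of n] by simp
        then show ?thesis using True by simp
      next
        case False
        then have "\<forall>\<^sub>F n in sequentially. q n < \<phi> x" using q_lim by (intro order_tendstoD) auto
        then show ?thesis by eventually_elim (use False in auto)
      qed
    qed
  qed (use f_nonneg in \<open>auto simp: indicator_def\<close>)
  moreover have "(\<lambda>n. mh (q n)) \<longlonglongrightarrow> mh t"
    by (rule isCont_tendsto_compose[OF DERIV_isCont[OF mh_deriv] q_lim])
  ultimately have 1: "(\<lambda>n. Zt (q n) y * mh (q n)) \<longlonglongrightarrow> Zt t y * mh t" by (rule tendsto_mult)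
  have "(\<lambda>n. Z y * W (q n) y) \<longlonglongrightarrow> Z y * W t y"
    by (intro tendsto_mult tendsto_const isCont_tendsto_compose[OF DERIV_isCont[OF W_deriv] q_lim])
  then have 2: "(\<lambda>n. Zt (q n) y * mh (q n)) \<longlonglongrightarrow> Z y * W t y"
    using match_rat[OF y q(1)] by simp
  show ?thesis using LIMSEQ_unique[OF 1 2] .
qed

text \<open>\<open>K t\<close> is the mean of the data under \<open>t\<close>, and \<open>J t y / mh t\<close> is the derivative in \<open>t\<close> of the
probability that the data exceed \<open>y\<close>.\<close>

definition K :: "real \<Rightarrow> real" where "K t = m1 t / mh t"
definition J :: "real \<Rightarrow> real \<Rightarrow> real" where "J t y = W1 t y - K t * W t y"

text \<open>The matching identity makes the posterior distribution function smooth in \<open>t\<close>, although the weight is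
only measurable: the smoothness is that of the Laplace transforms on the data side.\<close>

lemma Zt_deriv:
  assumes y: "y \<in> S"
  shows "((\<lambda>t. Zt t y) has_real_derivative Z y * (J t y / mh t)) (at t)"
proof -
  have eq: "Zt t y = Z y * (W t y / mh t)" for t
    using match_real[OF y, of t] mh_pos[of t] by (simp add: field_simps)
  have "((\<lambda>t. Z y * (W t y / mh t)) has_real_derivative Z y * ((W1 t y * mh t - W t y * m1 t) / (mh t * mh t))) (at t)"
    using mh_pos[of t] by (intro DERIV_cmult DERIV_divide W_deriv mh_deriv) auto
  also have "(W1 t y * mh t - W t y * m1 t) / (mh t * mh t) = J t y / mh t"
    using mh_pos[of t] by (simp add: J_def K_def field_simps)
  finally show ?thesis by (simp add: eq)
qed

lemma Zt_diff:
  assumes "y \<in> S" "a \<le> b"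
  shows "Zt b y - Zt a y = (\<integral>x. f x * exp (y * \<phi> x) * indicator {a<..b} (\<phi> x) \<partial>M)"
  unfolding Zt_def using assms(2)
  by (subst Bochner_Integration.integral_diff[symmetric], simp_all only: part_int assms(1) atMost_borel)
     (auto intro!: Bochner_Integration.integral_cong simp: indicator_def)

lemma J_nonneg: "y \<in> S \<Longrightarrow> 0 \<le> J t y"
proof -
  assume y: "y \<in> S"
  have "mono (\<lambda>t. Zt t y)"
  proof (rule monoI)
    fix a b :: real assume "a \<le> b"
    have "0 \<le> Zt b y - Zt a y" unfolding Zt_diff[OF y \<open>a \<le> b\<close>] using f_nonneg by simp
    then show "Zt a y \<le> Zt b y" by simp
  qed
  then have "0 \<le> Z y * (J t y / mh t)"
    using Zt_deriv[OF y] mono_on_imp_deriv_nonneg[of UNIV "\<lambda>t. Zt t y"] by auto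
  then show ?thesis using Z_pos[OF y] mh_pos[of t] by (simp add: zero_le_mult_iff zero_le_divide_iff)
qed

text \<open>The posterior mass of a short interval \<open>{t<..b}\<close> at \<open>y1\<close> and at \<open>y2\<close> differs, before normalisation,
by a factor between \<open>exp (t * (y1 - y2))\<close> and \<open>exp (b * (y1 - y2))\<close>. Letting \<open>b\<close> tend to \<open>t\<close> compares
the posterior densities of \<open>\<phi>\<close> at \<open>t\<close>, which exist by \<open>Zt_deriv\<close>.\<close>

lemma J_transport_le:
  assumes S: "y1 \<in> S" "y2 \<in> S" "y2 \<le> y1"
  shows "J t y1 * Z y1 = exp (t * (y1 - y2)) * (J t y2 * Z y2)"
proof -
  define d where "d = y1 - y2"
  have d: "0 \<le> d" using S by (simp add: d_def)
  have lim: "((\<lambda>b. (Zt b y - Zt t y) / (b - t)) \<longlongrightarrow> Z y * (J t y / mh t)) (at_right t)" if "y \<in> S" for y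
    using Zt_deriv[OF that, of t] unfolding has_field_derivative_iff
    by (rule tendsto_mono[rotated]) (simp add: at_le)
  have fac: "exp (y1 * \<phi> x) = exp (y2 * \<phi> x) * exp (d * \<phi> x)" for x
    by (simp add: d_def algebra_simps flip: exp_add)
  have up: "Zt b y1 - Zt t y1 \<le> exp (d * b) * (Zt b y2 - Zt t y2)"
    and lo: "exp (d * t) * (Zt b y2 - Zt t y2) \<le> Zt b y1 - Zt t y1" if "t < b" for b
  proof -
    have "t \<le> b" using that by simp
    have "(\<integral>x. f x * exp (y1 * \<phi> x) * indicator {t<..b} (\<phi> x) \<partial>M)
        \<le> (\<integral>x. exp (d * b) * (f x * exp (y2 * \<phi> x) * indicator {t<..b} (\<phi> x)) \<partial>M)"
    proof (rule integral_mono)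
      fix x
      have "\<phi> x \<le> b \<Longrightarrow> f x * (exp (y2 * \<phi> x) * exp (d * \<phi> x)) \<le> f x * (exp (y2 * \<phi> x) * exp (d * b))"
        using d f_nonneg by (intro mult_left_mono) (auto simp: mult_left_mono)
      then show "f x * exp (y1 * \<phi> x) * indicator {t<..b} (\<phi> x)
          \<le> exp (d * b) * (f x * exp (y2 * \<phi> x) * indicator {t<..b} (\<phi> x))"
        unfolding fac by (auto simp: indicator_def mult_ac)
    qed (use S in \<open>auto intro!: part_int\<close>)
    then show "Zt b y1 - Zt t y1 \<le> exp (d * b) * (Zt b y2 - Zt t y2)"
      using S \<open>t \<le> b\<close> by (simp add: Zt_diff)
    have "(\<integral>x. exp (d * t) * (f x * exp (y2 * \<phi> x) * indicator {t<..b} (\<phi> x)) \<partial>M)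
        \<le> (\<integral>x. f x * exp (y1 * \<phi> x) * indicator {t<..b} (\<phi> x) \<partial>M)"
    proof (rule integral_mono)
      fix x
      have "t < \<phi> x \<Longrightarrow> f x * (exp (y2 * \<phi> x) * exp (d * t)) \<le> f x * (exp (y2 * \<phi> x) * exp (d * \<phi> x))"
        using d f_nonneg by (intro mult_left_mono) (auto simp: mult_left_mono)
      then show "exp (d * t) * (f x * exp (y2 * \<phi> x) * indicator {t<..b} (\<phi> x))
          \<le> f x * exp (y1 * \<phi> x) * indicator {t<..b} (\<phi> x)"
        unfolding fac by (auto simp: indicator_def mult_ac)
    qed (use S in \<open>auto intro!: part_int\<close>)
    then show "exp (d * t) * (Zt b y2 - Zt t y2) \<le> Zt b y1 - Zt t y1"
      using S \<open>t \<le> b\<close> by (simp add: Zt_diff)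
  qed
  have elim: "\<forall>\<^sub>F b in at_right t. t < b" by (simp add: eventually_at_right_less)
  have expl: "((\<lambda>b. exp (d * b)) \<longlongrightarrow> exp (d * t)) (at_right t)" by (intro tendsto_intros)
  have "Z y1 * (J t y1 / mh t) \<le> exp (d * t) * (Z y2 * (J t y2 / mh t))"
    by (rule tendsto_le[OF _ tendsto_mult[OF expl lim[OF S(2)]] lim[OF S(1)]])
       (use elim in \<open>auto elim!: eventually_mono simp: divide_right_mono up\<close>)
  moreover have "exp (d * t) * (Z y2 * (J t y2 / mh t)) \<le> Z y1 * (J t y1 / mh t)"
    by (rule tendsto_le[OF _ lim[OF S(1)] tendsto_mult[OF tendsto_const lim[OF S(2)]]])
       (use elim in \<open>auto elim!: eventually_mono simp: divide_right_mono lo\<close>)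
  ultimately have "Z y1 * (J t y1 / mh t) = exp (d * t) * (Z y2 * (J t y2 / mh t))"
    by (rule antisym)
  then show ?thesis using mh_pos[of t] by (simp add: d_def field_simps)
qed

lemma J_transport:
  assumes S: "y1 \<in> S" "y2 \<in> S"
  shows "J t y1 * Z y1 * exp (- t * y1) = J t y2 * Z y2 * exp (- t * y2)"
proof -
  have *: "J t y * Z y * exp (- t * y) = J t x * Z x * exp (- t * x)" if "y \<in> S" "x \<in> S" "x \<le> y" for x y
    using J_transport_le[OF that, of t] by (simp add: algebra_simps flip: exp_add)
  show ?thesis using *[OF S] *[OF S(2) S(1)] by (cases "y2 \<le> y1") auto
qed

definition I :: "real set" where "I = interior S"

lemma S_convex: "convex S"
proof (rule convexI)
  fix x y u v :: real assume xy: "x \<in> S" "y \<in> S" and uv: "0 \<le> u" "0 \<le> v" "u + v = 1"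
  have "integrable M (\<lambda>z. f z * exp (x * \<phi> z) + f z * exp (y * \<phi> z))"
    using xy by (auto simp: S_def)
  then have "integrable M (\<lambda>z. f z * exp ((u *\<^sub>R x + v *\<^sub>R y) * \<phi> z))"
  proof (rule Bochner_Integration.integrable_bound)
    have "exp ((u * x + v * y) * p) \<le> exp (x * p) + exp (y * p)" for p
    proof (cases "x * p \<le> y * p")
      case True
      have "u * (x * p) + v * (y * p) \<le> u * (y * p) + v * (y * p)"
        using True uv by (intro add_right_mono mult_left_mono) auto
      also have "\<dots> = y * p" using uv by (simp flip: distrib_right)
      finally have "exp ((u * x + v * y) * p) \<le> exp (y * p)" by (simp add: algebra_simps)
      then show ?thesis using exp_ge_zero[of "x * p"] by linarith
    next
      case False
      have "u * (x * p) + v * (y * p) \<le> u * (x * p) + v * (x * p)"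
        using False uv by (intro add_left_mono mult_left_mono) auto
      also have "\<dots> = x * p" using uv by (simp flip: distrib_right)
      finally have "exp ((u * x + v * y) * p) \<le> exp (x * p)" by (simp add: algebra_simps)
      then show ?thesis using exp_ge_zero[of "y * p"] by linarith
    qed
    then have "f z * exp ((u * x + v * y) * \<phi> z) \<le> f z * (exp (x * \<phi> z) + exp (y * \<phi> z))" for z
      using f_nonneg by (intro mult_left_mono) auto
    then show "AE z in M. norm (f z * exp ((u *\<^sub>R x + v *\<^sub>R y) * \<phi> z)) \<le> norm (f z * exp (x * \<phi> z) + f z * exp (y * \<phi> z))"
      using f_nonneg by (intro AE_I2) (auto simp: distrib_left)
  qed simp
  then show "u *\<^sub>R x + v *\<^sub>R y \<in> S" by (simp add: S_def)
qed

lemma I_subset_S: "y \<in> I \<Longrightarrow> y \<in> S" and I_open: "open I" and I_convex: "convex I"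
  using interior_subset S_convex by (auto simp: I_def convex_interior)

lemma AE_I_line: "AE s in lborel. 0 < h s \<longrightarrow> s \<in> I"
  using AE_S AE_notin_frontier_convex[OF S_convex]
  by eventually_elim (use closure_subset in \<open>auto simp: I_def frontier_def\<close>)

lemma h_zero_contradiction: "AE s in lborel. s \<in> I \<longrightarrow> h s = 0 \<Longrightarrow> False"
proof -
  assume "AE s in lborel. s \<in> I \<longrightarrow> h s = 0"
  then have "AE s in lborel. h s = 0"
    using AE_I_line by eventually_elim (use h_nonneg in \<open>auto simp: less_le\<close>)
  with h_nonzero show False by simp
qed

lemma I_nonempty: "I \<noteq> {}"
  using h_zero_contradiction by force

definition Z1 :: "real \<Rightarrow> real" where "Z1 y = (\<integral>x. f x * \<phi> x * exp (y * \<phi> x) \<partial>M)"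

lemma Z1_meas [measurable]: "Z1 \<in> borel_measurable borel"
  unfolding Z1_def by measurable

lemma Z_deriv: "y \<in> I \<Longrightarrow> (Z has_real_derivative Z1 y) (at y)"
  unfolding Z_def[abs_def] Z1_def
  by (rule laplace_has_derivative[OF _ _ I_open]) (auto dest: I_subset_S simp: S_def)

lemma Z1_cont: "y \<in> I \<Longrightarrow> isCont Z1 y"
proof -
  assume y: "y \<in> I"
  have "integrable M (\<lambda>x. f x * \<phi> x * exp (s * \<phi> x))" if "s \<in> I" for s
    by (rule laplace_has_derivative[OF _ _ I_open that]) (auto dest: I_subset_S simp: S_def)
  then have "(Z1 has_real_derivative (\<integral>x. f x * \<phi> x * \<phi> x * exp (y * \<phi> x) \<partial>M)) (at y)"
    unfolding Z1_def[abs_def] by (intro laplace_has_derivative[OF _ _ I_open y]) auto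
  then show ?thesis by (rule DERIV_isCont)
qed

definition y0 :: real where "y0 = (SOME y. y \<in> I)"

text \<open>The density in \<open>\<phi> = t\<close> of the prior of the line problem, in the version that is continuous in \<open>t\<close>;
any other point of \<open>I\<close> in place of \<open>y0\<close> gives the same function.\<close>

definition prior :: "real \<Rightarrow> real" where "prior t = J t y0 * Z y0 * exp (- t * y0)"

lemma y0: "y0 \<in> I"
  unfolding y0_def using I_nonempty by (simp add: some_in_eq)

lemma J_eq: "y \<in> S \<Longrightarrow> J t y = prior t * exp (t * y) / Z y"
proof -
  assume y: "y \<in> S"
  have "prior t = J t y * Z y * exp (- t * y)"
    unfolding prior_def by (rule J_transport[OF I_subset_S[OF y0] y])
  then have "prior t * exp (t * y) / Z y = J t y * (Z y / Z y) * (exp (- t * y) * exp (t * y))"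
    by simp
  also have "\<dots> = J t y" using Z_pos[OF y] by (simp flip: exp_add)
  finally show ?thesis by simp
qed

lemma prior_nonneg: "0 \<le> prior t"
  using J_nonneg[OF I_subset_S[OF y0]] Z_pos[OF I_subset_S[OF y0]] by (simp add: prior_def)

lemma K_cont: "isCont K t"
  unfolding K_def[abs_def] using mh_pos[of t]
  by (intro continuous_intros m1_cont DERIV_isCont[OF mh_deriv]) auto

lemma prior_cont: "isCont prior t"
  unfolding prior_def[abs_def] J_def
  by (intro continuous_intros W1_cont K_cont DERIV_isCont[OF W_deriv])

definition D1 :: "real \<Rightarrow> real \<Rightarrow> real" where
  "D1 t y = prior t * (exp (t * y) * (t * Z y - Z1 y) / (Z y * Z y))"

lemma D_deriv:
  assumes "y \<in> I"
  shows "((\<lambda>y. prior t * exp (t * y) / Z y) has_real_derivative D1 t y) (at y)"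
proof -
  have "((\<lambda>y. prior t * (exp (t * y) / Z y)) has_real_derivative prior t * ((exp (t * y) * t * Z y - exp (t * y) * Z1 y) / (Z y * Z y))) (at y)"
    using Z_pos[OF I_subset_S[OF assms]]
    by (intro DERIV_cmult DERIV_divide Z_deriv assms) (auto intro!: derivative_eq_intros)
  then show ?thesis by (simp add: D1_def algebra_simps)
qed

lemma D1_cont: "y \<in> I \<Longrightarrow> isCont (D1 t) y"
  unfolding D1_def[abs_def] using Z_pos[OF I_subset_S, of y]
  by (intro continuous_intros Z1_cont DERIV_isCont[OF Z_deriv]) auto

lemma D1_meas [measurable]: "D1 t \<in> borel_measurable borel"
  unfolding D1_def[abs_def] by measurable

text \<open>The increments of \<open>J\<close> in the data variable, on one hand as integrals of \<open>h\<close> and on the other hand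
(in \<open>D_FTC\<close>) as integrals of the smooth function that \<open>J\<close> equals by \<open>J_eq\<close>. Comparison of the two
yields a pointwise equation for \<open>h\<close>.\<close>

lemma J_diff:
  assumes "a \<le> b"
  shows "J t a - J t b = (\<integral>x. (x - K t) * h x * exp (t * x) * indicator {a<..b} x \<partial>lborel)"
    and "integrable lborel (\<lambda>x. (x - K t) * h x * exp (t * x) * indicator {a<..b} x)"
proof -
  define p where "p B x = h x * indicator B x * x * exp (t * x) - K t * (h x * indicator B x * exp (t * x))" for B and x :: real
  have p_int: "integrable lborel (p B)" if "B \<in> sets borel" for B
    unfolding p_def using that
    by (intro Bochner_Integration.integrable_diff Bochner_Integration.integrable_mult_right hx_part_int h_part_int)
  have p: "(\<integral>x. p {y<..} x \<partial>lborel) = J t y" for y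
    unfolding p_def J_def W1_def W_def
    by (subst Bochner_Integration.integral_diff)
       (auto intro!: hx_part_int h_part_int Bochner_Integration.integrable_mult_right)
  have eq: "(x - K t) * h x * exp (t * x) * indicator {a<..b} x = p {a<..} x - p {b<..} x" for x
    using assms by (auto simp: p_def indicator_def algebra_simps)
  show "J t a - J t b = (\<integral>x. (x - K t) * h x * exp (t * x) * indicator {a<..b} x \<partial>lborel)"
    unfolding eq p[symmetric] by (rule Bochner_Integration.integral_diff[symmetric]) (auto intro: p_int)
  show "integrable lborel (\<lambda>x. (x - K t) * h x * exp (t * x) * indicator {a<..b} x)"
    unfolding eq by (intro Bochner_Integration.integrable_diff p_int) auto
qed

lemma I_interval:
  assumes ab: "a \<in> I" "b \<in> I"
  shows "{a..b} \<subseteq> I"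
proof
  fix x assume "x \<in> {a..b}"
  then have x: "a \<le> x" "x \<le> b" by auto
  have "is_interval I" using I_convex by (simp only: is_interval_convex_1)
  then show "x \<in> I" using ab x by (rule mem_is_interval_1_I)
qed

lemma D_FTC:
  assumes "a \<in> I" "b \<in> I" "a \<le> b"
  shows "J t b - J t a = (\<integral>x. D1 t x * indicator {a<..b} x \<partial>lborel)"
    and "integrable lborel (\<lambda>x. D1 t x * indicator {a<..b} x)"
proof -
  note sub = I_interval[OF assms(1,2)]
  have *: "(\<integral>x. D1 t x * indicator {a..b} x \<partial>lborel) = prior t * exp (t * b) / Z b - prior t * exp (t * a) / Z a"
    by (rule integral_FTC_Icc_real) (use assms sub in \<open>auto intro: D_deriv D1_cont\<close>)
  have eq: "AE x in lborel. D1 t x * indicator {a..b} x = D1 t x * indicator {a<..b} x"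
    using AE_lborel_singleton[of a] by eventually_elim (auto simp: indicator_def)
  have i: "integrable lborel (\<lambda>x. indicator {a..b} x *\<^sub>R D1 t x)"
    by (rule borel_integrable_compact) (use sub in \<open>auto intro!: continuous_at_imp_continuous_on D1_cont\<close>)
  show "integrable lborel (\<lambda>x. D1 t x * indicator {a<..b} x)"
    by (rule Bochner_Integration.integrable_bound[OF i]) (auto simp: indicator_def)
  have "(\<integral>x. D1 t x * indicator {a<..b} x \<partial>lborel) = (\<integral>x. D1 t x * indicator {a..b} x \<partial>lborel)"
    using eq by (intro integral_cong_AE) auto
  also have "\<dots> = J t b - J t a"
    unfolding * using assms by (simp add: J_eq I_subset_S)
  finally show "J t b - J t a = (\<integral>x. D1 t x * indicator {a<..b} x \<partial>lborel)" by simp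
qed

lemma AE_density_interval:
  assumes ab: "a \<in> I" "b \<in> I" "a \<le> b"
  shows "AE x in lborel. x \<in> {a<..b} \<longrightarrow> (x - K t) * h x * exp (t * x) + D1 t x = 0"
proof -
  define g where "g x = (x - K t) * h x * exp (t * x) * indicator {a<..b} x + D1 t x * indicator {a<..b} x" for x
  have "AE x in lborel. g x = 0"
  proof (rule integral_orthants_zero_imp_AE_zero)
    show "integrable lborel g"
      unfolding g_def by (intro Bochner_Integration.integrable_add J_diff D_FTC ab)
    fix c :: real
    show "(\<integral>y. g y * indicator {..c} y \<partial>lborel) = 0"
    proof (cases "a \<le> c")
      case False
      then have "(\<lambda>y. g y * indicator {..c} y) = (\<lambda>y. 0)" by (auto simp: g_def indicator_def)
      then show ?thesis by (simp only: integral_zero)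
    next
      case True
      define b' where "b' = min b c"
      have b': "b' \<in> I" "a \<le> b'" using I_interval[OF ab(1,2)] ab True by (auto simp: b'_def min_def)
      have "g y * indicator {..c} y = (y - K t) * h y * exp (t * y) * indicator {a<..b'} y + D1 t y * indicator {a<..b'} y" for y
        by (auto simp: g_def b'_def indicator_def)
      then have "(\<integral>y. g y * indicator {..c} y \<partial>lborel)
          = (\<integral>y. (y - K t) * h y * exp (t * y) * indicator {a<..b'} y \<partial>lborel) + (\<integral>y. D1 t y * indicator {a<..b'} y \<partial>lborel)"
        using J_diff(2)[OF b'(2)] D_FTC(2)[OF ab(1) b'] by simp
      also have "\<dots> = 0" using J_diff(1)[OF b'(2), of t] D_FTC(1)[OF ab(1) b', of t] by linarith
      finally show ?thesis .
    qed
  qed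
  then show ?thesis by eventually_elim (auto simp: g_def)
qed

definition hZ :: "real \<Rightarrow> real" where "hZ x = h x * Z x"
definition pmean :: "real \<Rightarrow> real" where "pmean x = Z1 x / Z x"

text \<open>The equation in which \<open>t\<close> and \<open>x\<close> are separated: for fixed \<open>x\<close> it is linear in the pair
\<open>(K t, prior t)\<close>.\<close>

definition good :: "real \<Rightarrow> bool" where
  "good x \<longleftrightarrow> x \<in> I \<and> (\<forall>t. (K t - x) * hZ x = prior t * (t - pmean x))"

text \<open>Each \<open>t\<close> and each interval contributes a null set. Rational \<open>t\<close> and rational end points keep their number
countable, and continuity of \<open>K\<close> and \<open>prior\<close> extends the equation to all \<open>t\<close>.\<close>

lemma AE_good: "AE x in lborel. x \<in> I \<longrightarrow> good x"
proof -
  have "AE x in lborel. \<forall>t\<in>\<rat>. \<forall>p\<in>\<rat> \<inter> I. \<forall>q\<in>\<rat> \<inter> I. p \<le> q \<longrightarrow> x \<in> {p<..q} \<longrightarrow> (x - K t) * h x * exp (t * x) + D1 t x = 0"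
    using countable_rat
    by (intro AE_ball_countable'[OF _ countable_rat] AE_ball_countable'[OF _ countable_Int1[OF countable_rat]])
       (use AE_density_interval in auto)
  then show ?thesis
  proof eventually_elim
    case (elim x)
    show ?case
    proof
      assume x: "x \<in> I"
      obtain e where e: "0 < e" "ball x e \<subseteq> I" using I_open x openE by blast
      obtain p where p: "p \<in> \<rat>" "x - e < p" "p < x" using Rats_dense_in_real[of "x - e" x] e by auto
      obtain q where q: "q \<in> \<rat>" "x < q" "q < x + e" using Rats_dense_in_real[of x "x + e"] e by auto
      have pq: "p \<in> I" "q \<in> I" using e p q by (auto intro!: subsetD[OF e(2)] simp: dist_real_def)
      have Z: "0 < Z x" using x by (intro Z_pos I_subset_S)
      have rat: "(K t - x) * hZ x - prior t * (t - pmean x) = 0" if t: "t \<in> \<rat>" for t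
      proof -
        have "(x - K t) * h x * exp (t * x) + D1 t x = 0" using elim t p q pq by force
        also have "D1 t x = exp (t * x) * (prior t * (t - pmean x) / Z x)"
          using Z by (simp add: D1_def pmean_def field_simps)
        finally have "exp (t * x) * ((x - K t) * h x + prior t * (t - pmean x) / Z x) = 0"
          by (simp add: algebra_simps)
        then have "(x - K t) * h x + prior t * (t - pmean x) / Z x = 0" by simp
        then have "(x - K t) * h x * Z x + prior t * (t - pmean x) = 0" using Z by (simp add: field_simps)
        then show ?thesis by (simp add: hZ_def algebra_simps)
      qed
      have "(K t - x) * hZ x - prior t * (t - pmean x) = 0" for t
        by (rule continuous_Rats_zero_imp_zero[OF _ rat])
           (auto intro!: continuous_at_imp_continuous_on continuous_intros K_cont prior_cont)
      then show "good x" using x by (simp add: good_def)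
    qed
  qed
qed

text \<open>If \<open>prior\<close> vanished at one \<open>t\<close>, the separated equation would make \<open>h\<close> vanish at almost every
\<open>x \<noteq> K t\<close>.\<close>

lemma prior_pos: "0 < prior t"
proof -
  have "prior t \<noteq> 0"
  proof
    assume p0: "prior t = 0"
    have "AE x in lborel. x \<in> I \<longrightarrow> h x = 0"
      using AE_good AE_lborel_singleton[of "K t"]
    proof eventually_elim
      case (elim x)
      show ?case
      proof
        assume x: "x \<in> I"
        then have "(K t - x) * hZ x = 0" using elim p0 by (simp add: good_def)
        then have "hZ x = 0" using elim by simp
        moreover have "0 < Z x" using x by (intro Z_pos I_subset_S)
        ultimately show "h x = 0" by (simp add: hZ_def)
      qed
    qed
    then show False by (rule h_zero_contradiction)
  qed
  then show ?thesis using prior_nonneg[of t] by simp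
qed

lemma hZ_pos: "good x \<Longrightarrow> 0 < hZ x"
proof -
  assume x: "good x"
  have "0 \<le> hZ x" using h_nonneg Z_pos[of x] x I_subset_S by (auto simp: hZ_def good_def)
  moreover have "hZ x \<noteq> 0"
  proof
    assume "hZ x = 0"
    moreover have "(K (pmean x + 1) - x) * hZ x = prior (pmean x + 1) * (pmean x + 1 - pmean x)"
      using x by (simp add: good_def)
    ultimately have "prior (pmean x + 1) = 0" by simp
    with prior_pos[of "pmean x + 1"] show False by simp
  qed
  ultimately show ?thesis by simp
qed

text \<open>Eliminating \<open>K t\<close> from the equations at \<open>x\<close> and \<open>y\<close> leaves \<open>prior t\<close> times an affine function of \<open>t\<close>
with slope \<open>hZ x - hZ y\<close>, equal to a constant that is non-zero. A non-zero slope would produce a zero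
of the affine function, because every real \<open>t\<close> is admissible. Tilts restricted to a half-line would
leave room for Gamma laws at this point.\<close>

lemma hZ_const:
  assumes "good x" "good y"
  shows "hZ x = hZ y"
proof (rule ccontr)
  assume ne: "hZ x \<noteq> hZ y"
  then have xy: "x \<noteq> y" by auto
  \<comment> \<open>The zero of the affine function.\<close>
  define t where "t = (hZ x * pmean y - hZ y * pmean x) / (hZ x - hZ y)"
  have t: "hZ x * (t - pmean y) - hZ y * (t - pmean x) = 0"
    using ne by (simp add: t_def field_simps)
  have "(K t - x) * hZ x = prior t * (t - pmean x)" "(K t - y) * hZ y = prior t * (t - pmean y)"
    using assms by (auto simp: good_def)
  then have "hZ y * ((K t - x) * hZ x) - hZ x * ((K t - y) * hZ y) = hZ y * (prior t * (t - pmean x)) - hZ x * (prior t * (t - pmean y))"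
    by simp
  also have "\<dots> = - prior t * (hZ x * (t - pmean y) - hZ y * (t - pmean x))" by algebra
  finally have "hZ y * ((K t - x) * hZ x) - hZ x * ((K t - y) * hZ y) = 0" unfolding t by simp
  moreover have "hZ y * ((K t - x) * hZ x) - hZ x * ((K t - y) * hZ y) = hZ x * hZ y * (y - x)" by algebra
  ultimately have "hZ x * hZ y * (y - x) = 0" by simp
  then show False using hZ_pos[OF assms(1)] hZ_pos[OF assms(2)] xy by simp
qed

text \<open>With \<open>hZ\<close> constant, subtracting the equations at two points shows that \<open>prior\<close> is constant too. Each
of \<open>K\<close> and \<open>pmean\<close> is then read off as an affine function from the equation at one fixed value of the
other variable.\<close>

lemma gaussian_line_in_I:
  obtains c \<kappa> x1 l1 where "0 < c" "0 < \<kappa>" "AE x in lborel. x \<in> I \<longrightarrow> hZ x = c"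
    "AE x in lborel. x \<in> I \<longrightarrow> pmean x = l1 + \<kappa> * (x - x1)" "\<And>t. K t = x1 + (t - l1) / \<kappa>"
proof -
  obtain x1 where x1: "x1 \<in> I" "good x1"
    using open_AE_imp_ex[OF I_open I_nonempty AE_good] by auto
  have "AE x in lborel. x \<in> I \<longrightarrow> good x \<and> x \<noteq> x1"
    using AE_good AE_lborel_singleton[of x1] by eventually_elim auto
  then obtain x2 where x2: "x2 \<in> I" "good x2" "x2 \<noteq> x1"
    using open_AE_imp_ex[OF I_open I_nonempty] by auto
  define c where "c = hZ x1"
  have c: "0 < c" using hZ_pos x1 by (simp add: c_def)
  have ac: "hZ x = c" if "good x" for x using hZ_const[OF that x1(2)] by (simp add: c_def)
  have eq: "(K t - x) * c = prior t * (t - pmean x)" if "good x" for x t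
    using that ac[OF that] by (simp add: good_def)
  have diff: "(x2 - x1) * c = prior t * (pmean x2 - pmean x1)" for t
    using eq[OF x1(2), of t] eq[OF x2(2), of t] by (simp add: algebra_simps)
  have ln: "pmean x2 \<noteq> pmean x1" using diff[of 0] c x2(3) by auto
  define k where "k = (x2 - x1) * c / (pmean x2 - pmean x1)"
  have pk: "prior t = k" for t using diff[of t] ln by (simp add: k_def field_simps)
  have k: "0 < k" using prior_pos[of 0] by (simp add: pk)
  have Kt: "K t = x1 + (t - pmean x1) / (c / k)" for t
    using eq[OF x1(2), of t] c k by (simp add: pk field_simps)
  have lx: "pmean x = pmean x1 + c / k * (x - x1)" if "good x" for x
    using eq[OF that, of "pmean x1"] eq[OF x1(2), of "pmean x1"] c k by (simp add: pk field_simps)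
  show ?thesis
  proof (rule that[of c "c / k" "pmean x1" x1])
    show "AE x in lborel. x \<in> I \<longrightarrow> hZ x = c" using AE_good by eventually_elim (blast intro: ac)
    show "AE x in lborel. x \<in> I \<longrightarrow> pmean x = pmean x1 + c / k * (x - x1)"
      using AE_good by eventually_elim (blast intro: lx)
  qed (use c k Kt in auto)
qed

text \<open>The mean of the data lies in the convex hull of their support. As \<open>K\<close> is affine with non-zero slope,
the support cannot be bounded on either side.\<close>

lemma K_bounds:
  shows "(\<And>x. x \<in> I \<Longrightarrow> x \<le> d) \<Longrightarrow> K t \<le> d" and "(\<And>x. x \<in> I \<Longrightarrow> d \<le> x) \<Longrightarrow> d \<le> K t"
proof -
  assume d: "\<And>x. x \<in> I \<Longrightarrow> x \<le> d"
  have "m1 t \<le> (\<integral>x. d * (h x * exp (t * x)) \<partial>lborel)"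
    unfolding m1_def
  proof (intro integral_mono_AE Bochner_Integration.integrable_mult_right h_int hx_int)
    show "AE x in lborel. h x * x * exp (t * x) \<le> d * (h x * exp (t * x))"
      using AE_I_line
    proof eventually_elim
      case (elim x)
      then show ?case using h_nonneg[of x] d[of x]
        by (cases "h x = 0") (auto simp: mult_ac intro!: mult_right_mono mult_left_mono)
    qed
  qed
  then show "K t \<le> d" using mh_pos[of t] by (simp add: K_def field_simps mh_def)
next
  assume d: "\<And>x. x \<in> I \<Longrightarrow> d \<le> x"
  have "(\<integral>x. d * (h x * exp (t * x)) \<partial>lborel) \<le> m1 t"
    unfolding m1_def
  proof (intro integral_mono_AE Bochner_Integration.integrable_mult_right h_int hx_int)
    show "AE x in lborel. d * (h x * exp (t * x)) \<le> h x * x * exp (t * x)"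
      using AE_I_line
    proof eventually_elim
      case (elim x)
      then show ?case using h_nonneg[of x] d[of x]
        by (cases "h x = 0") (auto simp: mult_ac intro!: mult_right_mono mult_left_mono)
    qed
  qed
  then show "d \<le> K t" using mh_pos[of t] by (simp add: K_def field_simps mh_def)
qed

text \<open>The conclusion of the one-dimensional analysis: the posterior mean is affine in the data, and it is
the logarithmic derivative of \<open>Z\<close>.\<close>

lemma gaussian_line:
  obtains c \<kappa> b d where "0 < c" "0 < \<kappa>" "AE s in lborel. h s * Z s = c"
    "\<And>s. integrable M (\<lambda>x. f x * exp (s * \<phi> x))" "\<And>s. Z s = exp (\<kappa> / 2 * s\<^sup>2 + b * s + d)"
proof -
  obtain c \<kappa> x1 l1 where c: "0 < c" and k: "0 < \<kappa>" and ac: "AE x in lborel. x \<in> I \<longrightarrow> hZ x = c"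
    and lx: "AE x in lborel. x \<in> I \<longrightarrow> pmean x = l1 + \<kappa> * (x - x1)" and Kt: "\<And>t. K t = x1 + (t - l1) / \<kappa>"
    by (rule gaussian_line_in_I) blast
  have Ksurj: "K (l1 + \<kappa> * (d - x1)) = d" for d using k by (simp add: Kt)
  have up: "\<exists>q\<in>I. x < q" for x
  proof (rule ccontr)
    assume "\<not> ?thesis"
    then have "K (l1 + \<kappa> * (x + 1 - x1)) \<le> x" by (intro K_bounds(1)) force
    then show False unfolding Ksurj by simp
  qed
  have dn: "\<exists>q\<in>I. q < x" for x
  proof (rule ccontr)
    assume "\<not> ?thesis"
    then have "x \<le> K (l1 + \<kappa> * (x - 1 - x1))" by (intro K_bounds(2)) force
    then show False unfolding Ksurj by simp
  qed
  have I: "x \<in> I" for x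
  proof -
    obtain p q where "p \<in> I" "q \<in> I" "p < x" "x < q" using up dn by blast
    then show ?thesis using I_interval[of p q] by auto
  qed
  have Zp: "0 < Z x" for x using I I_subset_S Z_pos by blast
  have l_eq: "pmean x = l1 + \<kappa> * (x - x1)" for x
  proof -
    have "pmean x - (l1 + \<kappa> * (x - x1)) = 0"
    proof (rule continuous_AE_zero_imp_zero[of "\<lambda>x. pmean x - (l1 + \<kappa> * (x - x1))"])
      show "continuous_on UNIV (\<lambda>x. pmean x - (l1 + \<kappa> * (x - x1)))"
        unfolding pmean_def using Zp
        by (intro continuous_at_imp_continuous_on ballI continuous_intros Z1_cont DERIV_isCont[OF Z_deriv] I) (simp add: less_imp_neq[symmetric])
      show "AE x in lborel. pmean x - (l1 + \<kappa> * (x - x1)) = 0" using lx by eventually_elim (simp add: I)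
    qed
    then show ?thesis by simp
  qed
  define b where "b = l1 - \<kappa> * x1"
  define d where "d = ln (Z 0)"
  have "((\<lambda>s. ln (Z s) - (\<kappa> / 2 * s\<^sup>2 + b * s)) has_real_derivative 0) (at s)" for s
  proof -
    have "((\<lambda>s. ln (Z s) - (\<kappa> / 2 * s\<^sup>2 + b * s)) has_real_derivative (Z1 s / Z s - (\<kappa> * s + b))) (at s)"
      using Zp[of s] by (auto intro!: derivative_eq_intros Z_deriv I simp: field_simps)
    also have "Z1 s / Z s - (\<kappa> * s + b) = 0"
      using l_eq[of s] by (simp add: pmean_def b_def algebra_simps)
    finally show ?thesis .
  qed
  then have cst: "ln (Z s) - (\<kappa> / 2 * s\<^sup>2 + b * s) = ln (Z 0) - (\<kappa> / 2 * 0\<^sup>2 + b * 0)" for s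
    by (intro DERIV_isconst_all) auto
  have lnZ: "ln (Z s) = \<kappa> / 2 * s\<^sup>2 + b * s + d" for s
    using cst[of s] by (simp add: d_def algebra_simps)
  show ?thesis
  proof (rule that[of c \<kappa> b d])
    show "Z s = exp (\<kappa> / 2 * s\<^sup>2 + b * s + d)" for s
      unfolding lnZ[symmetric] using Zp[of s] by simp
    show "AE s in lborel. h s * Z s = c" using ac by eventually_elim (simp add: I hZ_def)
    show "integrable M (\<lambda>x. f x * exp (s * \<phi> x))" for s
      using I_subset_S[OF I[of s]] by (simp add: S_def)
  qed (use c k in auto)
qed

end

section \<open>Functions that are quadratic on every line\<close>

text \<open>Polarisation of third differences, by an identity due to Djokovic: the mixed third difference with
steps \<open>u\<close>, \<open>v\<close>, \<open>w\<close> is an alternating sum of pure third differences with steps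
\<open>- (i *\<^sub>R u + (j / 2) *\<^sub>R v + (k / 3) *\<^sub>R w)\<close> for \<open>i, j, k\<close> in \<open>{0, 1}\<close>.\<close>

lemma third_differences_vanish:
  fixes L :: "'a::real_vector \<Rightarrow> real"
  assumes cube: "\<And>y w. L (y + 3 *\<^sub>R w) - 3 * L (y + 2 *\<^sub>R w) + 3 * L (y + w) - L y = 0"
  shows "L (u + v + w) - L (u + v) - L (u + w) - L (v + w) + L u + L v + L w - L 0 = 0"
proof -
  \<comment> \<open>In units of \<open>u\<close>, \<open>v / 2\<close> and \<open>w / 3\<close> all points of the identity are integral.\<close>
  define v' w' where "v' = (1/2) *\<^sub>R v" and "w' = (1/3) *\<^sub>R w"
  define F where "F i j k = L (i *\<^sub>R u + j *\<^sub>R v' + k *\<^sub>R w')" for i j k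
  have step: "F (i + 3 * a) (j + 3 * b) (k + 3 * c) - 3 * F (i + 2 * a) (j + 2 * b) (k + 2 * c)
      + 3 * F (i + a) (j + b) (k + c) - F i j k = 0" for i j k a b c :: real
  proof -
    have "(i + r * a) *\<^sub>R u + (j + r * b) *\<^sub>R v' + (k + r * c) *\<^sub>R w'
        = (i *\<^sub>R u + j *\<^sub>R v' + k *\<^sub>R w') + r *\<^sub>R (a *\<^sub>R u + b *\<^sub>R v' + c *\<^sub>R w')" for r
      by (simp add: algebra_simps)
    from this[of 3] this[of 2] this[of 1] show ?thesis
      using cube[of "i *\<^sub>R u + j *\<^sub>R v' + k *\<^sub>R w'" "a *\<^sub>R u + b *\<^sub>R v' + c *\<^sub>R w'"]
      by (simp add: F_def)
  qed
  have v: "v = 2 *\<^sub>R v'" and w: "w = 3 *\<^sub>R w'" by (simp_all add: v'_def w'_def)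
  have "F 1 2 3 - F 1 2 0 - F 1 0 3 - F 0 2 3 + F 1 0 0 + F 0 2 0 + F 0 0 3 - F 0 0 0 = 0"
    using step[of 1 "-1" 2 "-1" 3 "-1"] step[of 1 "-1" 2 "-1" 0 0] step[of 1 "-1" 0 0 3 "-1"]
      step[of 0 0 2 "-1" 3 "-1"] step[of 1 "-1" 0 0 0 0] step[of 0 0 2 "-1" 0 0] step[of 0 0 0 0 3 "-1"]
    by simp
  then show ?thesis by (simp add: F_def v w add.assoc)
qed

text \<open>The hypothesis is the interpolation formula for a quadratic polynomial in \<open>s\<close> with nodes \<open>-1\<close>, \<open>0\<close>
and \<open>1\<close>. It has this form because both sides depend continuously on \<open>y\<close> when \<open>L\<close> does, so it
passes from almost every line to all lines.\<close>

lemma quadratic_on_lines_imp_quadratic: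
  fixes L :: "real ^ 'n \<Rightarrow> real"
  assumes lines: "\<And>y w s. L (y + s *\<^sub>R w)
      = L y + s * (L (y + w) - L (y - w)) / 2 + s\<^sup>2 * (L (y + w) + L (y - w) - 2 * L y) / 2"
  obtains A b where "transpose A = A" "\<And>y. L y = y \<bullet> (A *v y) + b \<bullet> y + L 0"
    "\<And>y w. L (y + w) + L (y - w) - 2 * L y = 2 * (w \<bullet> (A *v w))"
proof -
  have cube: "L (y + 3 *\<^sub>R w) - 3 * L (y + 2 *\<^sub>R w) + 3 * L (y + w) - L y = 0" for y w
    using lines[of y 2 w] lines[of y 3 w] by (simp add: field_simps)
  define T where "T u v = L (u + v) - L u - L v + L 0" for u v
  have T_sym: "T u v = T v u" for u v by (simp add: T_def add.commute)
  have T_add: "T (u + v) w = T u w + T v w" for u v w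
    using third_differences_vanish[of L u v w, OF cube] by (simp add: T_def)
  have T_neg: "T v (- u) = - T v u" for u v
    using T_add[of u "- u" v] T_sym[of v] by (simp add: T_def)
  have T_scale: "T (s *\<^sub>R u) v = s * T u v" for s u v
  proof -
    have "T (s *\<^sub>R u) v = s / 2 * (T v u - T v (- u)) + s\<^sup>2 / 2 * (T v u + T v (- u))"
      using lines[of v s u] lines[of 0 s u] by (simp add: T_def field_simps)
    then show ?thesis unfolding T_neg using T_sym[of u v] by simp
  qed
  have T_linear: "linear (\<lambda>u. T u v)" for v
    by (rule linearI) (auto simp: T_add T_scale)
  define l where "l w = (L w - L (- w)) / 2" for w
  have l_linear: "linear l"
  proof (rule linearI)
    have TT: "T (- u) (- v) = T u v" for u v using T_neg[of "- u" v] T_neg[of v u] T_sym by simp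
    show "l (u + v) = l u + l v" for u v
      using TT[of u v] by (simp add: T_def l_def field_simps)
    show "l (s *\<^sub>R w) = s *\<^sub>R l w" for s w
      using lines[of 0 s w] lines[of 0 "- s" w] by (simp add: l_def)
  qed
  have L_eq: "L w = T w w / 2 + l w + L 0" for w
    using T_neg[of w w] by (simp add: T_def l_def field_simps)
  have rep: "g v = (\<chi> j. g (axis j 1)) \<bullet> v" if "linear g" for g :: "real ^ 'n \<Rightarrow> real" and v
  proof -
    have "g v = g (\<Sum>j\<in>UNIV. (v $ j) *\<^sub>R axis j 1)"
      using basis_expansion[of v] by (simp add: scalar_mult_eq_scaleR)
    also have "\<dots> = (\<Sum>j\<in>UNIV. v $ j * g (axis j 1))"
      using that by (simp add: linear_sum linear_scale)
    finally show ?thesis by (simp add: inner_vec_def mult.commute)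
  qed
  define B where "B u = (\<chi> j. T u (axis j 1))" for u
  have B_linear: "linear B"
    by (rule linearI) (simp_all add: B_def vec_eq_iff T_add T_scale)
  have T_B: "T u v = v \<bullet> (matrix B *v u)" for u v
  proof -
    have "T u v = B u \<bullet> v" using rep[OF T_linear[of u], of v] T_sym by (simp add: B_def)
    then show ?thesis using B_linear by (simp add: matrix_works inner_commute)
  qed
  define A where "A = (1/2) *\<^sub>R matrix B"
  have A: "w \<bullet> (A *v w) = T w w / 2" for w
    by (simp add: A_def T_B scaleR_matrix_vector_assoc[symmetric])
  show ?thesis
  proof (rule that[of A "\<chi> j. l (axis j 1)"])
    show "transpose A = A"
      by (auto simp: A_def matrix_def transpose_def vec_eq_iff B_def T_sym)
    show "L y = y \<bullet> (A *v y) + (\<chi> j. l (axis j 1)) \<bullet> y + L 0" for y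
      unfolding A rep[OF l_linear, symmetric] by (rule L_eq)
    show "L (y + w) + L (y - w) - 2 * L y = 2 * (w \<bullet> (A *v w))" for y w
      unfolding A using T_neg[of w w] T_neg[of y w] by (simp add: T_def)
  qed
qed

section \<open>Linear changes of variables\<close>

text \<open>The uniqueness argument for Haar measure: the functional on the left is invariant under
translation, and Fubini with the indicator of the unit ball makes it proportional to the Lebesgue
integral.\<close>

lemma nn_integral_linear_proportional:
  fixes G G' :: "'a::euclidean_space \<Rightarrow> 'a" and g :: "'a \<Rightarrow> ennreal"
  assumes G: "linear G" "\<And>x. G (G' x) = x"
    and [measurable]: "g \<in> borel_measurable borel"
  shows "(\<integral>\<^sup>+x. g (G x) \<partial>lborel) * emeasure lborel (ball (0::'a) 1)
       = (\<integral>\<^sup>+x. g x \<partial>lborel) * (\<integral>\<^sup>+x. indicator (ball 0 1) (G x) \<partial>lborel)"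
proof -
  define f where "f = (indicator (ball 0 1) :: 'a \<Rightarrow> ennreal)"
  have [measurable]: "f \<in> borel_measurable borel" unfolding f_def by (intro borel_measurable_indicator) simp
  have [measurable]: "G \<in> borel_measurable borel"
    using G(1) by (intro borel_measurable_continuous_onI linear_continuous_on) (simp add: linear_conv_bounded_linear)
  have "(\<integral>\<^sup>+x. g x \<partial>lborel) * (\<integral>\<^sup>+x. f (G x) \<partial>lborel) = (\<integral>\<^sup>+x. f (G x) * (\<integral>\<^sup>+y. g y \<partial>lborel) \<partial>lborel)"
    by (subst nn_integral_multc) (auto simp: mult.commute)
  also have "\<dots> = (\<integral>\<^sup>+x. f (G x) * (\<integral>\<^sup>+y. g (y + G x) \<partial>lborel) \<partial>lborel)"
    by (simp add: nn_integral_lborel_translate)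
  also have "\<dots> = (\<integral>\<^sup>+x. \<integral>\<^sup>+y. f (G x) * g (y + G x) \<partial>lborel \<partial>lborel)"
    by (simp add: nn_integral_cmult)
  also have "\<dots> = (\<integral>\<^sup>+y. \<integral>\<^sup>+x. f (G x) * g (y + G x) \<partial>lborel \<partial>lborel)"
    by (rule lborel_pair.Fubini'[symmetric]) measurable
  also have "\<dots> = (\<integral>\<^sup>+y. \<integral>\<^sup>+x. f (G (x + - G' y)) * g (y + G (x + - G' y)) \<partial>lborel \<partial>lborel)"
    by (intro nn_integral_cong nn_integral_lborel_translate[symmetric]) measurable
  also have "\<dots> = (\<integral>\<^sup>+y. \<integral>\<^sup>+x. f (G x - y) * g (G x) \<partial>lborel \<partial>lborel)"
    using G by (simp add: linear_diff)
  also have "\<dots> = (\<integral>\<^sup>+x. \<integral>\<^sup>+y. f (G x - y) * g (G x) \<partial>lborel \<partial>lborel)"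
    by (rule lborel_pair.Fubini') measurable
  also have "\<dots> = (\<integral>\<^sup>+x. (\<integral>\<^sup>+y. f (y + - G x) \<partial>lborel) * g (G x) \<partial>lborel)"
  proof (intro nn_integral_cong)
    fix x
    have "f (G x - y) = f (y + - G x)" for y
      by (simp add: f_def indicator_def dist_norm norm_minus_commute)
    then show "(\<integral>\<^sup>+y. f (G x - y) * g (G x) \<partial>lborel) = (\<integral>\<^sup>+y. f (y + - G x) \<partial>lborel) * g (G x)"
      by (simp add: nn_integral_multc)
  qed
  also have "\<dots> = (\<integral>\<^sup>+x. (\<integral>\<^sup>+y. f y \<partial>lborel) * g (G x) \<partial>lborel)"
    by (subst nn_integral_lborel_translate) auto
  also have "\<dots> = (\<integral>\<^sup>+y. f y \<partial>lborel) * (\<integral>\<^sup>+x. g (G x) \<partial>lborel)"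
    by (simp add: nn_integral_cmult)
  finally show ?thesis by (simp add: f_def mult.commute)
qed

text \<open>The constant of proportionality of an involution squares to one.\<close>

lemma nn_integral_linear_involution:
  fixes G :: "'a::euclidean_space \<Rightarrow> 'a" and g :: "'a \<Rightarrow> ennreal"
  assumes G: "linear G" "\<And>x. G (G x) = x" and g: "g \<in> borel_measurable borel"
  shows "(\<integral>\<^sup>+x. g (G x) \<partial>lborel) = (\<integral>\<^sup>+x. g x \<partial>lborel)"
proof -
  define V where "V = emeasure lborel (ball (0::'a) 1)"
  define c where "c = (\<integral>\<^sup>+x. indicator (ball (0::'a) 1) (G x) \<partial>lborel)"
  have V: "V \<noteq> \<infinity>" unfolding V_def using emeasure_lborel_ball_finite[of "0::'a" 1] by simp
  have V0: "V \<noteq> 0" unfolding V_def by (simp add: emeasure_ball unit_ball_vol_pos less_imp_neq[symmetric])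
  have Gm [measurable]: "G \<in> borel_measurable borel"
    using G(1) by (intro borel_measurable_continuous_onI linear_continuous_on) (simp add: linear_conv_bounded_linear)
  have m: "(\<lambda>x. indicator (ball 0 1) (G x) :: ennreal) \<in> borel_measurable borel"
    by (rule measurable_compose[OF Gm]) (intro borel_measurable_indicator, simp)
  have VV: "V * V = c * c"
    using nn_integral_linear_proportional[OF G m] by (simp add: G V_def c_def)
  have "c = V"
  proof -
    obtain r where r: "V = ennreal r" "0 \<le> r" using V by (cases V) auto
    have "c \<noteq> \<top>" using VV r by (auto simp: ennreal_mult_eq_top_iff simp flip: ennreal_mult)
    then obtain q where q: "c = ennreal q" "0 \<le> q" by (cases c) auto
    have "r * r = q * q" using VV r q by (simp flip: ennreal_mult)
    then have "r = q" using r q by (metis abs_of_nonneg abs_mult_self_eq power2_eq_square real_sqrt_abs)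
    then show ?thesis using r q by simp
  qed
  then have "(\<integral>\<^sup>+x. g (G x) \<partial>lborel) * V = (\<integral>\<^sup>+x. g x \<partial>lborel) * V"
    using nn_integral_linear_proportional[OF G g] by (simp add: V_def c_def)
  then have "(\<integral>\<^sup>+x. g (G x) \<partial>lborel) * V / V = (\<integral>\<^sup>+x. g x \<partial>lborel) * V / V" by simp
  then show ?thesis using V V0 by (simp add: mult_divide_eq_ennreal)
qed

text \<open>Change of variables for an arbitrary finite index type. By elimination, an invertible matrix is a product of
diagonal matrices, which scale the coordinates, and of matrices that are involutions up to a diagonal
factor.\<close>

lemma nn_integral_matrix_image:
  fixes A :: "real ^ 'n ^ 'n"
  assumes "det A \<noteq> 0" "g \<in> borel_measurable borel"
  shows "ennreal \<bar>det A\<bar> * (\<integral>\<^sup>+x. g (A *v x) \<partial>lborel) = (\<integral>\<^sup>+x. g x \<partial>lborel)"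
proof -
  define P where "P A \<longleftrightarrow> (det A \<noteq> 0 \<longrightarrow> (\<forall>g\<in>borel_measurable borel. ennreal \<bar>det A\<bar> * (\<integral>\<^sup>+x. g (A *v x) \<partial>lborel) = (\<integral>\<^sup>+x. g x \<partial>lborel)))" for A :: "real ^ 'n ^ 'n"
  have meas [measurable]: "(\<lambda>x. A *v x) \<in> borel_measurable borel" for A :: "real ^ 'n ^ 'n"
    by (intro borel_measurable_continuous_onI continuous_intros)
  have P_mult: "P (A ** B)" if "P A" "P B" for A B
    unfolding P_def
  proof (intro impI ballI)
    fix g :: "real ^ 'n \<Rightarrow> ennreal" assume nz: "det (A ** B) \<noteq> 0" and [measurable]: "g \<in> borel_measurable borel"
    have nz': "det A \<noteq> 0" "det B \<noteq> 0" using nz by (auto simp: det_mul)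
    have "ennreal \<bar>det (A ** B)\<bar> * (\<integral>\<^sup>+x. g ((A ** B) *v x) \<partial>lborel)
        = ennreal \<bar>det A\<bar> * (ennreal \<bar>det B\<bar> * (\<integral>\<^sup>+x. g (A *v (B *v x)) \<partial>lborel))"
      by (simp add: det_mul abs_mult ennreal_mult mult.assoc matrix_vector_mul_assoc)
    also have "ennreal \<bar>det B\<bar> * (\<integral>\<^sup>+x. g (A *v (B *v x)) \<partial>lborel) = (\<integral>\<^sup>+x. g (A *v x) \<partial>lborel)"
      using that(2) nz'(2) by (auto simp: P_def)
    also have "ennreal \<bar>det A\<bar> * (\<integral>\<^sup>+x. g (A *v x) \<partial>lborel) = (\<integral>\<^sup>+x. g x \<partial>lborel)"
      using that(1) nz'(1) by (auto simp: P_def)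
    finally show "ennreal \<bar>det (A ** B)\<bar> * (\<integral>\<^sup>+x. g ((A ** B) *v x) \<partial>lborel) = (\<integral>\<^sup>+x. g x \<partial>lborel)" .
  qed
  have P_inv: "P A" if inv: "A ** A = mat 1" for A
  proof -
    have "det A * det A = 1" using inv by (metis det_I det_mul)
    then have "(det A)\<^sup>2 = 1" by (simp add: power2_eq_square)
    then have "\<bar>det A\<bar> = 1" by (auto simp: power2_eq_1_iff)
    then show ?thesis
      using nn_integral_linear_involution[of "(*v) A"] inv
      by (auto simp: P_def matrix_vector_mul_assoc)
  qed
  have P_diag: "P A" if diag: "\<And>i j. i \<noteq> j \<Longrightarrow> A $ i $ j = 0" for A
    unfolding P_def
  proof (intro impI ballI)
    fix g :: "real ^ 'n \<Rightarrow> ennreal" assume nz: "det A \<noteq> 0" and [measurable]: "g \<in> borel_measurable borel"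
    have det: "det A = (\<Prod>i\<in>UNIV. A $ i $ i)" by (rule det_diagonal) (use diag in auto)
    define c where "c b = b \<bullet> (A *v b)" for b :: "real ^ 'n"
    have c_axis: "c (axis i 1) = A $ i $ i" for i
      by (simp add: c_def inner_axis' matrix_vector_mult_basis column_def)
    have c0: "c b \<noteq> 0" if "b \<in> Basis" for b
      using that nz by (auto simp: Basis_vec_def c_axis det)
    have prod_c: "(\<Prod>b\<in>Basis. \<bar>c b\<bar>) = \<bar>det A\<bar>"
    proof -
      have B: "(Basis :: (real ^ 'n) set) = range (\<lambda>i. axis i 1)" by (auto simp: Basis_vec_def)
      have "inj (\<lambda>i::'n. axis i (1::real))" by (auto simp: inj_on_def axis_eq_axis)
      then show ?thesis unfolding B det by (simp add: prod.reindex c_axis abs_prod)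
    qed
    have T: "(0 + (\<Sum>b\<in>Basis. (c b * (x \<bullet> b)) *\<^sub>R b)) = A *v x" for x
    proof -
      have "A *v x = (\<Sum>b\<in>Basis. ((A *v x) \<bullet> b) *\<^sub>R b)" by (rule euclidean_representation[symmetric])
      also have "\<dots> = (\<Sum>b\<in>Basis. (c b * (x \<bullet> b)) *\<^sub>R b)"
      proof (rule sum.cong)
        fix b :: "real ^ 'n" assume "b \<in> Basis"
        then obtain i where b: "b = axis i 1" by (auto simp: Basis_vec_def)
        have "(A *v x) $ i = (\<Sum>j\<in>UNIV. A $ i $ j * x $ j)" by (simp add: matrix_vector_mult_def)
        also have "\<dots> = (\<Sum>j\<in>UNIV. if j = i then A $ i $ i * x $ i else 0)"
          by (intro sum.cong) (auto simp: diag)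
        also have "\<dots> = A $ i $ i * x $ i" by simp
        finally show "((A *v x) \<bullet> b) *\<^sub>R b = (c b * (x \<bullet> b)) *\<^sub>R b"
          by (simp add: b c_axis inner_axis)
      qed simp
      finally show ?thesis by simp
    qed
    have lb: "lborel = density (distr lborel borel ((*v) A)) (\<lambda>_. ennreal \<bar>det A\<bar>)"
      using lborel_affine_euclidean[of c 0] c0
      unfolding T prod_c by simp
    have "(\<integral>\<^sup>+x. g x \<partial>lborel) = (\<integral>\<^sup>+x. g x \<partial>density (distr lborel borel ((*v) A)) (\<lambda>_. ennreal \<bar>det A\<bar>))"
      using lb by simp
    also have "\<dots> = ennreal \<bar>det A\<bar> * (\<integral>\<^sup>+x. g (A *v x) \<partial>lborel)"
      by (simp add: nn_integral_density nn_integral_distr nn_integral_cmult)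
    finally show "ennreal \<bar>det A\<bar> * (\<integral>\<^sup>+x. g (A *v x) \<partial>lborel) = (\<integral>\<^sup>+x. g x \<partial>lborel)" by simp
  qed
  have "P A"
  proof (rule induct_matrix_elementary)
    show "P A" if "row i A = 0" for A i
      using det_zero_row(2)[OF that] by (simp add: P_def)
    fix m n :: 'n and c :: real assume mn: "m \<noteq> n"
    show "P (\<chi> i j. mat 1 $ i $ Transposition.transpose m n j)"
      (is "P ?M")
    proof (rule P_inv)
      have M: "?M *v x = (\<chi> i. x $ Transposition.transpose m n i)" for x
      proof -
        have "(\<Sum>j\<in>UNIV. ?M $ i $ j * x $ j) = (\<Sum>j\<in>UNIV. if j = Transposition.transpose m n i then x $ j else 0)" for i
          by (intro sum.cong) (auto simp: mat_def)
        then show ?thesis by (simp add: matrix_vector_mult_def vec_eq_iff)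
      qed
      have "(?M ** ?M) *v x = x" for x
        unfolding matrix_vector_mul_assoc[symmetric] M by (simp add: vec_eq_iff)
      then show "?M ** ?M = mat 1" by (simp add: matrix_eq)
    qed
    \<comment> \<open>\<open>D\<close> reflects coordinate \<open>m\<close>; the shear composed with \<open>D\<close> is the involution \<open>E\<close>.\<close>
    define D E :: "real ^ 'n ^ 'n"
      where "D = (\<chi> i j. if i = j then (if i = m then - 1 else 1) else 0)"
        and "E = (\<chi> i j. if i = m \<and> j = n then c else if i = j then (if i = m then - 1 else 1) else 0)"
    have "P (E ** D)"
    proof (rule P_mult)
      show "P D" by (rule P_diag) (simp add: D_def)
      show "P E"
      proof (rule P_inv)
        have "(E ** E) *v x = x" for x
        proof -
          have E: "E *v x = (\<chi> i. if i = m then c * x $ n - x $ m else x $ i)" for x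
          proof -
            have "(\<Sum>j\<in>UNIV. E $ i $ j * x $ j) = (\<Sum>j\<in>UNIV. (if j = i then (if i = m then - 1 else 1) * x $ i else 0) + (if j = n then (if i = m then c * x $ n else 0) else 0))" for i
              using mn by (intro sum.cong) (auto simp: E_def)
            also have "\<dots> i = (if i = m then c * x $ n - x $ m else x $ i)" for i
              by (simp add: sum.distrib)
            finally show ?thesis by (simp add: matrix_vector_mult_def vec_eq_iff)
          qed
          show ?thesis unfolding matrix_vector_mul_assoc[symmetric] E using mn by (simp add: vec_eq_iff)
        qed
        then show "E ** E = mat 1" by (simp add: matrix_eq)
      qed
    qed
    also have "E ** D = (\<chi> i j. if i = m \<and> j = n then c else of_bool (i = j))"
    proof -
      have "(\<Sum>k\<in>UNIV. E $ i $ k * D $ k $ j) = (\<Sum>k\<in>UNIV. if k = j then E $ i $ j * (if j = m then - 1 else 1) else 0)" for i j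
        by (intro sum.cong) (auto simp: D_def)
      then show ?thesis using mn by (auto simp: vec_eq_iff matrix_matrix_mult_def E_def)
    qed
    finally show "P (\<chi> i j. if i = m \<and> j = n then c else of_bool (i = j))" .
  qed (use P_mult P_diag in auto)
  then show ?thesis using assms by (simp add: P_def)
qed

lemma nn_integral_matrix_affine:
  fixes A :: "real ^ 'n ^ 'n"
  assumes "det A \<noteq> 0" and [measurable]: "g \<in> borel_measurable borel"
  shows "ennreal \<bar>det A\<bar> * (\<integral>\<^sup>+x. g (A *v x + a) \<partial>lborel) = (\<integral>\<^sup>+x. g x \<partial>lborel)"
  using nn_integral_matrix_image[OF assms(1), of "\<lambda>x. g (x + a)"]
  by (simp add: nn_integral_lborel_translate)

section \<open>Positive definite matrices and Gaussian integrals\<close>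

lemma matrix_inv_mult:
  fixes A :: "real ^ 'n ^ 'n"
  assumes "invertible A"
  shows "A ** matrix_inv A = mat 1" "matrix_inv A ** A = mat 1"
proof -
  have "A ** matrix_inv A = mat 1 \<and> matrix_inv A ** A = mat 1"
    using assms unfolding matrix_inv_def invertible_def by (rule someI_ex)
  then show "A ** matrix_inv A = mat 1" "matrix_inv A ** A = mat 1" by auto
qed

lemma matrix_inv_cancel:
  fixes A :: "real ^ 'n ^ 'n"
  assumes "invertible A"
  shows "A *v (matrix_inv A *v x) = x" "matrix_inv A *v (A *v x) = x"
  using matrix_inv_mult[OF assms] by (simp_all add: matrix_vector_mul_assoc)

lemma matrix_inv_matrix_inv:
  fixes A :: "real ^ 'n ^ 'n"
  assumes "invertible A"
  shows "matrix_inv (matrix_inv A) = A"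
proof -
  have inv: "invertible (matrix_inv A)"
    using matrix_inv_mult[OF assms] by (auto simp: invertible_def)
  have "matrix_inv (matrix_inv A) *v x = A *v x" for x
    using matrix_inv_cancel(1)[OF inv, of x] matrix_inv_cancel(1)[OF assms] by metis
  then show ?thesis by (simp add: matrix_eq)
qed

lemma pos_def_invertible: "pos_def A \<Longrightarrow> invertible A"
  unfolding invertible_left_inverse matrix_left_invertible_ker pos_def_def
  by (metis inner_zero_right less_irrefl)

lemma pos_def_sym: "pos_def A \<Longrightarrow> x \<bullet> (A *v y) = (A *v x) \<bullet> y"
  unfolding pos_def_def by (metis dot_lmul_matrix transpose_matrix_vector)

lemma pos_def_matrix_inv:
  assumes "pos_def A"
  shows "pos_def (matrix_inv A)"
proof -
  note inv = pos_def_invertible[OF assms]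
  have sym: "transpose A = A" using assms by (simp add: pos_def_def)
  have "transpose (matrix_inv A) ** A = transpose (A ** matrix_inv A)"
    by (simp add: matrix_transpose_mul sym)
  also have "\<dots> = mat 1" by (simp add: matrix_inv_mult[OF inv])
  finally have "transpose (matrix_inv A) ** A ** matrix_inv A = matrix_inv A" by simp
  then have "transpose (matrix_inv A) = matrix_inv A"
    by (simp add: matrix_inv_mult[OF inv] flip: matrix_mul_assoc)
  moreover have "0 < x \<bullet> (matrix_inv A *v x)" if "x \<noteq> 0" for x
  proof -
    define z where "z = matrix_inv A *v x"
    have x: "x = A *v z" by (simp add: z_def matrix_inv_cancel[OF inv])
    with that have "z \<noteq> 0" by auto
    then have "0 < z \<bullet> (A *v z)" using assms by (simp add: pos_def_def)
    then show ?thesis unfolding z_def[symmetric] by (simp add: x inner_commute)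
  qed
  ultimately show ?thesis by (simp add: pos_def_def)
qed

text \<open>Gram-Schmidt for the inner product defined by \<open>A\<close>: fewer than \<open>CARD('n)\<close> linear conditions leave a
non-zero vector.\<close>

lemma pos_def_orthonormal_family:
  fixes A :: "real ^ 'n ^ 'n" and I :: "'n set"
  assumes A: "pos_def A" and "finite I"
  shows "\<exists>f :: 'n \<Rightarrow> real ^ 'n. \<forall>i\<in>I. \<forall>j\<in>I. f i \<bullet> (A *v f j) = (if i = j then 1 else 0)"
  using \<open>finite I\<close>
proof (induction I rule: finite_induct)
  case empty
  then show ?case by simp
next
  case (insert k I)
  then obtain f where f: "\<forall>i\<in>I. \<forall>j\<in>I. f i \<bullet> (A *v f j) = (if i = j then 1 else 0)" by blast
  have "dim ((\<lambda>i. A *v f i) ` I) \<le> card ((\<lambda>i. A *v f i) ` I)"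
    using insert.hyps by (intro dim_le_card') auto
  also have "\<dots> \<le> card I" using insert.hyps by (intro card_image_le)
  also have "\<dots> < card (insert k I)" using insert.hyps by simp
  also have "\<dots> \<le> CARD('n)" by (intro card_mono) auto
  finally have "dim ((\<lambda>i. A *v f i) ` I) < DIM(real ^ 'n)" by simp
  then obtain x where x: "x \<noteq> 0" "\<And>y. y \<in> span ((\<lambda>i. A *v f i) ` I) \<Longrightarrow> orthogonal x y"
    by (rule orthogonal_to_subspace_exists) blast
  define c where "c = x \<bullet> (A *v x)"
  have c: "0 < c" using A x(1) by (simp add: c_def pos_def_def)
  define e where "e = (1 / sqrt c) *\<^sub>R x"
  have ee: "e \<bullet> (A *v e) = 1"
  proof -
    have "e \<bullet> (A *v e) = (1 / sqrt c) * ((1 / sqrt c) * c)"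
      by (simp add: e_def c_def matrix_vector_mult_scaleR)
    also have "\<dots> = c / (sqrt c * sqrt c)" by simp
    also have "\<dots> = 1" using c by simp
    finally show ?thesis .
  qed
  have ef: "e \<bullet> (A *v f i) = 0" if "i \<in> I" for i
    using x(2)[of "A *v f i"] that by (auto simp: e_def orthogonal_def intro: span_base)
  have fe: "f i \<bullet> (A *v e) = 0" if "i \<in> I" for i
    using ef[OF that] pos_def_sym[OF A, of "f i" e] by (simp add: inner_commute)
  have "\<forall>i\<in>insert k I. \<forall>j\<in>insert k I. (f(k := e)) i \<bullet> (A *v (f(k := e)) j) = (if i = j then 1 else 0)"
    using insert.hyps f ee ef fe by auto
  then show ?case by blast
qed

lemma pos_def_factor:
  fixes A :: "real ^ 'n ^ 'n"
  assumes "pos_def A"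
  obtains F where "\<And>z. (F *v z) \<bullet> (A *v (F *v z)) = z \<bullet> z" "det A * (det F)\<^sup>2 = 1"
proof -
  obtain f :: "'n \<Rightarrow> real ^ 'n" where f: "\<forall>i. \<forall>j. f i \<bullet> (A *v f j) = (if i = j then 1 else 0)"
    using pos_def_orthonormal_family[OF assms finite[of UNIV]] unfolding ball_UNIV by blast
  define F :: "real ^ 'n ^ 'n" where "F = (\<chi> i j. f j $ i)"
  have F: "F *v axis j 1 = f j" for j
    by (simp add: F_def matrix_vector_mult_basis column_def vec_eq_iff)
  have "(transpose F ** A ** F) = mat 1"
  proof -
    have "(transpose F ** A ** F) $ i $ j = (if i = j then 1 else 0)" for i j
    proof -
      have "(transpose F ** A ** F) $ i $ j = axis i 1 \<bullet> ((transpose F ** A ** F) *v axis j 1)"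
        by (simp add: inner_axis' matrix_vector_mult_basis column_def)
      also have "(transpose F ** A ** F) *v axis j 1 = transpose F *v (A *v f j)"
        by (simp add: F flip: matrix_vector_mul_assoc)
      also have "axis i 1 \<bullet> \<dots> = (F *v axis i 1) \<bullet> (A *v f j)"
        by (metis dot_lmul_matrix transpose_matrix_vector transpose_transpose)
      also have "\<dots> = (if i = j then 1 else 0)" using f by (simp add: F)
      finally show ?thesis .
    qed
    then show ?thesis by (simp add: vec_eq_iff mat_def)
  qed
  note eq = this
  show ?thesis
  proof
    show "(F *v z) \<bullet> (A *v (F *v z)) = z \<bullet> z" for z
    proof -
      have "(F *v z) \<bullet> (A *v (F *v z)) = z \<bullet> (transpose F *v (A *v (F *v z)))"
        by (metis dot_lmul_matrix transpose_matrix_vector transpose_transpose)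
      also have "transpose F *v (A *v (F *v z)) = (transpose F ** A ** F) *v z"
        by (simp only: matrix_vector_mul_assoc matrix_mul_assoc)
      finally show ?thesis by (simp add: eq)
    qed
    have "det (transpose F ** A ** F) = 1" by (simp add: eq)
    then show "det A * (det F)\<^sup>2 = 1"
      by (simp add: det_mul det_transpose power2_eq_square mult_ac)
  qed
qed

lemma pos_def_det_pos: "pos_def A \<Longrightarrow> 0 < det A"
proof -
  assume "pos_def A"
  then obtain F :: "real ^ 'a ^ 'a" where "det A * (det F)\<^sup>2 = 1" by (metis pos_def_factor)
  then show ?thesis by (metis zero_less_mult_pos2 zero_less_one zero_le_power2 less_le mult_zero_right zero_neq_one)
qed

lemma matrix_vector_mult_measurable [measurable (raw)]:
  fixes A :: "real ^ 'n ^ 'm"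
  assumes "f \<in> borel_measurable M"
  shows "(\<lambda>x. A *v f x) \<in> borel_measurable M"
  by (rule measurable_compose[OF assms])
     (intro borel_measurable_continuous_onI matrix_vector_mult_linear_continuous_on)

lemma nn_integral_standard_gaussian:
  "(\<integral>\<^sup>+(x :: real ^ 'n). ennreal (exp (- (x \<bullet> x) / 2)) \<partial>lborel) = ennreal (sqrt ((2 * pi) ^ CARD('n)))"
proof -
  have one: "(\<integral>\<^sup>+x. ennreal (exp (- x\<^sup>2 / 2)) \<partial>lborel) = ennreal (sqrt (2 * pi))"
  proof -
    have "(\<integral>\<^sup>+x. ennreal (exp (- x\<^sup>2 / 2)) \<partial>lborel) = (\<integral>\<^sup>+x. ennreal (sqrt (2 * pi) * std_normal_density x) \<partial>lborel)"
      by (intro nn_integral_cong) (simp add: std_normal_density_def)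
    also have "\<dots> = ennreal (\<integral>x. sqrt (2 * pi) * std_normal_density x \<partial>lborel)"
      by (intro nn_integral_eq_integral) auto
    finally show ?thesis by simp
  qed
  have "(\<integral>\<^sup>+(x :: real ^ 'n). ennreal (exp (- (x \<bullet> x) / 2)) \<partial>lborel)
      = (\<integral>\<^sup>+(x :: real ^ 'n). (\<Prod>b\<in>Basis. ennreal (exp (- (x \<bullet> b)\<^sup>2 / 2))) \<partial>lborel)"
  proof (intro nn_integral_cong)
    fix x :: "real ^ 'n"
    have "x \<bullet> x = (\<Sum>b\<in>Basis. (x \<bullet> b)\<^sup>2)"
      by (subst euclidean_inner) (simp add: power2_eq_square)
    then have "- (x \<bullet> x) / 2 = (\<Sum>b\<in>Basis. - (x \<bullet> b)\<^sup>2 / 2)"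
      by (simp add: sum_negf sum_divide_distrib)
    then show "ennreal (exp (- (x \<bullet> x) / 2)) = (\<Prod>b\<in>Basis. ennreal (exp (- (x \<bullet> b)\<^sup>2 / 2)))"
      by (simp only: exp_sum finite_Basis) (simp add: prod_ennreal)
  qed
  also have "\<dots> = (\<Prod>b\<in>(Basis :: (real ^ 'n) set). ennreal (sqrt (2 * pi)))"
    by (subst nn_integral_lborel_prod) (simp_all only: one, auto)
  also have "\<dots> = ennreal (sqrt ((2 * pi) ^ CARD('n)))"
    by (subst real_sqrt_power) (simp only: prod_constant DIM_cart DIM_real mult_1_right ennreal_power real_sqrt_ge_0_iff pi_ge_zero mult_nonneg_nonneg zero_le_numeral)
  finally show ?thesis .
qed

text \<open>The factorisation of \<open>B\<close> by a basis that is orthonormal for it reduces the integral to the standard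
one, and the Jacobian of this basis is \<open>1 / sqrt (det B)\<close>.\<close>

lemma nn_integral_gaussian:
  fixes B :: "real ^ 'n ^ 'n"
  assumes "pos_def B"
  shows "(\<integral>\<^sup>+x. ennreal (exp (- (x \<bullet> (B *v x)) / 2)) \<partial>lborel) = ennreal (sqrt ((2 * pi) ^ CARD('n) / det B))"
proof -
  obtain F where F: "\<And>z. (F *v z) \<bullet> (B *v (F *v z)) = z \<bullet> z" "det B * (det F)\<^sup>2 = 1"
    using pos_def_factor[OF assms] by metis
  have [measurable]: "(\<lambda>x. ennreal (exp (- (x \<bullet> (B *v x)) / 2))) \<in> borel_measurable borel"
    by measurable
  have nz: "det F \<noteq> 0" using F(2) by auto
  have "(\<integral>\<^sup>+x. ennreal (exp (- (x \<bullet> (B *v x)) / 2)) \<partial>lborel)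
      = ennreal \<bar>det F\<bar> * (\<integral>\<^sup>+x. ennreal (exp (- ((F *v x) \<bullet> (B *v (F *v x))) / 2)) \<partial>lborel)"
    by (rule nn_integral_matrix_image[OF nz, symmetric]) simp
  also have "\<dots> = ennreal (\<bar>det F\<bar> * sqrt ((2 * pi) ^ CARD('n)))"
    by (simp only: F(1) nn_integral_standard_gaussian ennreal_mult[symmetric] abs_ge_zero real_sqrt_ge_0_iff pi_ge_zero zero_le_power mult_nonneg_nonneg zero_le_numeral)
  also have "\<bar>det F\<bar> = sqrt (1 / det B)"
  proof -
    have "1 / det B = (det F)\<^sup>2"
      using F(2) pos_def_det_pos[OF assms] by (simp add: eq_divide_eq divide_eq_eq mult.commute)
    then show ?thesis by simp
  qed
  also have "sqrt (1 / det B) * sqrt ((2 * pi) ^ CARD('n)) = sqrt ((2 * pi) ^ CARD('n) / det B)"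
    by (simp add: real_sqrt_mult real_sqrt_divide)
  finally show ?thesis .
qed

lemma gauss_density_meas [measurable]:
  "(\<lambda>p. gauss_density (fst p) S (snd p)) \<in> borel_measurable (borel :: ((real ^ 'n) \<times> (real ^ 'n)) measure)"
  unfolding gauss_density_def borel_prod[symmetric] by measurable

lemma gauss_density_meas2 [measurable (raw)]:
  assumes [measurable]: "f \<in> borel_measurable M" "g \<in> borel_measurable M"
  shows "(\<lambda>x. gauss_density (f x) S (g x)) \<in> borel_measurable M"
  using measurable_compose[of "\<lambda>x. (f x, g x)" M borel, OF _ gauss_density_meas[of S]]
  by (simp add: borel_prod[symmetric])

lemma gauss_density_pos: "pos_def S \<Longrightarrow> 0 < gauss_density \<mu> S y"
  using pos_def_det_pos[of S] by (simp add: gauss_density_def)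

lemma nn_integral_gauss_density:
  assumes "pos_def S"
  shows "(\<integral>\<^sup>+y. ennreal (gauss_density \<mu> S y) \<partial>lborel) = 1"
proof -
  define B where "B = matrix_inv S"
  have B: "pos_def B" unfolding B_def by (rule pos_def_matrix_inv[OF assms])
  have "det S * det B = 1"
    unfolding B_def using matrix_inv_mult[OF pos_def_invertible[OF assms]] by (metis det_I det_mul)
  then have detB: "det S = 1 / det B" using pos_def_det_pos[OF B] by (simp add: field_simps)
  define c where "c = sqrt ((2 * pi) ^ CARD('a) * det S)"
  have c: "0 < c" using pos_def_det_pos[OF assms] by (simp add: c_def)
  have [measurable]: "(\<lambda>x. ennreal (exp (- (x \<bullet> (B *v x)) / 2))) \<in> borel_measurable borel"
    by measurable
  have "(\<integral>\<^sup>+y. ennreal (gauss_density \<mu> S y) \<partial>lborel)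
      = (\<integral>\<^sup>+y. ennreal (gauss_density \<mu> S (y + \<mu>)) \<partial>lborel)"
    by (rule nn_integral_lborel_translate[symmetric]) measurable
  also have "\<dots> = (\<integral>\<^sup>+x. ennreal (1 / c) * ennreal (exp (- (x \<bullet> (B *v x)) / 2)) \<partial>lborel)"
    using c by (intro nn_integral_cong) (simp add: gauss_density_def B_def c_def flip: ennreal_mult)
  also have "\<dots> = ennreal (1 / c) * ennreal (sqrt ((2 * pi) ^ CARD('a) / det B))"
    by (subst nn_integral_cmult) (simp_all only: nn_integral_gaussian[OF B], simp)
  also have "\<dots> = ennreal (1 / c * c)"
    using c by (subst ennreal_mult) (auto simp: c_def detB)
  finally show ?thesis using c by simp
qed

section \<open>The selective model as an exponential family\<close>

text \<open>The two factors of the selective density that depend on one variable only; the remaining factor is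
\<open>exp ((matrix_inv \<Sigma> *v \<theta>) \<bullet> y)\<close>.\<close>

definition sel_base :: "real ^ 'n ^ 'n \<Rightarrow> (real ^ 'n \<Rightarrow> real) \<Rightarrow> real ^ 'n \<Rightarrow> real" where
  "sel_base \<Sigma> p y = exp (- (y \<bullet> (matrix_inv \<Sigma> *v y)) / 2) * p y"

definition sel_norm :: "real ^ 'n ^ 'n \<Rightarrow> (real ^ 'n \<Rightarrow> real) \<Rightarrow> real ^ 'n \<Rightarrow> real" where
  "sel_norm \<Sigma> p \<theta> = exp (- (\<theta> \<bullet> (matrix_inv \<Sigma> *v \<theta>)) / 2) /
     (sqrt ((2 * pi) ^ CARD('n) * det \<Sigma>) * selection_prob \<Sigma> p \<theta>)"

lemma quadratic_form_diff:
  assumes "pos_def B"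
  shows "(y - \<mu>) \<bullet> (B *v (y - \<mu>)) = y \<bullet> (B *v y) - 2 * ((B *v \<mu>) \<bullet> y) + \<mu> \<bullet> (B *v \<mu>)"
  using pos_def_sym[OF assms, of \<mu> y]
  by (simp add: matrix_vector_mult_diff_distrib inner_diff_left inner_diff_right inner_commute)

lemma selective_density_factor:
  assumes "pos_def \<Sigma>"
  shows "selective_density \<Sigma> p \<theta> y = sel_norm \<Sigma> p \<theta> * sel_base \<Sigma> p y * exp ((matrix_inv \<Sigma> *v \<theta>) \<bullet> y)"
proof -
  have "exp (- ((y - \<theta>) \<bullet> (matrix_inv \<Sigma> *v (y - \<theta>))) / 2)
      = exp (- (y \<bullet> (matrix_inv \<Sigma> *v y)) / 2) * exp ((matrix_inv \<Sigma> *v \<theta>) \<bullet> y) * exp (- (\<theta> \<bullet> (matrix_inv \<Sigma> *v \<theta>)) / 2)"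
    unfolding quadratic_form_diff[OF pos_def_matrix_inv[OF assms]] exp_add[symmetric]
    by (rule arg_cong[of _ _ exp]) (simp add: field_simps)
  then show ?thesis by (simp add: selective_density_def gauss_density_def sel_norm_def sel_base_def)
qed

context
  fixes \<Sigma> :: "real ^ 'n ^ 'n" and p :: "real ^ 'n \<Rightarrow> real"
  assumes Sig: "pos_def \<Sigma>" and sel: "selection_function \<Sigma> p"
begin

lemma p_meas [measurable]: "p \<in> borel_measurable borel" and p_nonneg: "0 \<le> p y"
  using sel by (auto simp: selection_function_def)

lemma selection_prob_pos: "0 < selection_prob \<Sigma> p \<theta>"
  using sel by (auto simp: selection_function_def)

lemma selection_prob_lborel:
  shows "selection_prob \<Sigma> p \<theta> = (\<integral>y. gauss_density \<theta> \<Sigma> y * p y \<partial>lborel)"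
    and "integrable lborel (\<lambda>y. gauss_density \<theta> \<Sigma> y * p y)"
proof -
  have i: "integrable (gauss_measure \<theta> \<Sigma>) p" using sel by (auto simp: selection_function_def)
  show "selection_prob \<Sigma> p \<theta> = (\<integral>y. gauss_density \<theta> \<Sigma> y * p y \<partial>lborel)"
    unfolding selection_prob_def gauss_measure_def
    by (subst integral_density) (auto intro!: AE_I2 less_imp_le gauss_density_pos Sig)
  show "integrable lborel (\<lambda>y. gauss_density \<theta> \<Sigma> y * p y)"
    using i unfolding gauss_measure_def
    by (subst (asm) integrable_density) (auto intro!: AE_I2 less_imp_le gauss_density_pos Sig)
qed

lemma selection_prob_meas [measurable]: "selection_prob \<Sigma> p \<in> borel_measurable borel"
  unfolding selection_prob_lborel(1)[abs_def] by measurable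

lemma selective_density_meas [measurable (raw)]:
  assumes [measurable]: "f \<in> borel_measurable M" "g \<in> borel_measurable M"
  shows "(\<lambda>x. selective_density \<Sigma> p (f x) (g x)) \<in> borel_measurable M"
  unfolding selective_density_def by measurable

lemma selective_density_nonneg: "0 \<le> selective_density \<Sigma> p \<theta> y"
  using selection_prob_pos[of \<theta>] gauss_density_pos[OF Sig, of \<theta> y] p_nonneg[of y]
  by (simp add: selective_density_def)

lemma selective_density_integral:
  shows "integrable lborel (selective_density \<Sigma> p \<theta>)" and "(\<integral>y. selective_density \<Sigma> p \<theta> y \<partial>lborel) = 1"
    and "(\<integral>\<^sup>+y. ennreal (selective_density \<Sigma> p \<theta> y) \<partial>lborel) = 1"
proof -
  show i: "integrable lborel (selective_density \<Sigma> p \<theta>)"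
    unfolding selective_density_def[abs_def] by (intro integrable_divide_zero) (simp add: selection_prob_lborel)
  show o: "(\<integral>y. selective_density \<Sigma> p \<theta> y \<partial>lborel) = 1"
    unfolding selective_density_def using selection_prob_pos[of \<theta>]
    by (simp flip: selection_prob_lborel(1))
  show "(\<integral>\<^sup>+y. ennreal (selective_density \<Sigma> p \<theta> y) \<partial>lborel) = 1"
    using i o by (subst nn_integral_eq_integral) (auto intro: selective_density_nonneg)
qed

lemma sel_norm_pos: "0 < sel_norm \<Sigma> p \<theta>"
  unfolding sel_norm_def using selection_prob_pos[of \<theta>] pos_def_det_pos[OF Sig] by simp

lemma sel_base_meas [measurable]: "sel_base \<Sigma> p \<in> borel_measurable borel"
  unfolding sel_base_def[abs_def] by measurable

lemma sel_norm_meas [measurable]: "sel_norm \<Sigma> p \<in> borel_measurable borel"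
  unfolding sel_norm_def[abs_def] by measurable

lemma sel_base_nonneg: "0 \<le> sel_base \<Sigma> p y"
  using p_nonneg by (simp add: sel_base_def)

lemma sel_base_laplace:
  shows "integrable lborel (\<lambda>y. sel_base \<Sigma> p y * exp (z \<bullet> y))"
    and "sel_norm \<Sigma> p \<theta> * (\<integral>y. sel_base \<Sigma> p y * exp ((matrix_inv \<Sigma> *v \<theta>) \<bullet> y) \<partial>lborel) = 1"
proof -
  have eq: "selective_density \<Sigma> p \<theta> = (\<lambda>y. sel_norm \<Sigma> p \<theta> * (sel_base \<Sigma> p y * exp ((matrix_inv \<Sigma> *v \<theta>) \<bullet> y)))" for \<theta>
    using selective_density_factor[OF Sig] by (auto simp: mult.assoc)
  have "integrable lborel (\<lambda>y. sel_norm \<Sigma> p (\<Sigma> *v z) * (sel_base \<Sigma> p y * exp ((matrix_inv \<Sigma> *v (\<Sigma> *v z)) \<bullet> y)))"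
    using selective_density_integral(1)[of "\<Sigma> *v z"] unfolding eq .
  then show "integrable lborel (\<lambda>y. sel_base \<Sigma> p y * exp (z \<bullet> y))"
    using sel_norm_pos[of "\<Sigma> *v z"] by (simp add: matrix_inv_cancel[OF pos_def_invertible[OF Sig]])
  show "sel_norm \<Sigma> p \<theta> * (\<integral>y. sel_base \<Sigma> p y * exp ((matrix_inv \<Sigma> *v \<theta>) \<bullet> y) \<partial>lborel) = 1"
    using selective_density_integral(2)[of \<theta>] unfolding eq by simp
qed

lemma marginal_posterior_cdf_eq:
  assumes [measurable]: "\<pi> \<in> borel_measurable borel"
  shows "marginal_posterior_cdf \<Sigma> p \<pi> v y t =
    enn2real (\<integral>\<^sup>+\<theta>. ennreal (\<pi> \<theta> * selective_density \<Sigma> p \<theta> y / (\<integral>\<eta>. \<pi> \<eta> * selective_density \<Sigma> p \<eta> y \<partial>lborel))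
       * indicator {..t} (v \<bullet> \<theta>) \<partial>lborel)"
proof -
  have "emeasure (distr (posterior_measure \<Sigma> p \<pi> y) borel (\<lambda>\<theta>. v \<bullet> \<theta>)) {..t}
      = emeasure (posterior_measure \<Sigma> p \<pi> y) ((\<lambda>\<theta>. v \<bullet> \<theta>) -` {..t} \<inter> space (posterior_measure \<Sigma> p \<pi> y))"
    by (rule emeasure_distr) (auto simp: posterior_measure_def)
  also have "\<dots> = (\<integral>\<^sup>+\<theta>. ennreal (\<pi> \<theta> * selective_density \<Sigma> p \<theta> y / (\<integral>\<eta>. \<pi> \<eta> * selective_density \<Sigma> p \<eta> y \<partial>lborel))
       * indicator {..t} (v \<bullet> \<theta>) \<partial>lborel)"
  proof -
    have [measurable]: "(\<lambda>\<theta>. v \<bullet> \<theta>) -` {..t} \<in> sets borel"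
      using measurable_sets[of "\<lambda>\<theta>. v \<bullet> \<theta>" borel borel "{..t}"] by simp
    show ?thesis
      unfolding posterior_measure_def
      by (subst emeasure_density) (auto intro!: nn_integral_cong simp: indicator_def)
  qed
  finally show ?thesis by (simp add: marginal_posterior_cdf_def cdf_def measure_def)
qed

lemma marginal_posterior_cdf_meas [measurable]:
  assumes [measurable]: "\<pi> \<in> borel_measurable borel"
  shows "(\<lambda>y. marginal_posterior_cdf \<Sigma> p \<pi> v y t) \<in> borel_measurable borel"
  unfolding marginal_posterior_cdf_eq[OF assms] by measurable

end

lemma real_distribution_uniform: "real_distribution (density lborel (indicator {0..1::real}))"
proof -
  have "emeasure (density lborel (indicator {0..1::real})) UNIV = 1"
    by (subst emeasure_density) auto
  then have "prob_space (density lborel (indicator {0..1::real}))" by (intro prob_spaceI) simp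
  then show ?thesis by (auto simp: real_distribution_def real_distribution_axioms_def)
qed

lemma cdf_uniform_01:
  assumes "0 \<le> x" "x \<le> 1"
  shows "measure (density lborel (indicator {0..1::real})) {..x} = x"
proof -
  have "emeasure (density lborel (indicator {0..1::real})) {..x} = (\<integral>\<^sup>+y. indicator {0..x} y \<partial>lborel)"
  proof -
    have "indicator {0..1} y * indicator {..x} y = (indicator {0..x} y :: ennreal)" for y
      using assms by (auto simp: indicator_def)
    then show ?thesis by (subst emeasure_density) simp_all
  qed
  also have "\<dots> = ennreal x" using assms by simp
  finally show ?thesis using assms by (simp add: measure_def)
qed

text \<open>The distribution function need not be injective. Hence the level set \<open>{x. cdf M x \<le> a}\<close> is enclosed
between half-lines whose probabilities are \<open>a\<close> and an arbitrary \<open>b > a\<close>.\<close>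

lemma (in real_distribution) probability_integral_transform:
  assumes cont: "\<And>x. isCont (cdf M) x"
  shows "distr M borel (cdf M) = density lborel (indicator {0..1})"
proof (rule cdf_unique)
  have meas [measurable]: "cdf M \<in> borel_measurable borel"
    using cont by (intro borel_measurable_continuous_onI continuous_at_imp_continuous_on) auto
  have measM: "cdf M \<in> borel_measurable M" using meas by simp
  show D: "real_distribution (distr M borel (cdf M))" by (rule real_distribution_distr[OF measM])
  show U: "real_distribution (density lborel (indicator {0..1::real}))" by (rule real_distribution_uniform)
  interpret D: real_distribution "distr M borel (cdf M)" by (rule D)
  interpret U: real_distribution "density lborel (indicator {0..1::real})" by (rule U)
  have val: "\<exists>x. cdf M x = a" if "0 < a" "a < 1" for a
  proof -
    have "eventually (\<lambda>x. cdf M x < a) at_bot" "eventually (\<lambda>x. a < cdf M x) at_top"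
      using cdf_lim_at_bot cdf_lim_at_top_prob that by (auto intro: order_tendstoD)
    then obtain x1 x2 where x1: "cdf M x1 < a" and x2: "a < cdf M x2"
      unfolding eventually_at_bot_linorder eventually_at_top_linorder by blast
    have "x1 \<le> x2"
    proof (rule ccontr)
      assume "\<not> x1 \<le> x2"
      then have "cdf M x2 \<le> cdf M x1" by (intro cdf_nondecreasing) simp
      with x1 x2 show False by simp
    qed
    then show ?thesis using IVT[of "cdf M" x1 a x2] cont x1 x2 by auto
  qed
  have low: "a \<le> prob {x. cdf M x \<le> a}" if a: "0 \<le> a" "a < 1" for a
  proof (cases "a = 0")
    case False
    then obtain w where w: "cdf M w = a" using val[of a] a by auto
    have "prob {..w} \<le> prob {x. cdf M x \<le> a}"
      using cdf_nondecreasing w by (intro finite_measure_mono) auto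
    then show ?thesis using w by (simp add: cdf_def)
  qed simp
  have up: "prob {x. cdf M x \<le> a} \<le> a" if a: "0 \<le> a" "a < 1" for a
  proof (rule dense_ge_bounded[OF a(2)])
    fix b assume b: "a < b" "b < 1"
    then obtain w where w: "cdf M w = b" using val[of b] a b by auto
    have "prob {x. cdf M x \<le> a} \<le> prob {..w}"
    proof (rule finite_measure_mono)
      show "{x. cdf M x \<le> a} \<subseteq> {..w}"
      proof
        fix x assume "x \<in> {x. cdf M x \<le> a}"
        then have "cdf M x < cdf M w" using w b by simp
        then show "x \<in> {..w}" using cdf_nondecreasing[of w x] by (cases "w \<le> x") auto
      qed
    qed simp
    then show "prob {x. cdf M x \<le> a} \<le> b" using w by (simp add: cdf_def)
  qed
  have D_eq: "cdf (distr M borel (cdf M)) a = prob {x. cdf M x \<le> a}" for a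
  proof -
    have "cdf (distr M borel (cdf M)) a = measure (distr M borel (cdf M)) {..a}" by (simp only: cdf_def)
    also have "\<dots> = prob (cdf M -` {..a} \<inter> space M)" by (rule measure_distr[OF measM]) simp
    finally show ?thesis by (simp add: vimage_def)
  qed
  show "cdf (distr M borel (cdf M)) = cdf (density lborel (indicator {0..1}))"
  proof
    fix a :: real
    consider "a < 0" | "0 \<le> a" "a < 1" | "1 \<le> a" by linarith
    then show "cdf (distr M borel (cdf M)) a = cdf (density lborel (indicator {0..1})) a"
    proof cases
      case 1
      have "{x. cdf M x \<le> a} = {}" using cdf_nonneg 1 by (auto simp: not_le intro: less_le_trans)
      moreover have "cdf (density lborel (indicator {0..1})) a \<le> cdf (density lborel (indicator {0..1::real})) 0"
        using 1 by (intro U.cdf_nondecreasing) simp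
      moreover have "cdf (density lborel (indicator {0..1::real})) 0 = 0" by (simp add: cdf_def cdf_uniform_01)
      ultimately show ?thesis using U.cdf_nonneg[of a] unfolding D_eq by simp
    next
      case 2
      then show ?thesis using low[OF 2] up[OF 2] unfolding D_eq by (simp add: cdf_def cdf_uniform_01)
    next
      case 3
      have "{x. cdf M x \<le> a} = UNIV" using cdf_bounded_prob 3 by (auto intro: order_trans)
      moreover have "cdf (density lborel (indicator {0..1::real})) 1 \<le> cdf (density lborel (indicator {0..1})) a"
        using 3 by (intro U.cdf_nondecreasing) simp
      moreover have "cdf (density lborel (indicator {0..1::real})) 1 = 1" by (simp add: cdf_def cdf_uniform_01)
      ultimately show ?thesis using U.cdf_bounded_prob[of a] prob_space unfolding D_eq by simp
    qed
  qed
qed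

section \<open>The flat prior under a log-quadratic selection function\<close>

lemma matrix_vector_mult_uminus:
  fixes A :: "real ^ 'n ^ 'm"
  shows "A *v (- x) = - (A *v x)"
  using matrix_vector_mult_diff_distrib[of A 0 x] by simp

context
  fixes \<Sigma> A :: "real ^ 'n ^ 'n" and p :: "real ^ 'n \<Rightarrow> real" and b :: "real ^ 'n" and c :: real
  assumes Sig: "pos_def \<Sigma>" and sel: "selection_function \<Sigma> p"
    and lq: "log_quadratic_selection \<Sigma> p A b c"
begin

text \<open>The precision matrix of the selective distribution.\<close>

definition prec :: "real ^ 'n ^ 'n" where "prec = matrix_inv \<Sigma> - 2 *\<^sub>R A"

lemma prec_pos_def: "pos_def prec"
  using lq by (simp add: log_quadratic_selection_def prec_def)

lemma AE_log_quadratic: "AE y in lborel. p y = exp (y \<bullet> (A *v y) + b \<bullet> y + c)"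
proof -
  have "AE y in lborel. 0 < p y \<and> ln (p y) = y \<bullet> (A *v y) + b \<bullet> y + c"
    using lq by (simp add: log_quadratic_selection_def)
  then show ?thesis by eventually_elim (metis exp_ln)
qed

text \<open>Completing the square gives equality up to a factor that depends on \<open>\<theta>\<close> only, and this factor is one
because both sides integrate to one. The equality holds for all \<open>\<theta>\<close> at the same good \<open>y\<close>, so it also
describes the density as a function of \<open>\<theta>\<close>.\<close>

lemma selective_density_eq_gauss_density:
  assumes y: "p y = exp (y \<bullet> (A *v y) + b \<bullet> y + c)"
  shows "selective_density \<Sigma> p \<theta> y
    = gauss_density (matrix_inv prec *v (matrix_inv \<Sigma> *v \<theta> + b)) (matrix_inv prec) y"
proof -
  define S where "S = matrix_inv prec"
  define Q where "Q = matrix_inv \<Sigma>"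
  define \<mu> where "\<mu> = S *v (Q *v \<theta> + b)"
  have S: "pos_def S" unfolding S_def by (rule pos_def_matrix_inv[OF prec_pos_def])
  have S_inv: "matrix_inv S = prec"
    unfolding S_def by (rule matrix_inv_matrix_inv[OF pos_def_invertible[OF prec_pos_def]])
  have prec_mu: "prec *v \<mu> = Q *v \<theta> + b"
    unfolding \<mu>_def S_def by (rule matrix_inv_cancel[OF pos_def_invertible[OF prec_pos_def]])
  define d where "d = sqrt ((2 * pi) ^ CARD('n) * det S)"
  have d: "0 < d" using pos_def_det_pos[OF S] by (simp add: d_def)
  define \<kappa> where "\<kappa> = sel_norm \<Sigma> p \<theta> * exp (c + (\<mu> \<bullet> (prec *v \<mu>)) / 2) * d"
  have \<kappa>0: "0 < \<kappa>" using sel_norm_pos[OF Sig sel] d by (simp add: \<kappa>_def)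
  have \<kappa>: "selective_density \<Sigma> p \<theta> y = \<kappa> * gauss_density \<mu> S y"
    if y: "p y = exp (y \<bullet> (A *v y) + b \<bullet> y + c)" for y
  proof -
    have pq: "y \<bullet> (prec *v y) = y \<bullet> (Q *v y) - 2 * (y \<bullet> (A *v y))"
      by (simp add: prec_def Q_def matrix_vector_mult_diff_rdistrib inner_diff_right scaleR_matrix_vector_assoc[symmetric])
    have "exp (- (y \<bullet> (Q *v y)) / 2) * exp (y \<bullet> (A *v y) + b \<bullet> y + c) * exp ((Q *v \<theta>) \<bullet> y)
        = exp (c + (\<mu> \<bullet> (prec *v \<mu>)) / 2) * exp (- ((y - \<mu>) \<bullet> (prec *v (y - \<mu>))) / 2)"
      unfolding quadratic_form_diff[OF prec_pos_def] exp_add[symmetric] pq prec_mu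
      by (rule arg_cong[of _ _ exp]) (simp add: inner_add_left field_simps)
    note expo = this
    have "selective_density \<Sigma> p \<theta> y
        = sel_norm \<Sigma> p \<theta> * (exp (- (y \<bullet> (Q *v y)) / 2) * exp (y \<bullet> (A *v y) + b \<bullet> y + c) * exp ((Q *v \<theta>) \<bullet> y))"
      unfolding selective_density_factor[OF Sig] sel_base_def y Q_def by (simp only: mult.assoc)
    also have "\<dots> = \<kappa> * (exp (- ((y - \<mu>) \<bullet> (prec *v (y - \<mu>))) / 2) / d)"
      unfolding expo \<kappa>_def using d by simp
    finally show ?thesis unfolding gauss_density_def S_inv d_def .
  qed
  have "1 = (\<integral>\<^sup>+y. ennreal (selective_density \<Sigma> p \<theta> y) \<partial>lborel)"
    using selective_density_integral(3)[OF Sig sel] by simp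
  also have "\<dots> = (\<integral>\<^sup>+y. ennreal \<kappa> * ennreal (gauss_density \<mu> S y) \<partial>lborel)"
  proof (rule nn_integral_cong_AE)
    show "AE y in lborel. ennreal (selective_density \<Sigma> p \<theta> y) = ennreal \<kappa> * ennreal (gauss_density \<mu> S y)"
      using AE_log_quadratic
    proof eventually_elim
      case (elim y)
      then show ?case
        using \<kappa>[OF elim] \<kappa>0 gauss_density_pos[OF S, of \<mu> y] by (simp add: ennreal_mult)
    qed
  qed
  also have "\<dots> = ennreal \<kappa>"
    by (subst nn_integral_cmult) (simp_all add: nn_integral_gauss_density[OF S])
  finally have "\<kappa> = 1" by simp
  then show ?thesis using \<kappa>[OF y] by (simp add: \<mu>_def S_def Q_def)
qed

lemma selective_measure_eq_gauss_measure:
  "selective_measure \<Sigma> p \<theta>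
    = gauss_measure (matrix_inv prec *v (matrix_inv \<Sigma> *v \<theta> + b)) (matrix_inv prec)"
  unfolding selective_measure_def gauss_measure_def
proof (rule density_cong)
  note [measurable] = selective_density_meas[OF Sig sel]
  show "(\<lambda>y. ennreal (selective_density \<Sigma> p \<theta> y)) \<in> borel_measurable lborel" by measurable
  show "AE y in lborel. ennreal (selective_density \<Sigma> p \<theta> y)
      = ennreal (gauss_density (matrix_inv prec *v (matrix_inv \<Sigma> *v \<theta> + b)) (matrix_inv prec) y)"
    using AE_log_quadratic by eventually_elim (simp add: selective_density_eq_gauss_density)
qed measurable

text \<open>The mean of the posterior under the flat prior.\<close>

definition post_mean :: "real ^ 'n \<Rightarrow> real ^ 'n" where "post_mean y = \<Sigma> *v (prec *v y - b)"

text \<open>The density of a centred Gaussian vector with precision \<open>Q ** matrix_inv prec ** Q\<close>, where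
\<open>Q = matrix_inv \<Sigma>\<close>, normalised as a density of \<open>y\<close> rather than of \<open>\<theta>\<close>.\<close>

definition kern :: "real ^ 'n \<Rightarrow> real" where
  "kern d = exp (- ((matrix_inv \<Sigma> *v d) \<bullet> (matrix_inv prec *v (matrix_inv \<Sigma> *v d))) / 2)
     / sqrt ((2 * pi) ^ CARD('n) * det (matrix_inv prec))"

lemma kern_meas [measurable]: "kern \<in> borel_measurable borel"
  unfolding kern_def[abs_def] by measurable

lemma post_mean_meas [measurable]: "post_mean \<in> borel_measurable borel"
  unfolding post_mean_def[abs_def] by measurable

lemma kern_pos: "0 < kern d"
  using pos_def_det_pos[OF pos_def_matrix_inv[OF prec_pos_def]] by (simp add: kern_def)

text \<open>The likelihood depends on data and parameter only through \<open>\<theta> - post_mean y\<close>: after reparametrisation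
the model is a location family.\<close>

lemma selective_density_eq_kern:
  assumes y: "p y = exp (y \<bullet> (A *v y) + b \<bullet> y + c)"
  shows "selective_density \<Sigma> p \<theta> y = kern (\<theta> - post_mean y)"
proof -
  define S where "S = matrix_inv prec"
  define Q where "Q = matrix_inv \<Sigma>"
  have S_inv: "matrix_inv S = prec"
    unfolding S_def by (rule matrix_inv_matrix_inv[OF pos_def_invertible[OF prec_pos_def]])
  define u where "u = Q *v (\<theta> - post_mean y)"
  have "u = Q *v \<theta> + b - prec *v y"
    by (simp add: u_def Q_def post_mean_def matrix_vector_mult_diff_distrib matrix_inv_cancel[OF pos_def_invertible[OF Sig]])
  then have "S *v u = S *v (Q *v \<theta> + b) - y"
    by (simp add: S_def matrix_vector_mult_diff_distrib matrix_inv_cancel[OF pos_def_invertible[OF prec_pos_def]])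
  then have diff: "y - S *v (Q *v \<theta> + b) = - (S *v u)" by simp
  have "prec *v (S *v u) = u"
    unfolding S_def by (rule matrix_inv_cancel[OF pos_def_invertible[OF prec_pos_def]])
  then have "(y - S *v (Q *v \<theta> + b)) \<bullet> (matrix_inv S *v (y - S *v (Q *v \<theta> + b))) = u \<bullet> (S *v u)"
    unfolding diff S_inv by (simp add: matrix_vector_mult_uminus inner_commute)
  then show ?thesis
    unfolding selective_density_eq_gauss_density[OF y] gauss_density_def kern_def
    by (simp flip: S_def Q_def u_def)
qed

text \<open>Sampling integrals over \<open>y\<close> become integrals over the residual \<open>\<theta> - post_mean y\<close> with a Jacobian that
does not depend on \<open>\<theta>\<close>; the same residual is obtained from \<open>\<theta>\<close> by a translation.\<close>

lemma nn_integral_post_mean: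
  assumes [measurable]: "g \<in> borel_measurable borel"
  shows "ennreal \<bar>det (\<Sigma> ** prec)\<bar> * (\<integral>\<^sup>+y. g (\<theta> - post_mean y) \<partial>lborel) = (\<integral>\<^sup>+x. g x \<partial>lborel)"
proof -
  define a where "a = - (\<theta> + \<Sigma> *v b)"
  have G: "\<theta> - post_mean y = - ((\<Sigma> ** prec) *v y + a)" for y
    by (simp add: a_def post_mean_def matrix_vector_mult_diff_distrib matrix_vector_mul_assoc)
  have "det (\<Sigma> ** prec) \<noteq> 0"
    using pos_def_det_pos[OF Sig] pos_def_det_pos[OF prec_pos_def] by (auto simp: det_mul)
  then have "ennreal \<bar>det (\<Sigma> ** prec)\<bar> * (\<integral>\<^sup>+y. g (- ((\<Sigma> ** prec) *v y + a)) \<partial>lborel) = (\<integral>\<^sup>+x. g (- x) \<partial>lborel)"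
    by (rule nn_integral_matrix_affine[where g = "\<lambda>x. g (- x)"]) measurable
  also have "\<dots> = (\<integral>\<^sup>+x. g x \<partial>lborel)"
    by (rule nn_integral_linear_involution) (auto intro: linear_uminus)
  finally show ?thesis unfolding G .
qed

definition kmass :: real where "kmass = \<bar>det (\<Sigma> ** prec)\<bar>"

lemma kmass_pos: "0 < kmass"
  using pos_def_det_pos[OF Sig] pos_def_det_pos[OF prec_pos_def] by (simp add: kmass_def det_mul)

lemma nn_integral_kern: "(\<integral>\<^sup>+x. ennreal (kern x) \<partial>lborel) = ennreal kmass"
proof -
  have "1 = (\<integral>\<^sup>+y. ennreal (selective_density \<Sigma> p 0 y) \<partial>lborel)"
    using selective_density_integral(3)[OF Sig sel] by simp
  also have "\<dots> = (\<integral>\<^sup>+y. ennreal (kern (0 - post_mean y)) \<partial>lborel)"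
    by (rule nn_integral_cong_AE) (use AE_log_quadratic in \<open>eventually_elim, simp add: selective_density_eq_kern\<close>)
  finally have "ennreal kmass = ennreal kmass * (\<integral>\<^sup>+y. ennreal (kern (0 - post_mean y)) \<partial>lborel)" by simp
  also have "\<dots> = (\<integral>\<^sup>+x. ennreal (kern x) \<partial>lborel)"
    unfolding kmass_def by (rule nn_integral_post_mean[of "\<lambda>x. ennreal (kern x)"]) measurable
  finally show ?thesis by simp
qed

lemma flat_posterior_mass:
  assumes y: "p y = exp (y \<bullet> (A *v y) + b \<bullet> y + c)"
  shows "integrable lborel (\<lambda>\<theta>. 1 * selective_density \<Sigma> p \<theta> y)"
    and "(\<integral>\<theta>. 1 * selective_density \<Sigma> p \<theta> y \<partial>lborel) = kmass"
proof -
  have "(\<integral>\<^sup>+\<theta>. ennreal (kern (\<theta> + - post_mean y)) \<partial>lborel) = ennreal kmass"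
    unfolding nn_integral_kern[symmetric] by (rule nn_integral_lborel_translate) measurable
  then have "has_bochner_integral lborel (\<lambda>\<theta>. kern (\<theta> - post_mean y)) kmass"
    using kmass_pos kern_pos by (intro has_bochner_integral_nn_integral) (auto intro: less_imp_le)
  then show "integrable lborel (\<lambda>\<theta>. 1 * selective_density \<Sigma> p \<theta> y)"
    and "(\<integral>\<theta>. 1 * selective_density \<Sigma> p \<theta> y \<partial>lborel) = kmass"
    by (simp_all add: selective_density_eq_kern[OF y] has_bochner_integral_iff)
qed

definition centred :: "(real ^ 'n) measure" where "centred = density lborel (\<lambda>x. ennreal (kern x / kmass))"

lemma prob_space_centred: "prob_space centred"
proof (rule prob_spaceI)
  have "emeasure centred (space centred) = (\<integral>\<^sup>+x. ennreal (1 / kmass) * ennreal (kern x) \<partial>lborel)"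
    unfolding centred_def using kmass_pos kern_pos
    by (subst emeasure_density) (auto intro!: nn_integral_cong simp: less_imp_le simp flip: ennreal_mult)
  also have "\<dots> = 1"
    using kmass_pos by (subst nn_integral_cmult) (auto simp: nn_integral_kern simp flip: ennreal_mult)
  finally show "emeasure centred (space centred) = 1" .
qed

definition centred_line :: "real ^ 'n \<Rightarrow> real measure" where
  "centred_line v = distr centred borel (\<lambda>x. v \<bullet> x)"

lemma real_distribution_centred_line: "real_distribution (centred_line v)"
proof -
  interpret prob_space centred by (rule prob_space_centred)
  show ?thesis unfolding centred_line_def
    by (rule real_distribution_distr) (simp add: centred_def)
qed

lemma centred_line_cdf_cont:
  assumes "v \<noteq> 0"
  shows "isCont (cdf (centred_line v)) x"
proof -
  interpret real_distribution "centred_line v" by (rule real_distribution_centred_line)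
  have "negligible {z. v \<bullet> z = x}" using assms by (intro negligible_hyperplane) simp
  then have "{z. v \<bullet> z = x} \<in> null_sets lebesgue" by (simp add: negligible_iff_null_sets)
  moreover have cl: "{z. v \<bullet> z = x} \<in> sets borel"
    using closed_hyperplane by (rule borel_closed)
  ultimately have null: "{z. v \<bullet> z = x} \<in> null_sets lborel" by (auto simp: null_sets_def)
  have "AE z in lborel. ennreal (kern z / kmass) * indicator {z. v \<bullet> z = x} z = 0"
    using AE_not_in[OF null] by eventually_elim auto
  then have "emeasure centred {z. v \<bullet> z = x} = 0"
    unfolding centred_def using cl by (subst emeasure_density) (auto simp: nn_integral_0_iff_AE)
  moreover have "emeasure (centred_line v) {x} = emeasure centred {z. v \<bullet> z = x}"
    unfolding centred_line_def by (subst emeasure_distr) (auto simp: centred_def vimage_def)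
  ultimately have "measure (centred_line v) {x} = 0" by (simp add: measure_def)
  then show ?thesis by (simp add: isCont_cdf)
qed

text \<open>Under the flat posterior the residual has law \<open>centred\<close>, by translation invariance in \<open>\<theta>\<close>.\<close>

lemma flat_marginal_posterior_cdf:
  assumes y: "p y = exp (y \<bullet> (A *v y) + b \<bullet> y + c)"
  shows "marginal_posterior_cdf \<Sigma> p (\<lambda>\<theta>. 1) v y (v \<bullet> \<theta>) = cdf (centred_line v) (v \<bullet> (\<theta> - post_mean y))"
proof -
  define t where "t = v \<bullet> (\<theta> - post_mean y)"
  have ind: "indicator {..v \<bullet> \<theta>} (v \<bullet> \<eta>) = (indicator {..t} (v \<bullet> (\<eta> - post_mean y)) :: ennreal)" for \<eta>
    by (auto simp: indicator_def t_def inner_diff_right)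
  have "marginal_posterior_cdf \<Sigma> p (\<lambda>\<theta>. 1) v y (v \<bullet> \<theta>)
      = enn2real (\<integral>\<^sup>+\<eta>. ennreal (kern (\<eta> + - post_mean y) / kmass) * indicator {..t} (v \<bullet> (\<eta> + - post_mean y)) \<partial>lborel)"
    using flat_posterior_mass(2)[OF y]
    by (subst marginal_posterior_cdf_eq[OF Sig sel]) (simp_all add: ind selective_density_eq_kern[OF y])
  also have "(\<integral>\<^sup>+\<eta>. ennreal (kern (\<eta> + - post_mean y) / kmass) * indicator {..t} (v \<bullet> (\<eta> + - post_mean y)) \<partial>lborel)
      = (\<integral>\<^sup>+x. ennreal (kern x / kmass) * indicator {..t} (v \<bullet> x) \<partial>lborel)"
    by (rule nn_integral_lborel_translate[of "\<lambda>x. ennreal (kern x / kmass) * indicator {..t} (v \<bullet> x)"]) measurable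
  also have "\<dots> = emeasure (centred_line v) {..t}"
  proof -
    have m: "(\<lambda>x. v \<bullet> x) -` {..t} \<in> sets borel"
      using measurable_sets[of "\<lambda>x. v \<bullet> x" borel borel "{..t}"] by simp
    have "emeasure (centred_line v) {..t} = emeasure centred ((\<lambda>x. v \<bullet> x) -` {..t})"
      unfolding centred_line_def by (subst emeasure_distr) (auto simp: centred_def)
    also have "\<dots> = (\<integral>\<^sup>+x. ennreal (kern x / kmass) * indicator {..t} (v \<bullet> x) \<partial>lborel)"
      unfolding centred_def using m
      by (subst emeasure_density) (auto intro!: nn_integral_cong simp: indicator_def)
    finally show ?thesis by simp
  qed
  finally show ?thesis by (simp add: cdf_def measure_def t_def)
qed

text \<open>Under sampling the residual has the same law \<open>centred\<close>, by the linear change of variables in \<open>y\<close>.\<close>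

lemma distr_residual: "distr (selective_measure \<Sigma> p \<theta>) borel (\<lambda>y. v \<bullet> (\<theta> - post_mean y)) = centred_line v"
proof (rule measure_eqI)
  note [measurable] = selective_density_meas[OF Sig sel]
  fix X assume "X \<in> sets (distr (selective_measure \<Sigma> p \<theta>) borel (\<lambda>y. v \<bullet> (\<theta> - post_mean y)))"
  then have X [measurable]: "X \<in> sets borel" by simp
  have m1: "(\<lambda>y. v \<bullet> (\<theta> - post_mean y)) -` X \<in> sets borel"
    using measurable_sets[of "\<lambda>y. v \<bullet> (\<theta> - post_mean y)" borel borel X] X by simp
  have m2: "(\<lambda>x. v \<bullet> x) -` X \<in> sets borel"
    using measurable_sets[of "\<lambda>x. v \<bullet> x" borel borel X] X by simp
  have "emeasure (distr (selective_measure \<Sigma> p \<theta>) borel (\<lambda>y. v \<bullet> (\<theta> - post_mean y))) X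
      = emeasure (selective_measure \<Sigma> p \<theta>) ((\<lambda>y. v \<bullet> (\<theta> - post_mean y)) -` X)"
    by (subst emeasure_distr) (auto simp: selective_measure_def)
  also have "\<dots> = (\<integral>\<^sup>+y. ennreal (selective_density \<Sigma> p \<theta> y) * indicator X (v \<bullet> (\<theta> - post_mean y)) \<partial>lborel)"
    unfolding selective_measure_def using m1
    by (subst emeasure_density) (auto intro!: nn_integral_cong simp: indicator_def)
  also have "\<dots> = (\<integral>\<^sup>+y. ennreal (kern (\<theta> - post_mean y)) * indicator X (v \<bullet> (\<theta> - post_mean y)) \<partial>lborel)"
    by (rule nn_integral_cong_AE) (use AE_log_quadratic in \<open>eventually_elim, simp add: selective_density_eq_kern\<close>)
  also have "\<dots> = ennreal (1 / kmass) * (ennreal kmass * \<dots>)"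
    using kmass_pos by (simp add: mult.assoc[symmetric] flip: ennreal_mult)
  also have "ennreal kmass * (\<integral>\<^sup>+y. ennreal (kern (\<theta> - post_mean y)) * indicator X (v \<bullet> (\<theta> - post_mean y)) \<partial>lborel)
      = (\<integral>\<^sup>+x. ennreal (kern x) * indicator X (v \<bullet> x) \<partial>lborel)"
    unfolding kmass_def by (rule nn_integral_post_mean[of "\<lambda>x. ennreal (kern x) * indicator X (v \<bullet> x)"]) measurable
  also have "ennreal (1 / kmass) * \<dots> = (\<integral>\<^sup>+x. ennreal (kern x / kmass) * indicator X (v \<bullet> x) \<partial>lborel)"
    using kmass_pos kern_pos
    by (subst nn_integral_cmult[symmetric])
       (auto intro!: nn_integral_cong simp: less_imp_le mult.assoc[symmetric] simp flip: ennreal_mult)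
  also have "\<dots> = emeasure centred ((\<lambda>x. v \<bullet> x) -` X)"
    unfolding centred_def using m2
    by (subst emeasure_density) (auto intro!: nn_integral_cong simp: indicator_def)
  also have "\<dots> = emeasure (centred_line v) X"
    unfolding centred_line_def by (subst emeasure_distr) (auto simp: centred_def)
  finally show "emeasure (distr (selective_measure \<Sigma> p \<theta>) borel (\<lambda>y. v \<bullet> (\<theta> - post_mean y))) X = emeasure (centred_line v) X" .
qed (simp add: centred_line_def)

text \<open>The residual \<open>\<theta> - post_mean y\<close> is a pivot: its law under the posterior, which gives the distribution
function, and its law under sampling, which gives the argument, coincide.\<close>

lemma flat_prior_matching: "probability_matching \<Sigma> p (\<lambda>\<theta>. 1)"
  unfolding probability_matching_def
proof (intro conjI allI impI)
  show "valid_prior \<Sigma> p (\<lambda>\<theta>. 1)"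
    unfolding valid_prior_def
  proof (intro conjI allI)
    show "AE y in lborel. 0 < p y \<longrightarrow> integrable lborel (\<lambda>\<theta>. 1 * selective_density \<Sigma> p \<theta> y) \<and>
        0 < (\<integral>\<theta>. 1 * selective_density \<Sigma> p \<theta> y \<partial>lborel)"
      using AE_log_quadratic
    proof eventually_elim
      case (elim y)
      show ?case using flat_posterior_mass[OF elim] kmass_pos by presburger
    qed
  qed auto
  fix v \<theta> :: "real ^ 'n" assume v: "v \<noteq> 0"
  interpret L: real_distribution "centred_line v" by (rule real_distribution_centred_line)
  have m [measurable]: "(\<lambda>y. marginal_posterior_cdf \<Sigma> p (\<lambda>\<theta>. 1) v y (v \<bullet> \<theta>)) \<in> borel_measurable borel"
    by (rule marginal_posterior_cdf_meas[OF Sig sel]) simp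
  have c [measurable]: "cdf (centred_line v) \<in> borel_measurable borel"
    using centred_line_cdf_cont[OF v]
    by (intro borel_measurable_continuous_onI continuous_at_imp_continuous_on) auto
  have "distr (selective_measure \<Sigma> p \<theta>) borel (\<lambda>y. marginal_posterior_cdf \<Sigma> p (\<lambda>\<theta>. 1) v y (v \<bullet> \<theta>))
      = distr (selective_measure \<Sigma> p \<theta>) borel (\<lambda>y. cdf (centred_line v) (v \<bullet> (\<theta> - post_mean y)))"
  proof (rule distr_cong_AE)
    note [measurable] = selective_density_meas[OF Sig sel]
    have sm: "(\<lambda>y. ennreal (selective_density \<Sigma> p \<theta> y)) \<in> borel_measurable lborel" by measurable
    show "AE y in selective_measure \<Sigma> p \<theta>. marginal_posterior_cdf \<Sigma> p (\<lambda>\<theta>. 1) v y (v \<bullet> \<theta>) = cdf (centred_line v) (v \<bullet> (\<theta> - post_mean y))"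
      unfolding selective_measure_def AE_density[OF sm]
      using AE_log_quadratic by eventually_elim (simp only: flat_marginal_posterior_cdf, blast)
  qed (auto simp: selective_measure_def)
  also have "\<dots> = distr (distr (selective_measure \<Sigma> p \<theta>) borel (\<lambda>y. v \<bullet> (\<theta> - post_mean y))) borel (cdf (centred_line v))"
    by (subst distr_distr) (auto simp: selective_measure_def comp_def)
  also have "\<dots> = density lborel (indicator {0..1})"
    unfolding distr_residual by (rule L.probability_integral_transform) (rule centred_line_cdf_cont[OF v])
  finally have "distr (selective_measure \<Sigma> p \<theta>) lborel (\<lambda>y. marginal_posterior_cdf \<Sigma> p (\<lambda>\<theta>. 1) v y (v \<bullet> \<theta>)) = density lborel (indicator {0..1})"
    by (subst (asm) distr_cong[of _ _ borel lborel]) auto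
  then show "distributed (selective_measure \<Sigma> p \<theta>) lborel (\<lambda>y. marginal_posterior_cdf \<Sigma> p (\<lambda>\<theta>. 1) v y (v \<bullet> \<theta>)) (indicator {0..1})"
    unfolding distributed_def by (auto simp: selective_measure_def)
qed

end

section \<open>Consequences of matching\<close>

lemma AE_lborel_translate:
  fixes a :: "'a::euclidean_space"
  assumes "AE x in lborel. P x"
  shows "AE x in lborel. P (x + a)"
proof -
  have "AE x in distr lborel borel ((+) a). P x" unfolding lborel_distr_plus by (rule assms)
  then have "AE x in lborel. P (a + x)" by (rule AE_distrD[rotated]) simp
  then show ?thesis by (simp add: add.commute)
qed

lemma AE_lborel_reflect:
  fixes a :: "'a::euclidean_space"
  assumes "AE x in lborel. P x"
  shows "AE x in lborel. P (a - x)"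
proof -
  obtain N where N: "{x. \<not> P x} \<subseteq> N" "emeasure lborel N = 0" "N \<in> sets (borel :: 'a measure)"
    using assms by (auto elim: AE_E)
  have [measurable]: "indicator N \<in> borel_measurable (borel :: 'a measure)"
    using N(3) by simp
  have "(\<integral>\<^sup>+x. indicator N (- x) \<partial>lborel) = (\<integral>\<^sup>+x. indicator N x \<partial>(lborel :: 'a measure))"
    by (rule nn_integral_linear_involution[of uminus "indicator N"]) (auto intro: linear_uminus)
  also have "\<dots> = 0" using N by simp
  finally have "AE x in (lborel :: 'a measure). (indicator N (- x) :: ennreal) = 0"
    by (subst (asm) nn_integral_0_iff_AE) measurable
  then have "AE x in lborel. P (- x)"
    by eventually_elim (use N(1) in \<open>auto simp: indicator_def split: if_splits\<close>)
  from AE_lborel_translate[OF this, of "- a"] show ?thesis by simp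
qed

text \<open>By Fubini there is a single base point \<open>y\<close> such that \<open>f\<close> agrees with \<open>f y\<close> at almost every translate
of \<open>y\<close>.\<close>

lemma AE_translation_invariant_imp_const:
  fixes f :: "'a::euclidean_space \<Rightarrow> real"
  assumes [measurable]: "f \<in> borel_measurable borel"
    and inv: "\<And>w. AE y in lborel. f (y + w) = f y"
  obtains c where "AE y in lborel. f y = c"
proof -
  have "AE w in (lborel :: 'a measure). AE y in lborel. f (y + w) = f y" using inv by simp
  then have "AE y in lborel. AE w in (lborel :: 'a measure). f (y + w) = f y"
    by (subst (asm) lborel_pair.AE_commute) measurable
  then obtain y where "AE w in lborel. f (y + w) = f y"
    using open_AE_imp_ex[of UNIV] by auto
  from AE_lborel_translate[OF this, of "- y"] have "AE x in lborel. f x = f y" by simp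
  then show ?thesis by (rule that)
qed

context
  fixes \<Sigma> :: "real ^ 'n ^ 'n" and p \<pi> :: "real ^ 'n \<Rightarrow> real"
  assumes Sig: "pos_def \<Sigma>" and sel: "selection_function \<Sigma> p"
    and matching: "probability_matching \<Sigma> p \<pi>"
begin

abbreviation (input) Q :: "real ^ 'n ^ 'n" where "Q \<equiv> matrix_inv \<Sigma>"
abbreviation (input) h :: "real ^ 'n \<Rightarrow> real" where "h \<equiv> sel_base \<Sigma> p"

text \<open>\<open>Zc y\<close> is the total mass of the unnormalised posterior at \<open>y\<close>, and \<open>Zct v t y\<close> its mass on the
half-space \<open>v \<bullet> \<theta> \<le> t\<close>.\<close>

definition prior_weight :: "real ^ 'n \<Rightarrow> real" where "prior_weight \<theta> = \<pi> \<theta> * sel_norm \<Sigma> p \<theta>"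
definition Zc :: "real ^ 'n \<Rightarrow> real" where "Zc y = (\<integral>\<theta>. prior_weight \<theta> * exp ((Q *v \<theta>) \<bullet> y) \<partial>lborel)"
definition Zct :: "real ^ 'n \<Rightarrow> real \<Rightarrow> real ^ 'n \<Rightarrow> real" where
  "Zct v t y = (\<integral>\<theta>. prior_weight \<theta> * exp ((Q *v \<theta>) \<bullet> y) * indicator {..t} (v \<bullet> \<theta>) \<partial>lborel)"

lemma prior_meas [measurable]: "\<pi> \<in> borel_measurable borel" and prior_nonneg: "0 \<le> \<pi> \<theta>"
  using matching by (auto simp: probability_matching_def valid_prior_def)

lemma h_meas [measurable]: "h \<in> borel_measurable borel" and h_nonneg: "0 \<le> h y"
  using sel_base_meas[OF Sig sel] sel_base_nonneg[OF Sig sel] by auto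

lemma prior_weight_meas [measurable]: "prior_weight \<in> borel_measurable borel" and prior_weight_nonneg: "0 \<le> prior_weight \<theta>"
  using sel_norm_meas[OF Sig sel] sel_norm_pos[OF Sig sel, of \<theta>] prior_nonneg[of \<theta>]
  by (auto simp: prior_weight_def[abs_def])

lemma Zc_meas [measurable]: "Zc \<in> borel_measurable borel" "Zct v t \<in> borel_measurable borel"
  unfolding Zc_def[abs_def] Zct_def[abs_def] by measurable

lemma prior_times_density: "\<pi> \<theta> * selective_density \<Sigma> p \<theta> y = h y * (prior_weight \<theta> * exp ((Q *v \<theta>) \<bullet> y))"
  by (simp add: selective_density_factor[OF Sig] prior_weight_def)

lemma AE_proper:
  "AE y in lborel. 0 < h y \<longrightarrow> integrable lborel (\<lambda>\<theta>. prior_weight \<theta> * exp ((Q *v \<theta>) \<bullet> y)) \<and> 0 < Zc y"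
proof -
  have "AE y in lborel. 0 < p y \<longrightarrow> integrable lborel (\<lambda>\<theta>. \<pi> \<theta> * selective_density \<Sigma> p \<theta> y) \<and>
        0 < (\<integral>\<theta>. \<pi> \<theta> * selective_density \<Sigma> p \<theta> y \<partial>lborel)"
    using matching by (simp add: probability_matching_def valid_prior_def)
  then show ?thesis
  proof eventually_elim
    case (elim y)
    show ?case
    proof
      assume hy: "0 < h y"
      then have "0 < p y" by (simp add: sel_base_def zero_less_mult_iff)
      then show "integrable lborel (\<lambda>\<theta>. prior_weight \<theta> * exp ((Q *v \<theta>) \<bullet> y)) \<and> 0 < Zc y"
        using elim hy unfolding prior_times_density by (simp add: Zc_def zero_less_mult_iff)
    qed
  qed
qed

lemma posterior_cdf_ratio:
  assumes hy: "0 < h y" and i: "integrable lborel (\<lambda>\<theta>. prior_weight \<theta> * exp ((Q *v \<theta>) \<bullet> y))" and Zp: "0 < Zc y"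
  shows "marginal_posterior_cdf \<Sigma> p \<pi> v y t = Zct v t y / Zc y"
proof -
  have N: "(\<integral>\<theta>. \<pi> \<theta> * selective_density \<Sigma> p \<theta> y \<partial>lborel) = h y * Zc y"
    unfolding prior_times_density Zc_def by simp
  have "(\<integral>\<^sup>+\<theta>. ennreal (\<pi> \<theta> * selective_density \<Sigma> p \<theta> y / (h y * Zc y)) * indicator {..t} (v \<bullet> \<theta>) \<partial>lborel)
      = (\<integral>\<^sup>+\<theta>. ennreal (prior_weight \<theta> * exp ((Q *v \<theta>) \<bullet> y) * indicator {..t} (v \<bullet> \<theta>) / Zc y) \<partial>lborel)"
    using hy by (intro nn_integral_cong) (auto simp: prior_times_density indicator_def)
  also have "\<dots> = ennreal (\<integral>\<theta>. prior_weight \<theta> * exp ((Q *v \<theta>) \<bullet> y) * indicator {..t} (v \<bullet> \<theta>) / Zc y \<partial>lborel)"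
  proof (rule nn_integral_eq_integral)
    have "integrable lborel (\<lambda>\<theta>. prior_weight \<theta> * exp ((Q *v \<theta>) \<bullet> y) * indicator {..t} (v \<bullet> \<theta>))"
      by (rule Bochner_Integration.integrable_bound[OF i]) (auto simp: indicator_def)
    then show "integrable lborel (\<lambda>\<theta>. prior_weight \<theta> * exp ((Q *v \<theta>) \<bullet> y) * indicator {..t} (v \<bullet> \<theta>) / Zc y)" by simp
  qed (use prior_weight_nonneg Zp in auto)
  also have "\<dots> = ennreal (Zct v t y / Zc y)" by (simp add: Zct_def)
  moreover have "0 \<le> Zct v t y / Zc y"
    unfolding Zct_def using prior_weight_nonneg Zp by (intro divide_nonneg_nonneg integral_nonneg_AE AE_I2) auto
  ultimately show ?thesis
    by (simp add: marginal_posterior_cdf_eq[OF Sig sel] N)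
qed

text \<open>Uniformity turned into a linear equation for the tilted function \<open>h\<close>: in this form the parameter
enters through the exponential alone, since the level set depends on \<open>\<theta>\<close> only by way of \<open>t\<close>.\<close>

lemma matching_level_sets:
  assumes v: "v \<noteq> 0" and \<alpha>: "0 \<le> \<alpha>" "\<alpha> \<le> 1" and t: "t = v \<bullet> \<theta>"
  shows "(\<integral>y. (indicator {y. Zct v t y \<le> \<alpha> * Zc y} y - \<alpha>) * h y * exp ((Q *v \<theta>) \<bullet> y) \<partial>lborel) = 0"
proof -
  note [measurable] = selective_density_meas[OF Sig sel]
  define G where "G y = marginal_posterior_cdf \<Sigma> p \<pi> v y t" for y
  have [measurable]: "G \<in> borel_measurable borel"
    unfolding G_def[abs_def] by (rule marginal_posterior_cdf_meas[OF Sig sel]) measurable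
  have "distributed (selective_measure \<Sigma> p \<theta>) lborel G (indicator {0..1})"
    using matching v by (simp add: probability_matching_def G_def[abs_def] t)
  then have "distr (selective_measure \<Sigma> p \<theta>) lborel G = density lborel (indicator {0..1})"
    by (simp add: distributed_def)
  then have "measure (distr (selective_measure \<Sigma> p \<theta>) lborel G) {..\<alpha>} = \<alpha>"
    using \<alpha> by (simp add: cdf_uniform_01)
  then have "measure (selective_measure \<Sigma> p \<theta>) {y. G y \<le> \<alpha>} = \<alpha>"
    by (subst (asm) measure_distr) (auto simp: selective_measure_def vimage_def)
  moreover have "measure (selective_measure \<Sigma> p \<theta>) {y. G y \<le> \<alpha>}
      = (\<integral>y. indicator {y. G y \<le> \<alpha>} y \<partial>selective_measure \<Sigma> p \<theta>)"
    by (simp add: selective_measure_def)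
  moreover have "\<dots> = (\<integral>y. selective_density \<Sigma> p \<theta> y *\<^sub>R indicator {y. G y \<le> \<alpha>} y \<partial>lborel)"
    unfolding selective_measure_def
    by (rule integral_density) (auto intro: selective_density_nonneg[OF Sig sel])
  ultimately have G\<alpha>: "(\<integral>y. selective_density \<Sigma> p \<theta> y * indicator {y. G y \<le> \<alpha>} y \<partial>lborel) = \<alpha>"
    by simp
  have si: "integrable lborel (\<lambda>y. selective_density \<Sigma> p \<theta> y * indicator {y. G y \<le> \<alpha>} y)"
    by (rule Bochner_Integration.integrable_bound[OF selective_density_integral(1)[OF Sig sel, of \<theta>]]) (auto simp: indicator_def)
  have "0 = (\<integral>y. selective_density \<Sigma> p \<theta> y * indicator {y. G y \<le> \<alpha>} y \<partial>lborel) - \<alpha> * (\<integral>y. selective_density \<Sigma> p \<theta> y \<partial>lborel)"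
    using G\<alpha> selective_density_integral(2)[OF Sig sel, of \<theta>] by simp
  also have "\<dots> = (\<integral>y. selective_density \<Sigma> p \<theta> y * indicator {y. G y \<le> \<alpha>} y - \<alpha> * selective_density \<Sigma> p \<theta> y \<partial>lborel)"
    using si selective_density_integral(1)[OF Sig sel, of \<theta>] by simp
  also have "\<dots> = (\<integral>y. sel_norm \<Sigma> p \<theta> * ((indicator {y. Zct v t y \<le> \<alpha> * Zc y} y - \<alpha>) * h y * exp ((Q *v \<theta>) \<bullet> y)) \<partial>lborel)"
  proof (rule integral_cong_AE)
    show "AE y in lborel. selective_density \<Sigma> p \<theta> y * indicator {y. G y \<le> \<alpha>} y - \<alpha> * selective_density \<Sigma> p \<theta> y
        = sel_norm \<Sigma> p \<theta> * ((indicator {y. Zct v t y \<le> \<alpha> * Zc y} y - \<alpha>) * h y * exp ((Q *v \<theta>) \<bullet> y))"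
      using AE_proper
    proof eventually_elim
      case (elim y)
      show ?case
      proof (cases "0 < h y")
        case True
        with elim have Zp: "0 < Zc y" and i: "integrable lborel (\<lambda>\<theta>. prior_weight \<theta> * exp ((Q *v \<theta>) \<bullet> y))" by auto
        have "G y \<le> \<alpha> \<longleftrightarrow> Zct v t y \<le> \<alpha> * Zc y"
          unfolding G_def posterior_cdf_ratio[OF True i Zp] using Zp by (simp add: pos_divide_le_eq)
        then show ?thesis
          by (simp add: selective_density_factor[OF Sig] indicator_def algebra_simps)
      next
        case False
        then have "h y = 0" using h_nonneg[of y] by simp
        then show ?thesis by (simp add: selective_density_factor[OF Sig])
      qed
    qed
  qed measurable
  also have "\<dots> = sel_norm \<Sigma> p \<theta> * (\<integral>y. (indicator {y. Zct v t y \<le> \<alpha> * Zc y} y - \<alpha>) * h y * exp ((Q *v \<theta>) \<bullet> y) \<partial>lborel)"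
    by (rule integral_mult_right_zero)
  finally show ?thesis using sel_norm_pos[OF Sig sel, of \<theta>] by simp
qed

text \<open>The tilts \<open>Q *v \<theta>\<close> of the parameters with \<open>v \<bullet> \<theta> = t\<close> fill the hyperplane orthogonal to \<open>\<Sigma> *v v\<close> at
level \<open>t\<close>, which is what the completeness lemma asks for.\<close>

lemma AE_line_matching:
  assumes v: "v \<noteq> 0"
  shows "AE y in lborel. \<forall>t\<in>\<rat>. \<forall>\<alpha>\<in>\<rat> \<inter> {0..1}.
    (\<integral>s. (indicator {y. Zct v t y \<le> \<alpha> * Zc y} (y + s *\<^sub>R (\<Sigma> *v v)) - \<alpha>) * h (y + s *\<^sub>R (\<Sigma> *v v)) * exp (t * s) \<partial>lborel) = 0"
proof (intro AE_ball_countable'[OF _ countable_rat] AE_ball_countable'[OF _ countable_Int1[OF countable_rat]])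
  fix t \<alpha> :: real assume \<alpha>: "\<alpha> \<in> \<rat> \<inter> {0..1}"
  define u where "u y = (indicator {y. Zct v t y \<le> \<alpha> * Zc y} y - \<alpha>) * h y" for y
  have [measurable]: "u \<in> borel_measurable borel" unfolding u_def[abs_def] by measurable
  have "AE y in lborel. (\<integral>s. u (y + s *\<^sub>R (\<Sigma> *v v)) * exp (t * s) \<partial>lborel) = 0"
  proof (rule laplace_zero_on_hyperplane_imp_AE_lines)
    show "\<Sigma> *v v \<noteq> 0" using v matrix_inv_cancel(2)[OF pos_def_invertible[OF Sig], of v] by (metis matrix_vector_mult_0_right)
    fix z :: "real ^ 'n"
    show "integrable lborel (\<lambda>y. u y * exp (z \<bullet> y))"
    proof (rule Bochner_Integration.integrable_bound[OF sel_base_laplace(1)[OF Sig sel, of z]])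
      have "\<bar>indicator X y - \<alpha>\<bar> \<le> 1" for X and y :: "real ^ 'n" using \<alpha> by (auto simp: indicator_def)
      then have "\<bar>u y\<bar> \<le> h y" for y
        unfolding u_def using h_nonneg[of y] by (simp add: abs_mult mult_left_le_one_le)
      then show "AE y in lborel. norm (u y * exp (z \<bullet> y)) \<le> norm (h y * exp (z \<bullet> y))"
        using h_nonneg by (intro AE_I2) (simp add: abs_mult mult_right_mono)
    qed measurable
    assume z: "z \<bullet> (\<Sigma> *v v) = t"
    have Qz: "Q *v (\<Sigma> *v z) = z" by (rule matrix_inv_cancel[OF pos_def_invertible[OF Sig]])
    have "t = v \<bullet> (\<Sigma> *v z)" using z pos_def_sym[OF Sig, of z v] by (simp add: inner_commute)
    from matching_level_sets[OF v _ _ this, of \<alpha>] \<alpha>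
    show "(\<integral>y. u y * exp (z \<bullet> y) \<partial>lborel) = 0" by (simp add: u_def Qz)
  qed measurable
  then show "AE y in lborel. (\<integral>s. (indicator {y. Zct v t y \<le> \<alpha> * Zc y} (y + s *\<^sub>R (\<Sigma> *v v)) - \<alpha>) * h (y + s *\<^sub>R (\<Sigma> *v v)) * exp (t * s) \<partial>lborel) = 0"
    by (simp add: u_def)
qed

text \<open>Where the line carries data at all, the restriction to the line is an instance of \<open>matched_line\<close>:
moving \<open>y\<close> by \<open>s *\<^sub>R (\<Sigma> *v v)\<close> multiplies the posterior weight at \<open>\<theta>\<close> by \<open>exp (s * (v \<bullet> \<theta>))\<close>.\<close>

lemma AE_gaussian_lines:
  assumes v: "v \<noteq> 0"
  defines "w \<equiv> \<Sigma> *v v"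
  shows "AE y in lborel. (AE s in lborel. h (y + s *\<^sub>R w) = 0) \<or>
    (\<exists>c \<kappa> b d. 0 < \<kappa> \<and> (AE s in lborel. h (y + s *\<^sub>R w) * Zc (y + s *\<^sub>R w) = c) \<and>
       (\<forall>s. Zc (y + s *\<^sub>R w) = exp (\<kappa> / 2 * s\<^sup>2 + b * s + d)))"
proof -
  have w0: "w \<noteq> 0" using v matrix_inv_cancel(2)[OF pos_def_invertible[OF Sig], of v] unfolding w_def by (metis matrix_vector_mult_0_right)
  have Qw: "(Q *v \<theta>) \<bullet> (y + s *\<^sub>R w) = (Q *v \<theta>) \<bullet> y + s * (v \<bullet> \<theta>)" for \<theta> y s
    using pos_def_sym[OF Sig, of "Q *v \<theta>" v]
    by (simp add: w_def inner_add_right matrix_inv_cancel[OF pos_def_invertible[OF Sig]] inner_commute)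
  have e: "prior_weight \<theta> * exp ((Q *v \<theta>) \<bullet> (y + s *\<^sub>R w)) = prior_weight \<theta> * exp ((Q *v \<theta>) \<bullet> y) * exp (s * (v \<bullet> \<theta>))" for \<theta> y s
    unfolding Qw by (simp add: exp_add)
  show ?thesis
    using AE_line_matching[OF v] AE_lborel_imp_AE_lines[OF AE_proper, of w]
      laplace_integrable_imp_AE_lines_integrable[OF h_meas w0 sel_base_laplace(1)[OF Sig sel]]
  proof eventually_elim
    case (elim y)
    show ?case
    proof (cases "AE s in lborel. h (y + s *\<^sub>R w) = 0")
      case False
      define f where "f \<theta> = prior_weight \<theta> * exp ((Q *v \<theta>) \<bullet> y)" for \<theta>
      have [measurable]: "f \<in> borel_measurable borel" unfolding f_def[abs_def] by measurable
      have Zf: "Zc (y + s *\<^sub>R w) = (\<integral>\<theta>. f \<theta> * exp (s * (v \<bullet> \<theta>)) \<partial>lborel)" for s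
        unfolding Zc_def e f_def ..
      have Ztf: "Zct v t (y + s *\<^sub>R w) = (\<integral>\<theta>. f \<theta> * exp (s * (v \<bullet> \<theta>)) * indicator {..t} (v \<bullet> \<theta>) \<partial>lborel)" for s t
        unfolding Zct_def e f_def ..
      interpret L: matched_line lborel "\<lambda>s. h (y + s *\<^sub>R w)" f "\<lambda>\<theta>. v \<bullet> \<theta>"
      proof
        show "(\<integral>s. (indicator {s. (\<integral>x. f x * exp (s * (v \<bullet> x)) * indicator {..t} (v \<bullet> x) \<partial>lborel)
                \<le> \<alpha> * (\<integral>x. f x * exp (s * (v \<bullet> x)) \<partial>lborel)} s - \<alpha>) * h (y + s *\<^sub>R w) * exp (t * s) \<partial>lborel) = 0"
          if "t \<in> \<rat>" "\<alpha> \<in> \<rat>" "0 \<le> \<alpha>" "\<alpha> \<le> 1" for t \<alpha>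
        proof -
          have "(\<integral>s. (indicator {y. Zct v t y \<le> \<alpha> * Zc y} (y + s *\<^sub>R w) - \<alpha>) * h (y + s *\<^sub>R w) * exp (t * s) \<partial>lborel) = 0"
            using elim(1) that unfolding w_def by auto
          moreover have "indicator {y. Zct v t y \<le> \<alpha> * Zc y} (y + s *\<^sub>R w)
              = (indicator {s. Zct v t (y + s *\<^sub>R w) \<le> \<alpha> * Zc (y + s *\<^sub>R w)} s :: real)" for s
            by (simp add: indicator_def)
          ultimately show ?thesis unfolding Zf Ztf by simp
        qed
        show "AE s in lborel. 0 < h (y + s *\<^sub>R w) \<longrightarrow> integrable lborel (\<lambda>x. f x * exp (s * (v \<bullet> x))) \<and> 0 < (\<integral>x. f x * exp (s * (v \<bullet> x)) \<partial>lborel)"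
          using elim(2) unfolding Zf e f_def[symmetric] .
        show "\<not> (AE s in lborel. h (y + s *\<^sub>R w) = 0)" by (rule False)
        show "integrable lborel (\<lambda>s. h (y + s *\<^sub>R w) * exp (t * s))" for t using elim(3) by blast
        show "0 \<le> f x" for x unfolding f_def using prior_weight_nonneg by simp
      qed (use h_nonneg in auto)
      have LZ: "L.Z s = Zc (y + s *\<^sub>R w)" for s unfolding Zf L.Z_def ..
      obtain c \<kappa> b d where "0 < \<kappa>" "AE s in lborel. h (y + s *\<^sub>R w) * L.Z s = c" "\<And>s. L.Z s = exp (\<kappa> / 2 * s\<^sup>2 + b * s + d)"
        by (rule L.gaussian_line) blast
      then show ?thesis
        unfolding LZ
        by (intro disjI2 exI[of _ c] exI[of _ \<kappa>] exI[of _ b] exI[of _ d] conjI allI)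
    qed simp
  qed
qed

text \<open>Lines without data are harmless here: on them the product is zero and hence constant as well. A
positive value somewhere therefore excludes such lines up to null sets.\<close>

lemma h_Zc_const:
  obtains C where "0 < C" "AE y in lborel. h y * Zc y = C"
proof -
  have "AE y in lborel. h (y + w) * Zc (y + w) = h y * Zc y" for w
  proof (cases "w = 0")
    case False
    define v where "v = Q *v w"
    have w: "w = \<Sigma> *v v" by (simp add: v_def matrix_inv_cancel[OF pos_def_invertible[OF Sig]])
    have v: "v \<noteq> 0" using False w by auto
    show ?thesis
    proof (rule AE_lines_imp_AE_lborel)
      show "AE y in lborel. AE s in (lborel :: real measure). h (y + s *\<^sub>R w + w) * Zc (y + s *\<^sub>R w + w) = h (y + s *\<^sub>R w) * Zc (y + s *\<^sub>R w)"
        using AE_gaussian_lines[OF v]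
      proof eventually_elim
        case (elim y)
        have "\<exists>c. AE s in lborel. h (y + s *\<^sub>R w) * Zc (y + s *\<^sub>R w) = c"
          using elim unfolding w[symmetric]
        proof
          assume "AE s in lborel. h (y + s *\<^sub>R w) = 0"
          then have "AE s in lborel. h (y + s *\<^sub>R w) * Zc (y + s *\<^sub>R w) = 0" by eventually_elim simp
          then show ?thesis by blast
        qed blast
        then obtain c where c: "AE s in lborel. h (y + s *\<^sub>R w) * Zc (y + s *\<^sub>R w) = c" by blast
        have "AE s in lborel. h (y + (s + 1) *\<^sub>R w) * Zc (y + (s + 1) *\<^sub>R w) = c"
          using AE_lborel_translate[OF c, of 1] by simp
        with c show ?case by eventually_elim (simp add: scaleR_add_left add.assoc)
      qed
    qed measurable
  qed simp
  then obtain C where C: "AE y in lborel. h y * Zc y = C"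
    by (rule AE_translation_invariant_imp_const[rotated]) auto
  have "0 < C"
  proof (rule ccontr)
    assume "\<not> 0 < C"
    have "AE y in lborel. h y = 0"
      using C AE_proper
    proof eventually_elim
      case (elim y)
      then show ?case using h_nonneg[of y] \<open>\<not> 0 < C\<close> by (cases "0 < h y") auto
    qed
    then have "(\<integral>y. h y * exp ((Q *v 0) \<bullet> y) \<partial>lborel) = 0"
      by (intro integral_eq_zero_AE) (auto elim: eventually_mono)
    then show False using sel_base_laplace(2)[OF Sig sel, of 0] by simp
  qed
  then show ?thesis using C that by blast
qed

lemma AE_h_pos: "AE y in lborel. 0 < h y"
proof -
  obtain C where "0 < C" "AE y in lborel. h y * Zc y = C" by (rule h_Zc_const)
  from this(2) show ?thesis
    by eventually_elim (use \<open>0 < C\<close> h_nonneg in \<open>auto simp: less_le\<close>)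
qed

text \<open>Every point is the midpoint of two points at which the posterior mass is finite.\<close>

lemma prior_weight_laplace_int: "integrable lborel (\<lambda>\<theta>. prior_weight \<theta> * exp ((Q *v \<theta>) \<bullet> y))"
proof -
  have i: "AE x in lborel. integrable lborel (\<lambda>\<theta>. prior_weight \<theta> * exp ((Q *v \<theta>) \<bullet> x))"
    using AE_proper AE_h_pos by eventually_elim blast
  \<comment> \<open>The points \<open>x\<close> and \<open>2 *\<^sub>R y - x\<close> have midpoint \<open>y\<close>.\<close>
  have "AE x in lborel. integrable lborel (\<lambda>\<theta>. prior_weight \<theta> * exp ((Q *v \<theta>) \<bullet> x)) \<and>
      integrable lborel (\<lambda>\<theta>. prior_weight \<theta> * exp ((Q *v \<theta>) \<bullet> (2 *\<^sub>R y - x)))"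
    using i AE_lborel_reflect[OF i, of "2 *\<^sub>R y"] by eventually_elim blast
  from open_AE_imp_ex[OF open_UNIV UNIV_not_empty this]
  obtain x where x: "integrable lborel (\<lambda>\<theta>. prior_weight \<theta> * exp ((Q *v \<theta>) \<bullet> x))"
      "integrable lborel (\<lambda>\<theta>. prior_weight \<theta> * exp ((Q *v \<theta>) \<bullet> (2 *\<^sub>R y - x)))"
    by blast
  have bound: "exp a \<le> exp b + exp (2 * a - b)" for a b :: real
  proof (cases "a \<le> b")
    case True
    then have "exp a \<le> exp b" by simp
    then show ?thesis using exp_ge_zero[of "2 * a - b"] by linarith
  next
    case False
    then have "exp a \<le> exp (2 * a - b)" by simp
    then show ?thesis using exp_ge_zero[of b] by linarith
  qed
  show ?thesis
  proof (rule Bochner_Integration.integrable_bound[OF Bochner_Integration.integrable_add[OF x]])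
    show "AE \<theta> in lborel. norm (prior_weight \<theta> * exp ((Q *v \<theta>) \<bullet> y)) \<le> norm (prior_weight \<theta> * exp ((Q *v \<theta>) \<bullet> x) + prior_weight \<theta> * exp ((Q *v \<theta>) \<bullet> (2 *\<^sub>R y - x)))"
    proof (intro AE_I2)
      fix \<theta>
      have "prior_weight \<theta> * exp ((Q *v \<theta>) \<bullet> y) \<le> prior_weight \<theta> * (exp ((Q *v \<theta>) \<bullet> x) + exp (2 * ((Q *v \<theta>) \<bullet> y) - (Q *v \<theta>) \<bullet> x))"
        by (intro mult_left_mono bound prior_weight_nonneg)
      then show "norm (prior_weight \<theta> * exp ((Q *v \<theta>) \<bullet> y)) \<le> norm (prior_weight \<theta> * exp ((Q *v \<theta>) \<bullet> x) + prior_weight \<theta> * exp ((Q *v \<theta>) \<bullet> (2 *\<^sub>R y - x)))"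
        using prior_weight_nonneg[of \<theta>] by (simp add: inner_diff_right distrib_left)
    qed
  qed measurable
qed

lemma Zc_pos: "0 < Zc y"
proof -
  have "0 \<le> Zc y" unfolding Zc_def using prior_weight_nonneg by simp
  moreover have "Zc y \<noteq> 0"
  proof
    assume "Zc y = 0"
    then have "AE \<theta> in lborel. prior_weight \<theta> * exp ((Q *v \<theta>) \<bullet> y) = 0"
      using prior_weight_laplace_int[of y] prior_weight_nonneg unfolding Zc_def by (subst (asm) integral_nonneg_eq_0_iff_AE) auto
    then have "AE \<theta> in lborel. prior_weight \<theta> = 0" by eventually_elim simp
    then have Z0: "Zc x = 0" for x unfolding Zc_def by (intro integral_eq_zero_AE) (auto elim: eventually_mono)
    have "AE x in lborel. 0 < Zc x" using AE_proper AE_h_pos by eventually_elim blast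
    from open_AE_imp_ex[OF open_UNIV UNIV_not_empty this] show False by (simp add: Z0)
  qed
  ultimately show ?thesis by simp
qed

text \<open>A finite convex function on the whole space is continuous.\<close>

lemma Zc_cont: "continuous_on UNIV Zc"
proof (rule convex_on_continuous)
  show "convex_on UNIV Zc"
  proof (rule convex_onI)
    fix t :: real and x y :: "real ^ 'n" assume t: "0 < t" "t < 1"
    have "Zc ((1 - t) *\<^sub>R x + t *\<^sub>R y) \<le> (\<integral>\<theta>. (1 - t) * (prior_weight \<theta> * exp ((Q *v \<theta>) \<bullet> x)) + t * (prior_weight \<theta> * exp ((Q *v \<theta>) \<bullet> y)) \<partial>lborel)"
      unfolding Zc_def
    proof (rule integral_mono)
      fix \<theta>
      have "exp ((1 - t) *\<^sub>R ((Q *v \<theta>) \<bullet> x) + t *\<^sub>R ((Q *v \<theta>) \<bullet> y)) \<le> (1 - t) * exp ((Q *v \<theta>) \<bullet> x) + t * exp ((Q *v \<theta>) \<bullet> y)"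
        by (rule convex_onD[OF exp_convex]) (use t in auto)
      then have "prior_weight \<theta> * exp ((Q *v \<theta>) \<bullet> ((1 - t) *\<^sub>R x + t *\<^sub>R y)) \<le> prior_weight \<theta> * ((1 - t) * exp ((Q *v \<theta>) \<bullet> x) + t * exp ((Q *v \<theta>) \<bullet> y))"
        using prior_weight_nonneg by (intro mult_left_mono) (simp_all add: inner_add_right)
      then show "prior_weight \<theta> * exp ((Q *v \<theta>) \<bullet> ((1 - t) *\<^sub>R x + t *\<^sub>R y)) \<le> (1 - t) * (prior_weight \<theta> * exp ((Q *v \<theta>) \<bullet> x)) + t * (prior_weight \<theta> * exp ((Q *v \<theta>) \<bullet> y))"
        by (simp add: distrib_left mult_ac)
    qed (intro prior_weight_laplace_int Bochner_Integration.integrable_add Bochner_Integration.integrable_mult_right)+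
    also have "\<dots> = (1 - t) * Zc x + t * Zc y"
      unfolding Zc_def by (simp add: prior_weight_laplace_int)
    finally show "Zc ((1 - t) *\<^sub>R x + t *\<^sub>R y) \<le> (1 - t) * Zc x + t * Zc y" .
  qed simp
qed simp

lemma AE_quadratic_lines:
  assumes w: "w \<noteq> 0"
  shows "AE y in lborel. \<exists>\<kappa> b d. 0 < \<kappa> \<and> (\<forall>s. ln (Zc (y + s *\<^sub>R w)) = \<kappa> / 2 * s\<^sup>2 + b * s + d)"
proof -
  define v where "v = Q *v w"
  have w': "w = \<Sigma> *v v" by (simp add: v_def matrix_inv_cancel[OF pos_def_invertible[OF Sig]])
  have v: "v \<noteq> 0" using w w' by auto
  show ?thesis
    using AE_gaussian_lines[OF v] AE_lborel_imp_AE_lines[OF AE_h_pos, of w]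
  proof eventually_elim
    case (elim y)
    have "\<not> (AE s in lborel. h (y + s *\<^sub>R w) = 0)"
    proof
      assume "AE s in lborel. h (y + s *\<^sub>R w) = 0"
      then have "AE s in (lborel :: real measure). False" using elim(2) by eventually_elim simp
      from open_AE_imp_ex[OF open_UNIV UNIV_not_empty this] show False by blast
    qed
    then obtain \<kappa> b d where "0 < \<kappa>" "\<forall>s. Zc (y + s *\<^sub>R w) = exp (\<kappa> / 2 * s\<^sup>2 + b * s + d)"
      using elim(1) unfolding w'[symmetric] by blast
    then show ?case by (intro exI[of _ \<kappa>] exI[of _ b] exI[of _ d]) simp
  qed
qed

text \<open>The interpolation formula for \<open>ln Zc\<close> holds at almost every base point and hence, by continuity, at
all of them. The leading coefficients on the lines give positive definiteness.\<close>

lemma matching_imp_log_quadratic: "\<exists>A b c. log_quadratic_selection \<Sigma> p A b c"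
proof -
  define L where "L y = ln (Zc y)" for y
  have L_cont: "continuous_on UNIV L"
    unfolding L_def[abs_def] using Zc_pos by (intro continuous_on_ln Zc_cont) (auto simp: less_imp_neq[symmetric])
  have L_comp: "continuous_on UNIV (\<lambda>y. L (g y))" if "continuous_on UNIV g" for g :: "real ^ 'n \<Rightarrow> real ^ 'n"
    by (rule continuous_on_compose2[OF L_cont that]) simp
  have lines: "L (y + s *\<^sub>R w) = L y + s * (L (y + w) - L (y - w)) / 2 + s\<^sup>2 * (L (y + w) + L (y - w) - 2 * L y) / 2" for y w s
  proof (cases "w = 0")
    case False
    define g where "g y = L (y + s *\<^sub>R w) - (L y + s * (L (y + w) - L (y - w)) / 2 + s\<^sup>2 * (L (y + w) + L (y - w) - 2 * L y) / 2)" for y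
    have "g y = 0"
    proof (rule continuous_AE_zero_imp_zero[of g])
      show "continuous_on UNIV g"
        unfolding g_def[abs_def] by (intro continuous_intros L_comp) auto
      show "AE y in lborel. g y = 0"
        using AE_quadratic_lines[OF False]
      proof eventually_elim
        case (elim y)
        then obtain \<kappa> b d where q: "\<And>s. L (y + s *\<^sub>R w) = \<kappa> / 2 * s\<^sup>2 + b * s + d" unfolding L_def by blast
        have vals: "L y = d" "L (y + w) = \<kappa> / 2 + b + d" "L (y - w) = \<kappa> / 2 - b + d"
          using q[of 0] q[of 1] q[of "- 1"] by simp_all
        show ?case unfolding g_def q[of s] vals by (simp add: field_simps)
      qed
    qed
    then show ?thesis by (simp add: g_def)
  qed simp
  obtain A' b' where A': "transpose A' = A'" "\<And>y. L y = y \<bullet> (A' *v y) + b' \<bullet> y + L 0"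
    "\<And>y w. L (y + w) + L (y - w) - 2 * L y = 2 * (w \<bullet> (A' *v w))"
    using quadratic_on_lines_imp_quadratic[OF lines] by metis
  have A'_pos: "0 < w \<bullet> (A' *v w)" if w: "w \<noteq> 0" for w
  proof -
    obtain y \<kappa> b d where k: "0 < \<kappa>" and q: "\<And>s. L (y + s *\<^sub>R w) = \<kappa> / 2 * s\<^sup>2 + b * s + d"
      using open_AE_imp_ex[OF open_UNIV _ AE_quadratic_lines[OF w]] unfolding L_def by auto
    have "L (y + w) + L (y - w) - 2 * L y = \<kappa>"
      using q[of 0] q[of 1] q[of "- 1"] by simp
    then show ?thesis using A'(3)[of y w] k by simp
  qed
  obtain C where C: "0 < C" "AE y in lborel. h y * Zc y = C" by (rule h_Zc_const)
  define A where "A = (1/2) *\<^sub>R Q - A'"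
  have QA: "Q - 2 *\<^sub>R A = 2 *\<^sub>R A'" by (simp add: A_def scaleR_diff_right)
  have Q_sym: "transpose Q = Q" using pos_def_matrix_inv[OF Sig] by (simp add: pos_def_def)
  have "log_quadratic_selection \<Sigma> p A (- b') (ln C - L 0)"
    unfolding log_quadratic_selection_def
  proof (intro conjI)
    show "transpose A = A"
      using Q_sym A'(1) by (simp add: A_def transpose_def vec_eq_iff)
    show "pos_def (Q - 2 *\<^sub>R A)"
      unfolding QA pos_def_def
      using A'(1) A'_pos by (auto simp: transpose_def vec_eq_iff scaleR_matrix_vector_assoc[symmetric])
    show "AE y in lborel. 0 < p y \<and> ln (p y) = y \<bullet> (A *v y) + (- b') \<bullet> y + (ln C - L 0)"
      using C(2) AE_h_pos
    proof eventually_elim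
      case (elim y)
      have p: "0 < p y" using elim(2) by (simp add: sel_base_def zero_less_mult_iff)
      have "ln C = ln (h y * Zc y)" using elim by simp
      also have "\<dots> = ln (h y) + L y" unfolding L_def by (rule ln_mult_pos[OF elim(2) Zc_pos])
      also have "ln (h y) = - (y \<bullet> (Q *v y)) / 2 + ln (p y)" using p by (simp add: sel_base_def ln_mult_pos)
      finally have "ln (p y) = ln C - L y + (y \<bullet> (Q *v y)) / 2" by simp
      then show ?case using p A'(2)[of y]
        by (simp add: A_def matrix_vector_mult_diff_rdistrib inner_diff_right scaleR_matrix_vector_assoc[symmetric])
    qed
  qed
  then show ?thesis by blast
qed

end

text \<open>\<open>C2 * Z1 = C1 * Z2\<close> holds wherever both products with \<open>sel_base\<close> take their constant values, and by
continuity everywhere; Laplace uniqueness then applies to \<open>C2 * R1 - C1 * R2\<close>.\<close>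

lemma matching_prior_unique:
  assumes Sig: "pos_def \<Sigma>" and sel: "selection_function \<Sigma> p"
    and m1: "probability_matching \<Sigma> p \<pi>" and m2: "probability_matching \<Sigma> p (\<lambda>\<theta>. 1)"
  shows "\<exists>k>0. AE \<theta> in lborel. \<pi> \<theta> = k"
proof -
  define Z1 Z2 where "Z1 = Zc \<Sigma> p \<pi>" and "Z2 = Zc \<Sigma> p (\<lambda>\<theta>. 1)"
  define R1 R2 where "R1 = prior_weight \<Sigma> p \<pi>" and "R2 = prior_weight \<Sigma> p (\<lambda>\<theta>. 1)"
  obtain C1 where C1: "0 < C1" "AE y in lborel. sel_base \<Sigma> p y * Z1 y = C1"
    unfolding Z1_def by (rule h_Zc_const[OF Sig sel m1])
  obtain C2 where C2: "0 < C2" "AE y in lborel. sel_base \<Sigma> p y * Z2 y = C2"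
    unfolding Z2_def by (rule h_Zc_const[OF Sig sel m2])
  have [measurable]: "R1 \<in> borel_measurable borel" "R2 \<in> borel_measurable borel"
    unfolding R1_def R2_def by (rule prior_weight_meas[OF Sig sel m1], rule prior_weight_meas[OF Sig sel m2])
  note i1 = prior_weight_laplace_int[OF Sig sel m1, folded R1_def] and i2 = prior_weight_laplace_int[OF Sig sel m2, folded R2_def]
  have Z_eq: "C2 * Z1 y - C1 * Z2 y = 0" for y
  proof (rule continuous_AE_zero_imp_zero[of "\<lambda>y. C2 * Z1 y - C1 * Z2 y"])
    show "continuous_on UNIV (\<lambda>y. C2 * Z1 y - C1 * Z2 y)"
      unfolding Z1_def Z2_def by (intro continuous_intros Zc_cont[OF Sig sel] m1 m2)
    show "AE y in lborel. C2 * Z1 y - C1 * Z2 y = 0"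
      using C1(2) C2(2)
    proof eventually_elim
      case (elim y)
      have "C2 * Z1 y - C1 * Z2 y = (sel_base \<Sigma> p y * Z2 y) * Z1 y - (sel_base \<Sigma> p y * Z1 y) * Z2 y"
        using elim by simp
      then show ?case by simp
    qed
  qed
  define g where "g \<theta> = C2 * R1 \<theta> - C1 * R2 \<theta>" for \<theta>
  have exch: "z \<bullet> \<theta> = (matrix_inv \<Sigma> *v \<theta>) \<bullet> (\<Sigma> *v z)" for z \<theta>
    using pos_def_sym[OF Sig, of "matrix_inv \<Sigma> *v \<theta>" z]
    by (simp add: matrix_inv_cancel[OF pos_def_invertible[OF Sig]] inner_commute)
  have "AE \<theta> in lborel. g \<theta> = 0"
  proof (rule laplace_zero_imp_AE_zero)
    have g_eq: "g \<theta> * exp (z \<bullet> \<theta>) = C2 * (R1 \<theta> * exp ((matrix_inv \<Sigma> *v \<theta>) \<bullet> (\<Sigma> *v z))) - C1 * (R2 \<theta> * exp ((matrix_inv \<Sigma> *v \<theta>) \<bullet> (\<Sigma> *v z)))" for \<theta> z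
      unfolding exch[of z] by (simp add: g_def left_diff_distrib)
    show "integrable lborel (\<lambda>\<theta>. g \<theta> * exp (z \<bullet> \<theta>))" for z
      unfolding g_eq by (intro Bochner_Integration.integrable_diff Bochner_Integration.integrable_mult_right i1 i2)
    show "(\<integral>\<theta>. g \<theta> * exp (z \<bullet> \<theta>) \<partial>lborel) = 0" for z
    proof -
      have "(\<integral>\<theta>. g \<theta> * exp (z \<bullet> \<theta>) \<partial>lborel) = C2 * Z1 (\<Sigma> *v z) - C1 * Z2 (\<Sigma> *v z)"
        unfolding g_eq Z1_def Z2_def Zc_def[OF Sig sel m1] Zc_def[OF Sig sel m2] R1_def[symmetric] R2_def[symmetric]
        by (subst Bochner_Integration.integral_diff) (auto intro!: i1 i2 Bochner_Integration.integrable_mult_right)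
      then show ?thesis using Z_eq by simp
    qed
    show "g \<in> borel_measurable borel" unfolding g_def[abs_def] by measurable
  qed
  then have "AE \<theta> in lborel. \<pi> \<theta> = C1 / C2"
  proof eventually_elim
    case (elim \<theta>)
    have "sel_norm \<Sigma> p \<theta> * (C2 * \<pi> \<theta> - C1) = 0"
      using elim unfolding g_def R1_def R2_def prior_weight_def[OF Sig sel m1] prior_weight_def[OF Sig sel m2] by (simp add: algebra_simps)
    then show ?case using sel_norm_pos[OF Sig sel, of \<theta>] C2(1) by (simp add: field_simps)
  qed
  then show ?thesis using C1(1) C2(1) by (intro exI[of _ "C1 / C2"]) simp
qed

theorem proposition2:
  fixes \<Sigma> :: "real ^ 'n ^ 'n" and p :: "real ^ 'n \<Rightarrow> real"
  assumes "pos_def \<Sigma>"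
    and "selection_function \<Sigma> p"
  shows "((\<exists>\<pi>. probability_matching \<Sigma> p \<pi>) \<longleftrightarrow> (\<exists>A b c. log_quadratic_selection \<Sigma> p A b c)) \<and>
    (\<forall>A b c. log_quadratic_selection \<Sigma> p A b c \<longrightarrow>
      (\<forall>\<theta>. selective_measure \<Sigma> p \<theta> =
         gauss_measure (matrix_inv (matrix_inv \<Sigma> - 2 *\<^sub>R A) *v (matrix_inv \<Sigma> *v \<theta> + b))
           (matrix_inv (matrix_inv \<Sigma> - 2 *\<^sub>R A))) \<and>
      probability_matching \<Sigma> p (\<lambda>\<theta>. 1) \<and>
      (\<forall>\<pi>. probability_matching \<Sigma> p \<pi> \<longrightarrow> (\<exists>k>0. AE \<theta> in lborel. \<pi> \<theta> = k)))"
proof (intro conjI iffI allI impI)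
  assume "\<exists>\<pi>. probability_matching \<Sigma> p \<pi>"
  then show "\<exists>A b c. log_quadratic_selection \<Sigma> p A b c"
    using matching_imp_log_quadratic[OF assms] by blast
next
  assume "\<exists>A b c. log_quadratic_selection \<Sigma> p A b c"
  then show "\<exists>\<pi>. probability_matching \<Sigma> p \<pi>"
    using flat_prior_matching[OF assms] by blast
next
  fix A b c assume lq: "log_quadratic_selection \<Sigma> p A b c"
  show "selective_measure \<Sigma> p \<theta> =
         gauss_measure (matrix_inv (matrix_inv \<Sigma> - 2 *\<^sub>R A) *v (matrix_inv \<Sigma> *v \<theta> + b))
           (matrix_inv (matrix_inv \<Sigma> - 2 *\<^sub>R A))" for \<theta>
    using selective_measure_eq_gauss_measure[OF assms lq] unfolding prec_def[OF assms lq] .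
  show flat: "probability_matching \<Sigma> p (\<lambda>\<theta>. 1)"
    by (rule flat_prior_matching[OF assms lq])
  show "\<exists>k>0. AE \<theta> in lborel. \<pi> \<theta> = k" if "probability_matching \<Sigma> p \<pi>" for \<pi>
    by (rule matching_prior_unique[OF assms that flat])
qed

end
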